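(* Assume the Exponential-Time Hypothesis (ETH) holds. Then there is no algorithm that solves the \textsc{Point in Cone} problem in time $\mathsf{enc}(\mathcal{P}, q)^{2^{o(d)}}$, where $\mathsf{enc}(\mathcal{P}, q)$ denotes the total number of bits required to encode both the polytope $\mathcal{P}$ (i.e., the matrix $A$ and vector $b$ defining it) and the point $q$.
   Context: For a finite set $X \subseteq \mathbb{R}^d$, its integer cone is $\mathsf{IntCone}(X) = \{\sum_{x\in X}\lambda_x x \mid \lambda_x \in \mathbb{Z}_{\ge 0} \text{ for every } x\in X\}$. A $d$-dimensional polytope is a set $\mathcal{P} = \{x\in\mathbb{R}^d \mid Ax\le b\}$ with $A$ an integer matrix with $d$ columns and $m$ rows and $b\in\mathbb{Z}^m$; its encoding size is the number of bits needed to write $A$ and $b$ in binary. $\mathcal{P}$ is bounded if there is $M$ with $|x(i)|\le M$ for all $x\in\mathcal{P}$ and $i\in\{1,\dots,d\}$. The \textsc{Point in Cone} problem: given a positive integer $d$, a bounded polytope $\mathcal{P}\subseteq\mathbb{R}^d$ (given by $A$ and $b$), and a point $q\in\mathbb{Z}^d$, decide whether $q\in\mathsf{IntCone}(\mathcal{P}\cap\mathbb{Z}^d)$. The Exponential-Time Hypothesis (ETH) states that there is a constant $c>0$ such that \textsc{3-SAT} with $n$ variables cannot be solved in time $\mathcal{O}(2^{cn})$. *)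

theory Defs
  imports Complex_Main "HOL-Library.Landau_Symbols"
begin

text \<open>Tape symbols: 0 = blank, 1 = bit 0, 2 = bit 1, 3 = separator.
  A machine is a transition function  state => symbol => (state, written symbol, move)
  with move in {-1,0,1}; state 0 is the start state, 1 is accepting, 2 is rejecting
  (both halting). A machine is well formed if it has finitely many states and only
  uses the four tape symbols.\<close>

type_synonym sym = nat
type_synonym tm = "nat \<Rightarrow> sym \<Rightarrow> nat \<times> sym \<times> int"
type_synonym config = "nat \<times> (int \<Rightarrow> sym) \<times> int"

definition wf_tm :: "tm \<Rightarrow> bool" where
  "wf_tm M \<longleftrightarrow> (\<exists>Q::nat. 3 \<le> Q \<and> (\<forall>q<Q. \<forall>s<4.
      (case M q s of (q', s', mv) \<Rightarrow> q' < Q \<and> s' < 4 \<and> mv \<in> {-1, 0, 1})))"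

definition tm_step :: "tm \<Rightarrow> config \<Rightarrow> config" where
  "tm_step M c = (case c of (q, t, h) \<Rightarrow>
      if q = 1 \<or> q = 2 then c
      else (case M q (t h) of (q', s', mv) \<Rightarrow> (q', t(h := s'), h + mv)))"

definition tm_init :: "sym list \<Rightarrow> config" where
  "tm_init w = (0, (\<lambda>i. if 0 \<le> i \<and> i < int (length w) then w ! nat i else 0), 0)"

definition tm_run :: "tm \<Rightarrow> sym list \<Rightarrow> nat \<Rightarrow> config" where
  "tm_run M w n = (tm_step M ^^ n) (tm_init w)"

definition decides_within :: "tm \<Rightarrow> sym list \<Rightarrow> real \<Rightarrow> bool \<Rightarrow> bool" where
  "decides_within M w T b \<longleftrightarrow>
     (\<exists>n. real n \<le> T \<and> fst (tm_run M w n) = (if b then 1 else 2))"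

fun bin :: "nat \<Rightarrow> sym list" where
  "bin n = (if n = 0 then [] else bin (n div 2) @ [n mod 2 + 1])"

definition enc_int :: "int \<Rightarrow> sym list" where
  "enc_int z = (if z < 0 then 2 else 1) # bin (nat \<bar>z\<bar>) @ [3]"

definition enc_ints :: "int list \<Rightarrow> sym list" where
  "enc_ints zs = concat (map enc_int zs)"

text \<open>A 3-CNF formula on n variables (numbered 1..n): a list of pairwise distinct
  clauses, each a list of at most 3 literals; literal l > 0 stands for variable l,
  l < 0 for the negation of variable -l.\<close>

definition is_3cnf :: "nat \<Rightarrow> int list list \<Rightarrow> bool" where
  "is_3cnf n cls \<longleftrightarrow> distinct cls \<and>
     (\<forall>C\<in>set cls. length C \<le> 3 \<and> (\<forall>l\<in>set C. l \<noteq> 0 \<and> \<bar>l\<bar> \<le> int n))"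

definition cnf_sat :: "int list list \<Rightarrow> bool" where
  "cnf_sat cls \<longleftrightarrow> (\<exists>\<alpha>::nat \<Rightarrow> bool. \<forall>C\<in>set cls. \<exists>l\<in>set C.
      (l > 0 \<and> \<alpha> (nat l)) \<or> (l < 0 \<and> \<not> \<alpha> (nat (- l))))"

definition enc_3sat :: "nat \<Rightarrow> int list list \<Rightarrow> sym list" where
  "enc_3sat n cls = enc_ints (int n # int (length cls) # concat (map (\<lambda>C. int (length C) # C) cls))"

definition ETH :: bool where
  "ETH \<longleftrightarrow> (\<exists>c::real. c > 0 \<and> \<not> (\<exists>M K. wf_tm M \<and>
      (\<forall>n cls. is_3cnf n cls \<longrightarrow>
          decides_within M (enc_3sat n cls) (K * 2 powr (c * real n)) (cnf_sat cls))))"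

text \<open>Vectors in Z^d / R^d are lists of length d; A is an m x d integer matrix given as a
  list of m rows of length d.\<close>

definition in_poly :: "int list list \<Rightarrow> int list \<Rightarrow> real list \<Rightarrow> bool" where
  "in_poly A b x \<longleftrightarrow> (\<forall>r<length A. (\<Sum>j<length x. real_of_int (A ! r ! j) * x ! j) \<le> real_of_int (b ! r))"

definition poly_bounded :: "nat \<Rightarrow> int list list \<Rightarrow> int list \<Rightarrow> bool" where
  "poly_bounded d A b \<longleftrightarrow> (\<exists>M::real. \<forall>x. length x = d \<and> in_poly A b x \<longrightarrow>
      (\<forall>i<d. \<bar>x ! i\<bar> \<le> M))"

definition int_points :: "nat \<Rightarrow> int list list \<Rightarrow> int list \<Rightarrow> int list set" where
  "int_points d A b = {x. length x = d \<and> in_poly A b (map real_of_int x)}"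

definition IntCone :: "nat \<Rightarrow> int list set \<Rightarrow> int list set" where
  "IntCone d X = {q. length q = d \<and> (\<exists>cf::int list \<Rightarrow> nat. finite {x\<in>X. cf x \<noteq> 0} \<and>
      (\<forall>i<d. q ! i = (\<Sum>x\<in>{x\<in>X. cf x \<noteq> 0}. int (cf x) * x ! i)))}"

definition pic_instance :: "nat \<Rightarrow> int list list \<Rightarrow> int list \<Rightarrow> int list \<Rightarrow> bool" where
  "pic_instance d A b q \<longleftrightarrow> d > 0 \<and> length b = length A \<and> (\<forall>r\<in>set A. length r = d)
     \<and> length q = d \<and> poly_bounded d A b"

definition pic_answer :: "nat \<Rightarrow> int list list \<Rightarrow> int list \<Rightarrow> int list \<Rightarrow> bool" where
  "pic_answer d A b q \<longleftrightarrow> q \<in> IntCone d (int_points d A b)"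

text \<open>Input encoding; its length plays the role of enc(P,q).\<close>
definition enc_pic :: "nat \<Rightarrow> int list list \<Rightarrow> int list \<Rightarrow> int list \<Rightarrow> sym list" where
  "enc_pic d A b q = enc_ints ([int d, int (length A)] @ concat A @ b @ q)"

end

theory Submission
  imports Defs "HOL-Real_Asymp.Real_Asymp"
begin

text \<open>Selecting one literal occurrence per clause so that no two selected literals are opposite is a
  system of linear equations over the natural numbers: the occurrences of each clause sum up to 1, and
  for each occurrence o we have G x(o) + (sum of x(o') over the occurrences o' opposite to o) + s(o) = G,
  where G is large and s(o) is a slack variable. Writing the equations as the digits of numbers in a
  base too large for carries turns the system into sum lam(i) v(i) = t subject to sum lam(i) = T. All
  v(i) have the same leading digit 1, so that v(i) is at most 2 v(i') for all i, i'.

  The items i are the vertices of a cube of dimension k = O(log n). If D(i, x) is the Hamming distance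
  of x from i (linear in the bits of x and their complements), then the inequalities
  v(i) (c - D(i, x)) <= y <= v(i) (c + D(i, x)) for all i leave exactly the integer points with
  y = c v(x), where c is 0 or 1. The points with c = 0 are used to fill up the coordinates of the bits,
  so that (T, ..., T, t) lies in the integer cone iff the equation is solvable. As the dimension is
  d = 2k + 2, an algorithm running in time enc to the power of 2 to the o(d) would decide 3-SAT in time
  2 to the o(n).

  The Turing machine for the reduction is compiled from a language whose programs produce a string by
  nested loops over the lengths of strings produced before. Such programs need only polynomially many
  steps, whatever they compute. They are executed with several stacks, which are stored in the
  residue classes of the negative tape cells.\<close>

section \<open>Stack programs and their representation on a tape\<close>

text \<open>The obstacle is to make 2^k unrelated large numbers the heights of the integer points of
  a polytope of dimension O(k). Two rows per number do this because the rows of i are slack at every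
  other vertex: there the distance is at least 1, so the lower bound is at most 0 and the upper
  bound with c = 1 is at least 2 v(i), which is where the factor 2 comes from. Having 2^k rows is
  affordable, since 2^k is itself only linear in the length of the formula. Each bit is kept next to
  its complement. This makes the distance a linear form without constant term, and it lets the
  vertex i with c = 1 and the opposite vertex with c = 0 add up to the vector (1, ..., 1, v(i)),
  whatever i is. ETH measures time in the number n of variables. As the clauses are distinct and
  have at most three literals, the formula, the instance and 2^d are all bounded by powers of n + 2.
  Hence f in o(d) gives 2^f(d) = O((n + 2)^(1/2)), and the assumed algorithm needs only (n + 2)^O((n
  + 2)^(1/2)) steps. Any fixed polynomial overhead is harmless, so the encodings favour simple loops
  over short strings.\<close>

definition rd :: "nat list \<Rightarrow> nat \<Rightarrow> nat" where
  "rd xs i = (if i < length xs then xs ! i else 0)"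

text \<open>\<open>ReadI i j\<close> takes its index in unary, as the height of stack j. On the tape
  this is cheap: with all stacks but 0 spaced by the same stride, the head at the end of stack j
  reaches the corresponding cell of stack i by one fixed shift. The result 0 of \<open>rd\<close>
  beyond the end is the blank symbol.\<close>

datatype instr = PushI nat nat | PopI nat | ReadI nat nat

text \<open>Only the values of a continuation at the four symbols 0, ..., 3 matter, so a program has
  finitely many points of control although continuations are functions.\<close>

datatype cmd = Skip | Do instr "nat \<Rightarrow> cmd" | Seq cmd cmd | Loop instr "nat set" "nat \<Rightarrow> cmd"

type_synonym store = "nat \<Rightarrow> nat list"

fun istep :: "instr \<Rightarrow> store \<Rightarrow> nat \<times> store" where
  "istep (PushI j a) s = (0, s(j := s j @ [a]))"
| "istep (PopI j) s = (if s j = [] then 0 else last (s j), s(j := butlast (s j)))"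
| "istep (ReadI i j) s = (rd (s i) (length (s j)), s)"

inductive exec :: "cmd \<Rightarrow> store \<Rightarrow> nat \<Rightarrow> store \<Rightarrow> bool" where
  exec_Skip: "exec Skip s 1 s"
| exec_Do: "istep q s = (r, s1) \<Longrightarrow> exec (f r) s1 n s2 \<Longrightarrow> exec (Do q f) s (n + 1) s2"
| exec_Seq: "exec a s n1 s1 \<Longrightarrow> exec b s1 n2 s2 \<Longrightarrow> exec (Seq a b) s (n1 + n2 + 1) s2"
| exec_LoopE: "istep q s = (r, s1) \<Longrightarrow> r \<in> E \<Longrightarrow> exec (Loop q E f) s 1 s1"
| exec_LoopC: "istep q s = (r, s1) \<Longrightarrow> r \<notin> E \<Longrightarrow> exec (f r) s1 n1 s2 \<Longrightarrow>
    exec (Loop q E f) s2 n2 s3 \<Longrightarrow> exec (Loop q E f) s (n1 + n2 + 1) s3"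

text \<open>A pushed symbol is never 0, as a blank marks the end of a stack. \<open>ReadI\<close>
  excludes stack 0, which grows in the opposite direction with stride 1.\<close>

fun wf_instr :: "nat \<Rightarrow> instr \<Rightarrow> bool" where
  "wf_instr K (PushI j a) \<longleftrightarrow> j < K \<and> 0 < a \<and> a < 4"
| "wf_instr K (PopI j) \<longleftrightarrow> j < K"
| "wf_instr K (ReadI i j) \<longleftrightarrow> 0 < i \<and> i < K \<and> 0 < j \<and> j < K"

primrec wf_cmd :: "nat \<Rightarrow> cmd \<Rightarrow> bool" where
  "wf_cmd K Skip \<longleftrightarrow> True"
| "wf_cmd K (Do q f) \<longleftrightarrow> wf_instr K q \<and> (\<forall>r<4. wf_cmd K (f r))"
| "wf_cmd K (Seq a b) \<longleftrightarrow> wf_cmd K a \<and> wf_cmd K b"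
| "wf_cmd K (Loop q E f) \<longleftrightarrow> wf_instr K q \<and> (\<forall>r<4. wf_cmd K (f r))"

definition wf_store :: "nat \<Rightarrow> store \<Rightarrow> bool" where
  "wf_store K s \<longleftrightarrow> (\<forall>j. set (s j) \<subseteq> {1, 2, 3} \<and> (K \<le> j \<longrightarrow> s j = []))"

definition store_size :: "nat \<Rightarrow> store \<Rightarrow> nat" where
  "store_size K s = (\<Sum>j<K. length (s j))"

lemma length_le_store_size: "j < K \<Longrightarrow> length (s j) \<le> store_size K s"
  unfolding store_size_def by (rule member_le_sum) auto

lemma rd_set: "rd xs i \<in> insert 0 (set xs)"
  by (auto simp: rd_def)

lemma wf_store_rd_less: "wf_store K s \<Longrightarrow> rd (s j) i < 4"
proof -
  assume "wf_store K s"
  then have "set (s j) \<subseteq> {1, 2, 3}" by (auto simp: wf_store_def)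
  then have "rd (s j) i \<in> {0, 1, 2, 3}" using rd_set[of "s j" i] by blast
  then show ?thesis by auto
qed

lemma wf_store_upd: "wf_store K s \<Longrightarrow> j < K \<Longrightarrow> set ys \<subseteq> {1,2,3} \<Longrightarrow> wf_store K (s(j := ys))"
  by (auto simp: wf_store_def)

lemma istep_wf:
  assumes "istep q s = (r, s')" "wf_instr K q" "wf_store K s"
  shows "r < 4" "wf_store K s'" "store_size K s' \<le> store_size K s + 1"
proof -
  have A: "r < 4 \<and> wf_store K s'"
  proof (cases q)
    case (PushI j a)
    then have "a \<in> {1, 2, 3}" "j < K" using assms(2) by auto
    moreover have "set (s j) \<subseteq> {1, 2, 3}" using assms(3) by (auto simp: wf_store_def)
    ultimately show ?thesis using PushI assms by (auto intro!: wf_store_upd)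
  next
    case (PopI j)
    have sj: "set (s j) \<subseteq> {1,2,3}" using assms(3) by (simp add: wf_store_def)
    then have "set (butlast (s j)) \<subseteq> {1,2,3}" by (meson in_set_butlastD subset_iff)
    moreover have "s j \<noteq> [] \<Longrightarrow> last (s j) < 4" using sj last_in_set[of "s j"] by fastforce
    ultimately show ?thesis using PopI assms by (auto intro!: wf_store_upd)
  next
    case (ReadI i j)
    then show ?thesis using assms wf_store_rd_less by auto
  qed
  then show "r < 4" "wf_store K s'" by auto
  have upd: "store_size K (s(j := ys)) \<le> store_size K s + 1"
    if "length ys \<le> length (s j) + 1" for j ys
  proof (cases "j < K")
    case True
    then show ?thesis using that unfolding store_size_def
      by (simp add: sum.remove[of "{..<K}" j] cong: sum.cong_simp)
  next
    case False
    then show ?thesis unfolding store_size_def by (auto intro!: le_SucI sum_mono)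
  qed
  show "store_size K s' \<le> store_size K s + 1"
    using assms(1) upd[of "s j @ [a]" j for a j] upd[of "butlast (s j)" j for j] by (cases q) auto
qed

text \<open>Stack 0 occupies the cells 0, 1, 2, ... in plain form; the other stacks are the residue
  classes modulo K of the negative cells. The cells of level 0, which include the cell -1 where
  the head rests between instructions, are always blank and delimit the stacks.\<close>

definition tape :: "nat \<Rightarrow> store \<Rightarrow> int \<Rightarrow> nat" where
  "tape K s i = (if 0 \<le> i then rd (s 0) (nat i)
     else let m = nat (- 1 - i) in
       if m mod K = 0 \<or> m div K = 0 then 0 else rd (s (m mod K)) (m div K - 1))"

definition base :: "nat \<Rightarrow> int" where
  "base j = - 1 - int j"

definition stride :: "nat \<Rightarrow> nat \<Rightarrow> int" where
  "stride K j = (if j = 0 then 1 else - int K)"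

text \<open>Level 0 is the delimiter, and the symbol with index p lies at level p + 1. As
  \<open>base 0\<close> is -1, the resting cell of the head is also level 0 of stack 0, so the same
  formula serves all stacks.\<close>

definition addr :: "nat \<Rightarrow> nat \<Rightarrow> nat \<Rightarrow> int" where
  "addr K j p = base j + stride K j * int p"

lemma addr_Suc: "addr K j (Suc p) = addr K j p + stride K j"
  by (simp add: addr_def algebra_simps)

lemma addr_0: "addr K j 0 = base j"
  by (simp add: addr_def)

lemma nat_addr: "0 < j \<Longrightarrow> nat (- 1 - addr K j p) = K * p + j"
proof -
  assume "0 < j"
  then have "- 1 - addr K j p = int (K * p + j)"
    by (simp add: addr_def base_def stride_def)
  then show ?thesis by (metis nat_int)
qed

lemma tape_addr:
  assumes "j < K"
  shows "tape K s (addr K j p) = (if p = 0 then 0 else rd (s j) (p - 1))"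
proof (cases "j = 0")
  case True
  show ?thesis
  proof (cases p)
    case 0
    then show ?thesis using True by (simp add: addr_def tape_def base_def)
  next
    case (Suc p')
    then show ?thesis using True by (simp add: addr_def tape_def base_def stride_def)
  qed
next
  case False
  then have neg: "\<not> 0 \<le> addr K j p"
    by (simp add: addr_def base_def stride_def not_le) (smt (verit) mult_nonneg_nonneg of_nat_0_le_iff)
  have m: "(K * p + j) mod K = j" "(K * p + j) div K = p" using assms by simp_all
  show ?thesis using neg False
    by (simp only: tape_def nat_addr Let_def m) (use assms in simp)
qed

lemma tape_upd:
  assumes "j < K" "rd ys p = a" "\<And>p'. p' \<noteq> p \<Longrightarrow> rd ys p' = rd (s j) p'"
  shows "tape K (s(j := ys)) = (tape K s)(addr K j (Suc p) := a)"
proof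
  fix i
  show "tape K (s(j := ys)) i = ((tape K s)(addr K j (Suc p) := a)) i"
  proof (cases "i = addr K j (Suc p)")
    case True
    then show ?thesis using assms by (simp add: tape_addr)
  next
    case False
    show ?thesis
    proof (cases "0 \<le> i")
      case True
      then have "j = 0 \<Longrightarrow> nat i \<noteq> p" using False
        by (auto simp: addr_def base_def stride_def)
      then show ?thesis using True False assms by (auto simp: tape_def)
    next
      case neg: False
      define m where "m = nat (- 1 - i)"
      have i: "i = - 1 - int m" using neg by (simp add: m_def)
      have "m div K - 1 \<noteq> p" if "m mod K = j" "m div K \<noteq> 0" "j \<noteq> 0"
      proof
        assume "m div K - 1 = p"
        then have "m div K = Suc p" using that by simp
        then have "m = K * Suc p + j" using that by (metis mult_div_mod_eq)
        then have "i = addr K j (Suc p)" using i that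
          by (simp add: addr_def base_def stride_def algebra_simps)
        then show False using False by simp
      qed
      then show ?thesis using neg False assms
        by (auto simp: tape_def m_def[symmetric] Let_def)
    qed
  qed
qed

lemma tape_push:
  assumes "j < K"
  shows "tape K (s(j := s j @ [a])) = (tape K s)(addr K j (Suc (length (s j))) := a)"
  by (rule tape_upd[OF assms]) (auto simp: rd_def nth_append)

lemma tape_pop:
  assumes "j < K" "s j \<noteq> []"
  shows "tape K (s(j := butlast (s j))) = (tape K s)(addr K j (length (s j)) := 0)"
proof -
  have len: "Suc (length (s j) - 1) = length (s j)" using assms(2) by simp
  have "rd (butlast (s j)) p' = rd (s j) p'" if "p' \<noteq> length (s j) - 1" for p'
    using that by (auto simp: rd_def nth_butlast)
  moreover have "rd (butlast (s j)) (length (s j) - 1) = 0" by (simp add: rd_def)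
  ultimately show ?thesis
    using tape_upd[OF assms(1), of "butlast (s j)" "length (s j) - 1" 0 s] unfolding len by blast
qed

section \<open>Turing machines over an arbitrary state type\<close>

definition gstep :: "('q \<Rightarrow> nat \<Rightarrow> 'q \<times> nat \<times> int) \<Rightarrow> 'q \<times> (int \<Rightarrow> nat) \<times> int \<Rightarrow> 'q \<times> (int \<Rightarrow> nat) \<times> int" where
  "gstep \<delta> = (\<lambda>(x, t, h). case \<delta> x (t h) of (x', a, mv) \<Rightarrow> (x', t(h := a), h + mv))"

text \<open>The machine model fixes the numbers 0, 1, 2 for start, acceptance and rejection; the
  numbering of an abstract state set has to respect this.\<close>

lemma bij_prescribed:
  assumes "finite S" "st \<in> S" "acc \<in> S" "rej \<in> S" "distinct [st, acc, rej]"
  obtains h :: "'q \<Rightarrow> nat" where "inj_on h S" "h ` S = {..<card S}" "h st = 0" "h acc = 1" "h rej = 2" "3 \<le> card S"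
proof -
  let ?S = "S - {st, acc, rej}"
  obtain g where g: "bij_betw g ?S {0..<card ?S}"
    using assms(1) ex_bij_betw_finite_nat finite_Diff by blast
  define h where "h x = (if x = st then 0 else if x = acc then 1 else if x = rej then 2 else g x + 3)" for x
  have card: "card S = card ?S + 3"
  proof -
    have "card ?S = card S - card {st, acc, rej}" by (rule card_Diff_subset) (use assms in auto)
    moreover have "card {st, acc, rej} = 3" using assms by simp
    moreover have "card {st, acc, rej} \<le> card S" by (rule card_mono) (use assms in auto)
    ultimately show ?thesis by simp
  qed
  have g_inj: "inj_on g ?S" and g_less: "\<And>x. x \<in> ?S \<Longrightarrow> g x < card ?S"
    using g by (auto simp: bij_betw_def)
  have inj: "inj_on h S"
  proof (rule inj_onI)
    fix x y assume xy: "x \<in> S" "y \<in> S" "h x = h y"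
    then have "x \<in> ?S \<and> y \<in> ?S \<and> g x = g y \<or> x = y" using assms(5)
      by (simp add: h_def split: if_splits)
    then show "x = y" using g_inj by (meson inj_onD)
  qed
  have "h ` S \<subseteq> {..<card S}"
  proof
    fix y assume "y \<in> h ` S"
    then obtain x where x: "x \<in> S" "y = h x" by auto
    show "y \<in> {..<card S}"
    proof (cases "x \<in> ?S")
      case True
      then show ?thesis using x g_less[OF True] unfolding card by (simp add: h_def)
    next
      case False
      then show ?thesis using x unfolding card by (auto simp: h_def)
    qed
  qed
  moreover have "card (h ` S) = card S" using inj by (rule card_image)
  ultimately have "h ` S = {..<card S}" by (simp add: card_subset_eq)
  moreover have "3 \<le> card S" using card by linarith
  moreover have "h st = 0" "h acc = 1" "h rej = 2" using assms(5) by (auto simp: h_def)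
  ultimately show thesis using that[OF inj] by blast
qed

text \<open>\<open>tm_step\<close> freezes in the states 1 and 2, whereas \<open>gstep\<close> never
  stops. Making \<open>acc\<close> and \<open>rej\<close> fixed points of the transition function
  lets both iterations agree after every number of steps.\<close>

lemma gtm_to_tm:
  fixes \<delta> :: "'q \<Rightarrow> nat \<Rightarrow> 'q \<times> nat \<times> int"
  assumes S: "finite S" "st \<in> S" "acc \<in> S" "rej \<in> S" "distinct [st, acc, rej]"
    and closed: "\<And>x a x' a' mv. x \<in> S \<Longrightarrow> a < 4 \<Longrightarrow> \<delta> x a = (x', a', mv) \<Longrightarrow> x' \<in> S \<and> a' < 4 \<and> mv \<in> {-1, 0, 1}"
    and halt: "\<And>a. \<delta> acc a = (acc, a, 0)" "\<And>a. \<delta> rej a = (rej, a, 0)"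
  obtains M where "wf_tm M"
    "\<And>w n b. set w \<subseteq> {..<4} \<Longrightarrow>
       fst ((gstep \<delta> ^^ n) (st, snd (tm_init w))) = (if b then acc else rej) \<Longrightarrow>
       fst (tm_run M w n) = (if b then 1 else 2)"
proof -
  obtain h :: "'q \<Rightarrow> nat" where h: "inj_on h S" "h ` S = {..<card S}" "h st = 0" "h acc = 1" "h rej = 2" "3 \<le> card S"
    using bij_prescribed[OF S] by metis
  define hi where "hi = inv_into S h"
  have hi: "hi (h x) = x" if "x \<in> S" for x using that h(1) by (simp add: hi_def)
  have hi_in: "hi q \<in> S" if "q < card S" for q
    using that h(2) by (metis hi_def inv_into_into lessThan_iff)
  define M :: tm where "M q a = (case \<delta> (hi q) a of (x', a', mv) \<Rightarrow> (h x', a', mv))" for q a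
  have wf: "wf_tm M"
    unfolding wf_tm_def
  proof (intro exI[of _ "card S"] conjI allI impI)
    show "3 \<le> card S" by fact
    fix q a :: nat assume "q < card S" "a < 4"
    obtain x' a' mv where d: "\<delta> (hi q) a = (x', a', mv)" by (cases "\<delta> (hi q) a")
    then have "x' \<in> S \<and> a' < 4 \<and> mv \<in> {-1, 0, 1}"
      using closed hi_in \<open>q < card S\<close> \<open>a < 4\<close> by blast
    moreover then have "h x' < card S" using h(2) by blast
    ultimately show "case M q a of (q', s', mv) \<Rightarrow> q' < card S \<and> s' < 4 \<and> mv \<in> {- 1, 0, 1}"
      by (simp add: M_def d)
  qed
  have sim: "case (gstep \<delta> ^^ n) (st, snd (tm_init w)) of (x, t, p) \<Rightarrow>
      x \<in> S \<and> (\<forall>i. t i < 4) \<and> tm_run M w n = (h x, t, p)" if w: "set w \<subseteq> {..<4}" for w n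
  proof (induction n)
    case 0
    have "w ! nat i < 4" if "0 \<le> i" "i < int (length w)" for i
    proof -
      have "w ! nat i \<in> set w" using that by (intro nth_mem) linarith
      then show ?thesis using w by blast
    qed
    then show ?case using S h(3) by (auto simp: tm_run_def tm_init_def)
  next
    case (Suc n)
    obtain x t p where c: "(gstep \<delta> ^^ n) (st, snd (tm_init w)) = (x, t, p)"
      by (cases "(gstep \<delta> ^^ n) (st, snd (tm_init w))")
    then have IH: "x \<in> S" "\<And>i. t i < 4" "tm_run M w n = (h x, t, p)" using Suc by auto
    obtain x' a' mv where d: "\<delta> x (t p) = (x', a', mv)" by (cases "\<delta> x (t p)")
    have cl: "x' \<in> S" "a' < 4" using closed[OF IH(1) IH(2) d] by auto
    have run: "tm_run M w (Suc n) = tm_step M (h x, t, p)" using IH(3) by (simp add: tm_run_def)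
    have "tm_step M (h x, t, p) = (h x', t(p := a'), p + mv)"
    proof (cases "x = acc \<or> x = rej")
      case True
      then have "x' = x" "a' = t p" "mv = 0" using d halt by auto
      then show ?thesis using True h by (auto simp: tm_step_def)
    next
      case False
      then have "h x \<noteq> 1 \<and> h x \<noteq> 2" using h(1,4,5) S IH(1) by (metis inj_onD)
      then show ?thesis by (simp add: tm_step_def M_def hi IH(1) d)
    qed
    then show ?case using cl IH c d run by (simp add: gstep_def)
  qed
  show thesis
  proof (rule that[OF wf])
    fix w :: "nat list" and n :: nat and b :: bool assume w: "set w \<subseteq> {..<4}"
      and f: "fst ((gstep \<delta> ^^ n) (st, snd (tm_init w))) = (if b then acc else rej)"
    have "fst (tm_run M w n) = h (fst ((gstep \<delta> ^^ n) (st, snd (tm_init w))))"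
      using sim[OF w, of n] by (auto split: prod.splits)
    then show "fst (tm_run M w n) = (if b then 1 else 2)" using f h by simp
  qed
qed

text \<open>A transition function with moves of arbitrary length is run by a machine with unit moves
  that keeps the rest of the current move in its state.\<close>

definition unit_moves :: "('q \<Rightarrow> nat \<Rightarrow> 'q \<times> nat \<times> int) \<Rightarrow> int \<times> 'q \<Rightarrow> nat \<Rightarrow> (int \<times> 'q) \<times> nat \<times> int" where
  "unit_moves \<delta> = (\<lambda>(m, x) a. if m > 0 then ((m - 1, x), a, 1) else if m < 0 then ((m + 1, x), a, - 1)
     else (case \<delta> x a of (x', a', mv) \<Rightarrow> ((mv, x'), a', 0)))"

text \<open>Both configurations have no pending move. The bound on the number of unit steps is only
  an upper one, so that estimates can be weakened when runs are concatenated.\<close>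

definition reach :: "('q \<Rightarrow> nat \<Rightarrow> 'q \<times> nat \<times> int) \<Rightarrow> nat \<Rightarrow> 'q \<times> (int \<Rightarrow> nat) \<times> int \<Rightarrow> 'q \<times> (int \<Rightarrow> nat) \<times> int \<Rightarrow> bool" where
  "reach \<delta> n c c' \<longleftrightarrow> (\<exists>k\<le>n. case c of (x, t, h) \<Rightarrow> case c' of (x', t', h') \<Rightarrow>
      (gstep (unit_moves \<delta>) ^^ k) ((0, x), t, h) = ((0, x'), t', h'))"

lemma reach_refl: "reach \<delta> n c c"
  by (auto simp: reach_def split: prod.splits intro: exI[of _ 0])

lemma reach_trans:
  assumes "reach \<delta> m a b" "reach \<delta> n b c" shows "reach \<delta> (m + n) a c"
proof -
  obtain x t h x' t' h' x'' t'' h'' where e: "a = (x,t,h)" "b = (x',t',h')" "c = (x'',t'',h'')"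
    by (cases a; cases b; cases c)
  obtain k l where k: "k \<le> m" "(gstep (unit_moves \<delta>) ^^ k) ((0, x), t, h) = ((0, x'), t', h')"
    and l: "l \<le> n" "(gstep (unit_moves \<delta>) ^^ l) ((0, x'), t', h') = ((0, x''), t'', h'')"
    using assms by (auto simp: reach_def e)
  have "(gstep (unit_moves \<delta>) ^^ (l + k)) ((0, x), t, h) = ((0, x''), t'', h'')"
    using k l by (simp add: funpow_add)
  then show ?thesis using k(1) l(1) by (auto simp: reach_def e intro!: exI[of _ "l + k"])
qed

lemma reach_mono: "reach \<delta> m a b \<Longrightarrow> m \<le> n \<Longrightarrow> reach \<delta> n a b"
  unfolding reach_def by (meson order_trans)

lemma unit_moves_walk: "(gstep (unit_moves \<delta>) ^^ nat \<bar>m\<bar>) ((m, x), t, h) = ((0, x), t, h + m)"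
proof (induction "nat \<bar>m\<bar>" arbitrary: m h)
  case 0
  then show ?case by simp
next
  case (Suc n)
  show ?case
  proof (cases "m > 0")
    case True
    then have "n = nat \<bar>m - 1\<bar>" using Suc(2) by simp
    from Suc(1)[OF this, of "h + 1"] show ?thesis using True Suc(2)[symmetric] \<open>n = nat \<bar>m - 1\<bar>\<close>[symmetric]
      by (simp add: funpow_Suc_right gstep_def unit_moves_def del: funpow.simps)
  next
    case False
    then have m: "m < 0" "n = nat \<bar>m + 1\<bar>" using Suc(2) by simp_all
    from Suc(1)[OF m(2), of "h - 1"] show ?thesis using m(1) Suc(2)[symmetric] m(2)[symmetric]
      by (simp add: funpow_Suc_right gstep_def unit_moves_def del: funpow.simps)
  qed
qed

lemma reach_step:
  assumes "\<delta> x (t h) = (x', a, mv)" "\<bar>mv\<bar> \<le> int D"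
  shows "reach \<delta> (D + 1) (x, t, h) (x', t(h := a), h + mv)"
proof -
  have "(gstep (unit_moves \<delta>) ^^ (Suc (nat \<bar>mv\<bar>))) ((0, x), t, h) = ((0, x'), t(h := a), h + mv)"
    using unit_moves_walk[where \<delta> = \<delta> and m = mv and x = x' and t = "t(h := a)" and h = h]
    by (simp add: funpow_Suc_right gstep_def unit_moves_def assms(1) del: funpow.simps)
  then show ?thesis using assms(2) unfolding reach_def
    by (intro exI[of _ "Suc (nat \<bar>mv\<bar>)"]) auto
qed

section \<open>Running a stack program and a machine one after the other\<close>

text \<open>In \<open>Ctl\<close> the head rests at cell -1 and the state holds the commands still
  to be executed. \<open>Seek\<close> walks to the first blank of the main stack;
  \<open>Take\<close> inspects the top symbol for a pop; \<open>Look\<close> stands on the stack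
  being read; \<open>Back r\<close> returns to level 0 with the result r. \<open>Sim\<close> runs
  the second machine.\<close>

datatype core = Start | Ctl "cmd list" | Seek "cmd list" | Take "cmd list" | Look "cmd list"
  | Back nat "cmd list" | Sim nat

fun cur_instr :: "cmd list \<Rightarrow> instr" where
  "cur_instr (Do q f # ks) = q"
| "cur_instr (Loop q E f # ks) = q"
| "cur_instr ks = PopI 0"

fun cont :: "cmd list \<Rightarrow> nat \<Rightarrow> cmd list" where
  "cont (Do q f # ks) r = f r # ks"
| "cont (Loop q E f # ks) r = (if r \<in> E then ks else f r # Loop q E f # ks)"
| "cont ks r = ks"

fun main_stack :: "instr \<Rightarrow> nat" where
  "main_stack (PushI j a) = j"
| "main_stack (PopI j) = j"
| "main_stack (ReadI i j) = j"

fun seek_end :: "nat \<Rightarrow> cmd list \<Rightarrow> instr \<Rightarrow> core \<times> nat \<times> int" where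
  "seek_end K ks (PushI j b) = (Back 0 ks, b, - stride K j)"
| "seek_end K ks (PopI j) = (Take ks, 0, - stride K j)"
| "seek_end K ks (ReadI i j) = (Look ks, 0, base i - base j)"

fun look_shift :: "instr \<Rightarrow> int" where
  "look_shift (ReadI i j) = base j - base i"
| "look_shift q = 0"

text \<open>The shifts are relative to the resting cell -1: the offset \<open>addr ... 1 + 1\<close>
  leads from there to level 1 of the main stack, and \<open>- 1 - base\<close> leads back from level
  0.\<close>

fun delta :: "nat \<Rightarrow> cmd \<Rightarrow> tm \<Rightarrow> core \<Rightarrow> nat \<Rightarrow> core \<times> nat \<times> int" where
  "delta K c M Start a = (Ctl [c], a, - 1)"
| "delta K c M (Ctl []) a = (Sim 0, a, 1)"
| "delta K c M (Ctl (Skip # ks)) a = (Ctl ks, a, 0)"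
| "delta K c M (Ctl (Seq x y # ks)) a = (Ctl (x # y # ks), a, 0)"
| "delta K c M (Ctl ks) a = (Seek ks, a, addr K (main_stack (cur_instr ks)) 1 + 1)"
| "delta K c M (Seek ks) a = (if a \<noteq> 0 then (Seek ks, a, stride K (main_stack (cur_instr ks)))
     else seek_end K ks (cur_instr ks))"
| "delta K c M (Take ks) a = (if a = 0 then (Ctl (cont ks 0), 0, - 1 - base (main_stack (cur_instr ks)))
     else (Back a ks, 0, - stride K (main_stack (cur_instr ks))))"
| "delta K c M (Look ks) a = (Back a ks, a, look_shift (cur_instr ks) - stride K (main_stack (cur_instr ks)))"
| "delta K c M (Back r ks) a = (if a = 0 then (Ctl (cont ks r), 0, - 1 - base (main_stack (cur_instr ks)))
     else (Back r ks, a, - stride K (main_stack (cur_instr ks))))"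
| "delta K c M (Sim m) a = (if m = 1 \<or> m = 2 then (Sim m, a, 0) else
     case M m a of (m', a', mv) \<Rightarrow> (Sim m', a', mv))"

definition max_move :: "nat \<Rightarrow> nat" where
  "max_move K = 2 * K + 2"

lemma stride_bound: "0 < K \<Longrightarrow> \<bar>stride K j\<bar> \<le> int K"
  by (auto simp: stride_def)

lemma base_bound: "j < K \<Longrightarrow> \<bar>base j\<bar> \<le> int K"
  by (auto simp: base_def)

lemma main_stack_less: "wf_instr K q \<Longrightarrow> main_stack q < K"
  by (cases q) auto

lemma nth_nonzero: "wf_store K s \<Longrightarrow> p < length (s j) \<Longrightarrow> s j ! p \<noteq> 0"
proof -
  assume a: "wf_store K s" "p < length (s j)"
  then have "s j ! p \<in> {1,2,3}" unfolding wf_store_def using nth_mem by blast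
  then show ?thesis by auto
qed

text \<open>The walk stops at the right place because symbols on a stack are nonblank; each level
  costs at most K unit moves and the step that chooses them.\<close>

lemma seek_reach:
  assumes "wf_store K s" "j < K" "j = main_stack (cur_instr ks)" "p \<le> length (s j)"
  shows "reach (delta K c M) ((K + 1) * p) (Seek ks, tape K s, addr K j 1) (Seek ks, tape K s, addr K j (Suc p))"
  using assms(4)
proof (induction p)
  case 0
  then show ?case by (simp add: reach_refl)
next
  case (Suc p)
  have t: "tape K s (addr K j (Suc p)) \<noteq> 0"
    using Suc.prems assms nth_nonzero[OF assms(1)] by (simp add: tape_addr rd_def)
  have "reach (delta K c M) (K + 1) (Seek ks, tape K s, addr K j (Suc p))
      (Seek ks, (tape K s)(addr K j (Suc p) := tape K s (addr K j (Suc p))), addr K j (Suc p) + stride K j)"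
    by (rule reach_step) (use t assms stride_bound[of K j] in auto)
  then have "reach (delta K c M) (K + 1) (Seek ks, tape K s, addr K j (Suc p)) (Seek ks, tape K s, addr K j (Suc (Suc p)))"
    by (simp add: addr_Suc)
  then show ?case using reach_trans[OF Suc.IH] Suc.prems by (fastforce simp: algebra_simps)
qed

lemma back_reach:
  assumes "wf_store K s" "j < K" "j = main_stack (cur_instr ks)" "p \<le> length (s j)"
  shows "reach (delta K c M) ((K + 1) * (p + 1)) (Back r ks, tape K s, addr K j p) (Ctl (cont ks r), tape K s, - 1)"
  using assms(4)
proof (induction p)
  case 0
  have "reach (delta K c M) (K + 1) (Back r ks, tape K s, addr K j 0)
      (Ctl (cont ks r), (tape K s)(addr K j 0 := 0), addr K j 0 + (- 1 - base j))"
    by (rule reach_step) (use assms in \<open>auto simp: tape_addr base_def\<close>)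
  moreover have "(tape K s)(addr K j 0 := 0) = tape K s"
    using assms by (auto simp: fun_eq_iff tape_addr)
  ultimately show ?case by (simp add: addr_0)
next
  case (Suc p)
  have t: "tape K s (addr K j (Suc p)) \<noteq> 0"
    using Suc.prems assms nth_nonzero[OF assms(1)] by (simp add: tape_addr rd_def)
  have "reach (delta K c M) (K + 1) (Back r ks, tape K s, addr K j (Suc p))
      (Back r ks, (tape K s)(addr K j (Suc p) := tape K s (addr K j (Suc p))), addr K j (Suc p) + (- stride K j))"
    by (rule reach_step) (use t assms stride_bound[of K j] in auto)
  then have "reach (delta K c M) (K + 1) (Back r ks, tape K s, addr K j (Suc p)) (Back r ks, tape K s, addr K j p)"
    by (simp add: addr_Suc)
  then show ?case using reach_trans[OF _ Suc.IH] Suc.prems by (fastforce simp: algebra_simps)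
qed

definition is_instr :: "cmd \<Rightarrow> bool" where
  "is_instr c \<longleftrightarrow> (\<exists>q f. c = Do q f) \<or> (\<exists>q E f. c = Loop q E f)"

text \<open>One instruction walks up the main stack and down again, at K + 1 unit steps per level,
  and makes at most three further moves of length at most 2 K.\<close>

lemma instr_reach:
  assumes wf: "wf_store K s" "wf_instr K q" and ks: "ks = x # ks'" "is_instr x" and q: "q = cur_instr ks"
    and st: "istep q s = (r, s')"
  shows "reach (delta K c M) (10 * (K + 1) * (store_size K s + 2)) (Ctl ks, tape K s, - 1) (Ctl (cont ks r), tape K s', - 1)"
proof -
  define j where "j = main_stack q"
  define L where "L = length (s j)"
  have jK: "j < K" using wf main_stack_less j_def by simp
  have j: "j = main_stack (cur_instr ks)" by (simp add: j_def q)
  have L: "L \<le> store_size K s" using jK length_le_store_size L_def by simp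
  have d: "delta K c M (Ctl ks) a = (Seek ks, a, addr K j 1 + 1)" for a
    using ks j by (auto simp: is_instr_def)
  have small: "\<bar>addr K j 1 + 1\<bar> \<le> int (2 * K)" "\<bar>stride K j\<bar> \<le> int (2 * K)"
    using jK by (auto simp: addr_def base_def stride_def)
  have "reach (delta K c M) (2 * K + 1) (Ctl ks, tape K s, - 1)
     (Seek ks, (tape K s)(- 1 := tape K s (- 1)), - 1 + (addr K j 1 + 1))"
    by (rule reach_step) (use d small in auto)
  then have 1: "reach (delta K c M) (2 * K + 1) (Ctl ks, tape K s, - 1) (Seek ks, tape K s, addr K j 1)" by simp
  have 2: "reach (delta K c M) ((K + 1) * L) (Seek ks, tape K s, addr K j 1) (Seek ks, tape K s, addr K j (Suc L))"
    by (rule seek_reach[OF wf(1) jK j]) (simp add: L_def)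
  have t0: "tape K s (addr K j (Suc L)) = 0" using jK by (simp add: tape_addr rd_def L_def)
  have len': "n \<le> 10 * (K + 1) * (store_size K s + 2)"
    if "n \<le> (2 * K + 1) + (K + 1) * L + (2 * K + 1) + (2 * K + 1) + (K + 1) * (L + 2)" for n
  proof -
    have "(K + 1) * L \<le> (K + 1) * store_size K s" "(K + 1) * (L + 2) \<le> (K + 1) * (store_size K s + 2)"
      using L by (meson mult_le_mono2 add_le_mono1)+
    then have "n \<le> (2 * K + 1) + (K + 1) * store_size K s + (2 * K + 1) + (2 * K + 1) + (K + 1) * (store_size K s + 2)"
      using that by linarith
    also have "\<dots> \<le> 10 * (K + 1) * (store_size K s + 2)" by (simp add: algebra_simps)
    finally show ?thesis .
  qed
  note 12 = reach_trans[OF 1 2]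
  show ?thesis
  proof (cases q)
    case (PushI _ b)
    then have qq: "q = PushI j b" by (simp add: j_def)
    have s': "s' = s(j := s j @ [b])" "r = 0" using st qq by auto
    have wf': "wf_store K s'" using istep_wf(2)[OF st wf(2,1)] .
    have "reach (delta K c M) (2 * K + 1) (Seek ks, tape K s, addr K j (Suc L))
       (Back 0 ks, (tape K s)(addr K j (Suc L) := b), addr K j (Suc L) + (- stride K j))"
      by (rule reach_step) (use t0 qq q small in auto)
    then have 3: "reach (delta K c M) (2 * K + 1) (Seek ks, tape K s, addr K j (Suc L)) (Back r ks, tape K s', addr K j L)"
      using tape_push[OF jK, of s b] s' by (simp add: addr_Suc L_def)
    have 4: "reach (delta K c M) ((K + 1) * (L + 1)) (Back r ks, tape K s', addr K j L) (Ctl (cont ks r), tape K s', - 1)"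
      by (rule back_reach[OF wf' jK j]) (simp add: s' L_def)
    show ?thesis by (rule reach_mono[OF reach_trans[OF reach_trans[OF 12 3] 4] len']) simp
  next
    case (PopI _)
    then have qq: "q = PopI j" by (simp add: j_def)
    have "reach (delta K c M) (2 * K + 1) (Seek ks, tape K s, addr K j (Suc L))
       (Take ks, (tape K s)(addr K j (Suc L) := 0), addr K j (Suc L) + (- stride K j))"
      by (rule reach_step) (use t0 qq q small in auto)
    moreover have "(tape K s)(addr K j (Suc L) := 0) = tape K s" using t0 by (auto simp: fun_eq_iff)
    ultimately have 3: "reach (delta K c M) (2 * K + 1) (Seek ks, tape K s, addr K j (Suc L)) (Take ks, tape K s, addr K j L)"
      by (simp add: addr_Suc)
    show ?thesis
    proof (cases "s j = []")
      case True
      then have s': "s' = s" "r = 0" and L0: "L = 0" using st qq by (auto simp: L_def)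
      have tz: "tape K s (addr K j L) = 0" using L0 jK by (simp add: tape_addr)
      have "reach (delta K c M) (2 * K + 1) (Take ks, tape K s, addr K j L)
         (Ctl (cont ks 0), (tape K s)(addr K j L := 0), addr K j L + (- 1 - base j))"
        by (rule reach_step) (use tz j jK in \<open>auto simp: base_def\<close>)
      moreover have "(tape K s)(addr K j L := 0) = tape K s" using tz by (auto simp: fun_eq_iff)
      ultimately have 4: "reach (delta K c M) (2 * K + 1) (Take ks, tape K s, addr K j L) (Ctl (cont ks r), tape K s', - 1)"
        using L0 s' by (simp add: addr_0)
      show ?thesis by (rule reach_mono[OF reach_trans[OF reach_trans[OF 12 3] 4] len']) simp
    next
      case False
      then obtain L' where L': "L = Suc L'" by (cases L) (auto simp: L_def)
      have s': "s' = s(j := butlast (s j))" "r = s j ! L'" using st qq False L' by (auto simp: L_def last_conv_nth)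
      have wf': "wf_store K s'" using istep_wf(2)[OF st wf(2,1)] .
      have t: "tape K s (addr K j L) = r" "r \<noteq> 0" using L' jK s' nth_nonzero[OF wf(1), of L' j]
        by (auto simp: tape_addr rd_def L_def)
      have "reach (delta K c M) (2 * K + 1) (Take ks, tape K s, addr K j L)
         (Back r ks, (tape K s)(addr K j L := 0), addr K j L + (- stride K j))"
        by (rule reach_step) (use t j small in auto)
      then have 4: "reach (delta K c M) (2 * K + 1) (Take ks, tape K s, addr K j L) (Back r ks, tape K s', addr K j L')"
        using tape_pop[of j K s] jK False s' L' by (simp add: L_def addr_Suc)
      have 5: "reach (delta K c M) ((K + 1) * (L' + 1)) (Back r ks, tape K s', addr K j L') (Ctl (cont ks r), tape K s', - 1)"
        by (rule back_reach[OF wf' jK j]) (use s' L' L_def in simp)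
      show ?thesis by (rule reach_mono[OF reach_trans[OF reach_trans[OF reach_trans[OF 12 3] 4] 5] len']) (simp add: L')
    qed
  next
    case (ReadI i _)
    then have qq: "q = ReadI i j" by (simp add: j_def)
    then have ij: "0 < i" "i < K" "0 < j" using wf(2) by auto
    have s': "s' = s" "r = rd (s i) L" using st qq by (auto simp: L_def)
    have ai: "addr K j p + (base i - base j) = addr K i p" for p
      using ij by (simp add: addr_def stride_def)
    have "reach (delta K c M) (2 * K + 1) (Seek ks, tape K s, addr K j (Suc L))
       (Look ks, (tape K s)(addr K j (Suc L) := 0), addr K j (Suc L) + (base i - base j))"
      by (rule reach_step) (use t0 qq q jK ij in \<open>auto simp: base_def\<close>)
    moreover have "(tape K s)(addr K j (Suc L) := 0) = tape K s" using t0 by (auto simp: fun_eq_iff)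
    ultimately have 3: "reach (delta K c M) (2 * K + 1) (Seek ks, tape K s, addr K j (Suc L)) (Look ks, tape K s, addr K i (Suc L))"
      by (simp add: ai)
    have t: "tape K s (addr K i (Suc L)) = r" using ij s' by (simp add: tape_addr)
    have "reach (delta K c M) (2 * K + 1) (Look ks, tape K s, addr K i (Suc L))
       (Back r ks, (tape K s)(addr K i (Suc L) := r), addr K i (Suc L) + (base j - base i - stride K j))"
      by (rule reach_step) (use t qq q[symmetric] jK ij in \<open>auto simp: base_def stride_def\<close>)
    moreover have "(tape K s)(addr K i (Suc L) := r) = tape K s" using t by (auto simp: fun_eq_iff)
    moreover have "addr K i (Suc L) + (base j - base i - stride K j) = addr K j L"
      using ai[of "Suc L"] by (simp add: addr_Suc)
    ultimately have 4: "reach (delta K c M) (2 * K + 1) (Look ks, tape K s, addr K i (Suc L)) (Back r ks, tape K s', addr K j L)"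
      using s' by simp
    have 5: "reach (delta K c M) ((K + 1) * (L + 1)) (Back r ks, tape K s', addr K j L) (Ctl (cont ks r), tape K s', - 1)"
      by (rule back_reach[OF _ jK j]) (use s' L_def wf in simp_all)
    show ?thesis by (rule reach_mono[OF reach_trans[OF reach_trans[OF reach_trans[OF 12 3] 4] 5] len']) simp
  qed
qed

text \<open>Each instruction lengthens the stores by at most one symbol, so the number of steps also
  bounds the growth of the space. This supplies the a priori bound for the simulation.\<close>

lemma exec_wf:
  assumes "exec c s n s'" "wf_cmd K c" "wf_store K s"
  shows "wf_store K s' \<and> store_size K s' \<le> store_size K s + n"
  using assms
proof (induction rule: exec.induct)
  case (exec_Do q s r s1 f n s2)
  then show ?case using istep_wf[OF exec_Do.hyps(1)] by fastforce
next
  case (exec_LoopE q s r s1 E f)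
  then show ?case using istep_wf[OF exec_LoopE.hyps(1)] by fastforce
next
  case (exec_LoopC q s r s1 E f n1 s2 n2 s3)
  have "r < 4" "wf_store K s1" "store_size K s1 \<le> store_size K s + 1"
    using istep_wf[OF exec_LoopC.hyps(1)] exec_LoopC.prems by auto
  moreover from this have "wf_store K s2 \<and> store_size K s2 \<le> store_size K s1 + n1"
    using exec_LoopC by auto
  moreover from this have "wf_store K s3 \<and> store_size K s3 \<le> store_size K s2 + n2"
    using exec_LoopC by auto
  ultimately show ?case by auto
qed auto

text \<open>The bound B is an a priori bound on the total size of the stores during the run.\<close>

lemma exec_reach:
  assumes "exec x s n s'" "wf_cmd K x" "wf_store K s" "store_size K s + n \<le> B"
  shows "reach (delta K c M) (n * (10 * (K + 1) * (B + 2))) (Ctl (x # ks), tape K s, - 1) (Ctl ks, tape K s', - 1)"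
  using assms
proof (induction arbitrary: ks rule: exec.induct)
  case (exec_Skip s)
  have "reach (delta K c M) (0 + 1) (Ctl (Skip # ks), tape K s, - 1) (Ctl ks, (tape K s)(- 1 := tape K s (- 1)), - 1 + 0)"
    by (rule reach_step) auto
  then show ?case using reach_mono by fastforce
next
  case (exec_Do q s r s1 f n s2)
  have w: "r < 4" "wf_store K s1" "store_size K s1 \<le> store_size K s + 1"
    using istep_wf[OF exec_Do.hyps(1)] exec_Do.prems by auto
  have 1: "reach (delta K c M) (10 * (K + 1) * (store_size K s + 2)) (Ctl (Do q f # ks), tape K s, - 1) (Ctl (f r # ks), tape K s1, - 1)"
    using instr_reach[OF exec_Do.prems(2) _ refl _ _ exec_Do.hyps(1), of "Do q f" ks] exec_Do.prems
    by (simp add: is_instr_def)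
  have 2: "reach (delta K c M) (n * (10 * (K + 1) * (B + 2))) (Ctl (f r # ks), tape K s1, - 1) (Ctl ks, tape K s2, - 1)"
    using exec_Do w by auto
  have "10 * (K + 1) * (store_size K s + 2) \<le> 10 * (K + 1) * (B + 2)"
    using exec_Do.prems by (intro mult_le_mono2) simp
  then show ?case by (intro reach_mono[OF reach_trans[OF 1 2]]) simp
next
  case (exec_Seq a s n1 s1 b n2 s2)
  have w: "wf_store K s1" "store_size K s1 \<le> store_size K s + n1"
    using exec_wf[OF exec_Seq.hyps(1)] exec_Seq.prems by auto
  have "reach (delta K c M) (0 + 1) (Ctl (Seq a b # ks), tape K s, - 1) (Ctl (a # b # ks), (tape K s)(- 1 := tape K s (- 1)), - 1 + 0)"
    by (rule reach_step) auto
  then have 0: "reach (delta K c M) 1 (Ctl (Seq a b # ks), tape K s, - 1) (Ctl (a # b # ks), tape K s, - 1)" by simp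
  have 1: "reach (delta K c M) (n1 * (10 * (K + 1) * (B + 2))) (Ctl (a # b # ks), tape K s, - 1) (Ctl (b # ks), tape K s1, - 1)"
    using exec_Seq by simp
  have 2: "reach (delta K c M) (n2 * (10 * (K + 1) * (B + 2))) (Ctl (b # ks), tape K s1, - 1) (Ctl ks, tape K s2, - 1)"
    using exec_Seq w by simp
  show ?case by (rule reach_mono[OF reach_trans[OF reach_trans[OF 0 1] 2]]) (simp add: algebra_simps)
next
  case (exec_LoopE q s r s1 E f)
  have 1: "reach (delta K c M) (10 * (K + 1) * (store_size K s + 2)) (Ctl (Loop q E f # ks), tape K s, - 1) (Ctl ks, tape K s1, - 1)"
    using instr_reach[OF exec_LoopE.prems(2) _ refl _ _ exec_LoopE.hyps(1), of "Loop q E f" ks] exec_LoopE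
    by (simp add: is_instr_def)
  have "10 * (K + 1) * (store_size K s + 2) \<le> 10 * (K + 1) * (B + 2)"
    using exec_LoopE.prems by (intro mult_le_mono2) simp
  then show ?case by (intro reach_mono[OF 1]) simp
next
  case (exec_LoopC q s r s1 E f n1 s2 n2 s3)
  have w: "r < 4" "wf_store K s1" "store_size K s1 \<le> store_size K s + 1"
    using istep_wf[OF exec_LoopC.hyps(1)] exec_LoopC.prems by auto
  have w2: "wf_store K s2" "store_size K s2 \<le> store_size K s1 + n1"
    using exec_wf[OF exec_LoopC.hyps(3), of K] exec_LoopC.prems w by auto
  have 1: "reach (delta K c M) (10 * (K + 1) * (store_size K s + 2)) (Ctl (Loop q E f # ks), tape K s, - 1)
      (Ctl (f r # Loop q E f # ks), tape K s1, - 1)"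
    using instr_reach[OF exec_LoopC.prems(2) _ refl _ _ exec_LoopC.hyps(1), of "Loop q E f" ks] exec_LoopC.hyps(2) exec_LoopC.prems
    by (simp add: is_instr_def)
  have 2: "reach (delta K c M) (n1 * (10 * (K + 1) * (B + 2))) (Ctl (f r # Loop q E f # ks), tape K s1, - 1) (Ctl (Loop q E f # ks), tape K s2, - 1)"
    using exec_LoopC w by auto
  have 3: "reach (delta K c M) (n2 * (10 * (K + 1) * (B + 2))) (Ctl (Loop q E f # ks), tape K s2, - 1) (Ctl ks, tape K s3, - 1)"
    using exec_LoopC w w2 by auto
  have "10 * (K + 1) * (store_size K s + 2) \<le> 10 * (K + 1) * (B + 2)"
    using exec_LoopC.prems by (intro mult_le_mono2) simp
  then show ?case by (intro reach_mono[OF reach_trans[OF reach_trans[OF 1 2] 3]]) (simp add: algebra_simps)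
qed

section \<open>Finiteness of the control states\<close>

text \<open>All continuation stacks that occur while the first command is being executed.\<close>

primrec conts :: "cmd \<Rightarrow> cmd list \<Rightarrow> cmd list set" where
  "conts Skip ks = {Skip # ks}"
| "conts (Do q f) ks = insert (Do q f # ks) (\<Union>r<4. conts (f r) ks)"
| "conts (Seq a b) ks = insert (Seq a b # ks) (conts a (b # ks) \<union> conts b ks)"
| "conts (Loop q E f) ks = insert (Loop q E f # ks) (\<Union>r<4. conts (f r) (Loop q E f # ks))"

lemma finite_conts: "finite (conts c ks)"
  by (induction c arbitrary: ks) auto

lemma conts_self: "c # ks \<in> conts c ks"
  by (cases c) auto

fun succs :: "cmd list \<Rightarrow> cmd list set" where
  "succs [] = {}"
| "succs (Skip # ks) = {ks}"
| "succs (Seq a b # ks) = {a # b # ks}"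
| "succs ks = (\<lambda>r. cont ks r) ` {..<4}"

text \<open>A loop puts itself back below its body and there is no recursion, so the stack of
  commands never leaves a finite set until \<open>c\<close> has been executed and \<open>ks\<close>
  is uncovered.\<close>

lemma conts_closed:
  "ls \<in> conts c ks \<Longrightarrow> succs ls \<subseteq> insert ks (conts c ks)"
proof (induction c arbitrary: ks)
  case (Do q f)
  then show ?case using conts_self by fastforce
next
  case (Seq a b)
  then show ?case using conts_self by fastforce
next
  case (Loop q E f)
  then show ?case using conts_self by (fastforce split: if_splits)
qed auto

lemma conts_wf:
  "ls \<in> conts c ks \<Longrightarrow> wf_cmd K c \<Longrightarrow> list_all (wf_cmd K) ks \<Longrightarrow> list_all (wf_cmd K) ls"
proof (induction c arbitrary: ks)
  case (Do q f)
  show ?case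
  proof (cases "ls = Do q f # ks")
    case False
    then obtain r where "r < 4" "ls \<in> conts (f r) ks" using Do.prems by auto
    then show ?thesis using Do.IH[of "f r" ks] Do.prems by auto
  qed (use Do.prems in simp)
next
  case (Seq a b)
  then consider "ls = Seq a b # ks" | "ls \<in> conts a (b # ks)" | "ls \<in> conts b ks" by auto
  then show ?case using Seq.IH(1)[of "b # ks"] Seq.IH(2)[of ks] Seq.prems by cases auto
next
  case (Loop q E f)
  show ?case
  proof (cases "ls = Loop q E f # ks")
    case False
    then obtain r where "r < 4" "ls \<in> conts (f r) (Loop q E f # ks)" using Loop.prems by auto
    then show ?thesis using Loop.IH[of "f r" "Loop q E f # ks"] Loop.prems by auto
  qed (use Loop.prems in simp)
qed simp


section \<open>Composition of a stack program with a machine\<close>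

definition input_store :: "nat list \<Rightarrow> store" where
  "input_store w = (\<lambda>j. if j = 0 then w else [])"

text \<open>This is why stack 0 lies in plain form on the cells 0, 1, 2, ...: the initial tape on an
  input already represents a store, and a store with only stack 0 filled is again an initial
  tape.\<close>

lemma tape_input_store: "snd (tm_init w) = (tape K (input_store w), 0)"
  by (auto simp: tm_init_def tape_def input_store_def rd_def fun_eq_iff Let_def nat_less_iff)

lemma wf_input_store: "0 < K \<Longrightarrow> set w \<subseteq> {1,2,3} \<Longrightarrow> wf_store K (input_store w)"
  by (auto simp: wf_store_def input_store_def)

lemma store_size_input_store: "store_size K (input_store w) \<le> length w"
  by (cases K) (auto simp: store_size_def input_store_def lessThan_Suc_eq_insert_0 sum.insert_if)

definition core_states :: "cmd \<Rightarrow> nat \<Rightarrow> core set" where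
  "core_states c Q = insert Start (Sim ` {..<Q} \<union>
     (\<Union>ks\<in>insert [] (conts c []). {Ctl ks, Seek ks, Take ks, Look ks} \<union> (\<lambda>r. Back r ks) ` {..<4}))"

lemma finite_core_states: "finite (core_states c Q)"
  by (simp add: core_states_def finite_conts)

lemma delta_closed:
  assumes K: "0 < K" and c: "wf_cmd K c"
    and M: "\<And>q a q' a' mv. q < Q \<Longrightarrow> a < 4 \<Longrightarrow> M q a = (q', a', mv) \<Longrightarrow> q' < Q \<and> a' < 4 \<and> mv \<in> {-1, 0, 1}"
    and Q: "3 \<le> Q" and x: "x \<in> core_states c Q" and a: "a < 4" and d: "delta K c M x a = (x', a', mv)"
  shows "x' \<in> core_states c Q \<and> a' < 4 \<and> \<bar>mv\<bar> \<le> int (max_move K)"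
proof -
  let ?Ks = "insert [] (conts c [])"
  have mem: "Ctl ks \<in> core_states c Q" "Seek ks \<in> core_states c Q" "Take ks \<in> core_states c Q"
    "Look ks \<in> core_states c Q" "r < 4 \<Longrightarrow> Back r ks \<in> core_states c Q" if "ks \<in> ?Ks" for ks r
    using that unfolding core_states_def by blast+
  have sim: "Sim m \<in> core_states c Q" if "m < Q" for m
    using that unfolding core_states_def by blast
  have wfq: "wf_instr K (cur_instr ks)" if "ks \<in> ?Ks" for ks
  proof -
    have "list_all (wf_cmd K) ks" using that conts_wf[of ks c "[]" K] c by auto
    then show ?thesis using K by (cases ks rule: cur_instr.cases) auto
  qed
  have cl: "succs ks \<subseteq> ?Ks" if "ks \<in> ?Ks" for ks
    using that conts_closed[of ks c "[]"] by auto
  have ct: "cont ks r \<in> ?Ks" if "ks \<in> ?Ks" "r < 4" for ks r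
    using that cl[OF that(1)] by (cases ks rule: cur_instr.cases) auto
  have bnd: "\<bar>stride K j\<bar> \<le> int K" "\<bar>base j\<bar> \<le> int K" if "j < K" for j
    using that stride_bound base_bound K by auto
  have ms: "main_stack (cur_instr ks) < K" if "ks \<in> ?Ks" for ks
    using wfq[OF that] by (rule main_stack_less)
  have a1: "\<bar>addr K j 1 + 1\<bar> \<le> int (max_move K)" if "j < K" for j
    using that by (auto simp: addr_def base_def stride_def max_move_def)
  have se: "x' \<in> core_states c Q \<and> a' < 4 \<and> \<bar>mv\<bar> \<le> int (max_move K)"
    if "ks \<in> ?Ks" "seek_end K ks (cur_instr ks) = (x', a', mv)" for ks
    using wfq[OF that(1)] that(2) mem[OF that(1)] by (cases "cur_instr ks") (auto simp: base_def stride_def max_move_def)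
  have ls: "\<bar>look_shift q - stride K (main_stack q)\<bar> \<le> int (max_move K)" if "wf_instr K q" for q
    using that by (cases q) (auto simp: base_def stride_def max_move_def)
  from x consider (s) "x = Start" | (m) m where "x = Sim m" "m < Q"
    | (k) ks where "ks \<in> ?Ks" "x = Ctl ks \<or> x = Seek ks \<or> x = Take ks \<or> x = Look ks \<or> (\<exists>r<4. x = Back r ks)"
    unfolding core_states_def by blast
  then show ?thesis
  proof cases
    case s
    have "[c] \<in> ?Ks" using conts_self by simp
    then show ?thesis using d s mem a by (auto simp: max_move_def)
  next
    case m
    show ?thesis
    proof (cases "m = 1 \<or> m = 2")
      case True
      then show ?thesis using d m sim a by (auto simp: max_move_def)
    next
      case False
      obtain m' b' mv' where e: "M m a = (m', b', mv')" by (cases "M m a")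
      then have "m' < Q \<and> b' < 4 \<and> mv' \<in> {-1, 0, 1}" using M[OF m(2) a] by simp
      moreover have "x' = Sim m'" "a' = b'" "mv = mv'" using d m False e by auto
      ultimately show ?thesis using sim by (auto simp: max_move_def)
    qed
  next
    case k
    note ks = k(1)
    from k(2) consider "x = Ctl ks" | "x = Seek ks" | "x = Take ks" | "x = Look ks" | r where "x = Back r ks" "r < 4"
      by blast
    then show ?thesis
    proof cases
      case 1
      show ?thesis
      proof (cases ks)
        case Nil
        then show ?thesis using d 1 a sim Q by (auto simp: max_move_def)
      next
        case (Cons y zs)
        show ?thesis
        proof (cases y)
          case Skip
          then have "zs \<in> ?Ks" using cl[OF ks] Cons by auto
          then show ?thesis using d 1 a Cons Skip mem by (auto simp: max_move_def)
        next
          case (Seq u v)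
          then have "u # v # zs \<in> ?Ks" using cl[OF ks] Cons by auto
          then show ?thesis using d 1 a Cons Seq mem(1) by (auto simp: max_move_def)
        next
          case (Do q f)
          then show ?thesis using d 1 a Cons mem(2)[OF ks] a1[OF ms[OF ks]] by auto
        next
          case (Loop q E f)
          then show ?thesis using d 1 a Cons mem(2)[OF ks] a1[OF ms[OF ks]] by auto
        qed
      qed
    next
      case 2
      then show ?thesis using d a se[OF ks] mem(2)[OF ks] bnd[OF ms[OF ks]] by (auto simp: max_move_def split: if_splits)
    next
      case 3
      have "Ctl (cont ks 0) \<in> core_states c Q" using mem(1)[OF ct[OF ks, of 0]] by simp
      then show ?thesis using 3 d a mem(5)[OF ks] bnd[OF ms[OF ks]] by (auto simp: max_move_def split: if_splits)
    next
      case 4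
      then show ?thesis using d a mem(5)[OF ks] ls[OF wfq[OF ks]] by auto
    next
      case 5
      have "Ctl (cont ks r) \<in> core_states c Q" using mem(1)[OF ct[OF ks 5(2)]] .
      then show ?thesis using 5 d a mem(5)[OF ks] bnd[OF ms[OF ks]] by (auto simp: max_move_def split: if_splits)
    qed
  qed
qed

text \<open>The factor 2 arises because a move of \<open>M\<close> takes one step to be chosen and
  one to be carried out by \<open>unit_moves\<close>.\<close>

lemma sim_reach:
  assumes M: "\<And>q a q' a' mv. q < Q \<Longrightarrow> a < 4 \<Longrightarrow> M q a = (q', a', mv) \<Longrightarrow> q' < Q \<and> a' < 4 \<and> mv \<in> {-1, 0, 1}"
    and Q: "3 \<le> Q" and u: "set u \<subseteq> {1, 2, 3}"
  shows "case tm_run M u n of (q, t, h) \<Rightarrow> q < Q \<and> (\<forall>i. t i < 4) \<and>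
    reach (delta K c M) (2 * n) (Sim 0, snd (tm_init u)) (Sim q, t, h)"
proof (induction n)
  case 0
  have "rd u k < 4" for k using wf_store_rd_less[OF wf_input_store[of 1 u], of 0 k] u by (simp add: input_store_def)
  then have "\<forall>i. (if 0 \<le> i \<and> i < int (length u) then u ! nat i else 0) < 4"
    by (metis rd_def nat_less_iff zero_less_numeral)
  then show ?case using Q by (auto simp: tm_run_def tm_init_def reach_refl)
next
  case (Suc n)
  obtain q t h where r: "tm_run M u n = (q, t, h)" by (cases "tm_run M u n")
  then have IH: "q < Q" "\<And>i. t i < 4" "reach (delta K c M) (2 * n) (Sim 0, snd (tm_init u)) (Sim q, t, h)"
    using Suc by auto
  have run: "tm_run M u (Suc n) = tm_step M (q, t, h)" using r by (simp add: tm_run_def)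
  show ?case
  proof (cases "q = 1 \<or> q = 2")
    case True
    then show ?thesis using run IH reach_mono[OF IH(3)] by (auto simp: tm_step_def)
  next
    case False
    obtain q' a' mv where e: "M q (t h) = (q', a', mv)" by (cases "M q (t h)")
    then have m: "q' < Q \<and> a' < 4 \<and> mv \<in> {-1, 0, 1}" using M IH by blast
    have "reach (delta K c M) (1 + 1) (Sim q, t, h) (Sim q', t(h := a'), h + mv)"
      by (rule reach_step) (use False e m in auto)
    then show ?thesis using reach_trans[OF IH(3)] run m IH(2) False e by (fastforce simp: tm_step_def)
  qed
qed

text \<open>The program has to end in \<open>input_store u\<close>, with all working stacks empty,
  because then the tape is literally the initial tape of \<open>M\<close> on u and the second phase
  cannot notice the first. The summand 4 pays for entering and leaving the program.\<close>

lemma compose_tm: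
  assumes M: "wf_tm M" and K: "0 < K" and c: "wf_cmd K c"
  obtains M' where "wf_tm M'"
    "\<And>w u n T b. set w \<subseteq> {1, 2, 3} \<Longrightarrow> exec c (input_store w) n (input_store u) \<Longrightarrow> decides_within M u T b \<Longrightarrow>
       decides_within M' w (real (4 + n * (10 * (K + 1) * (length w + n + 2))) + 2 * T) b"
proof -
  obtain Q where Q: "3 \<le> Q" and
    MQ: "\<And>q a q' a' mv. q < Q \<Longrightarrow> a < 4 \<Longrightarrow> M q a = (q', a', mv) \<Longrightarrow> q' < Q \<and> a' < 4 \<and> mv \<in> {-1, 0, 1}"
    using M unfolding wf_tm_def by fastforce
  let ?d = "delta K c M" and ?D = "int (max_move K)"
  define S where "S = {- ?D..?D} \<times> core_states c Q"
  have cs: "Start \<in> core_states c Q" "Sim 1 \<in> core_states c Q" "Sim 2 \<in> core_states c Q"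
    using Q unfolding core_states_def by auto
  have closed: "y \<in> S \<and> a' < 4 \<and> mv \<in> {-1, 0, 1}"
    if "x \<in> S" "a < 4" "unit_moves ?d x a = (y, a', mv)" for x a y a' mv
  proof -
    obtain m x0 where x: "x = (m, x0)" by (cases x)
    then have m: "\<bar>m\<bar> \<le> ?D" "x0 \<in> core_states c Q" using that by (auto simp: S_def)
    consider "m > 0" | "m < 0" | "m = 0" by linarith
    then show ?thesis
    proof cases
      case 3
      obtain x' b' mv' where e: "?d x0 a = (x', b', mv')" by (cases "?d x0 a")
      have "x' \<in> core_states c Q \<and> b' < 4 \<and> \<bar>mv'\<bar> \<le> ?D"
        by (rule delta_closed[OF K c MQ Q m(2) that(2) e])
      then show ?thesis using that(3) x 3 e by (auto simp: unit_moves_def S_def)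
    qed (use that x m in \<open>auto simp: unit_moves_def S_def\<close>)
  qed
  have fin: "finite S" by (simp add: S_def finite_core_states)
  have mem: "(0, Start) \<in> S" "(0, Sim 1) \<in> S" "(0, Sim 2) \<in> S" using cs by (auto simp: S_def)
  have dist: "distinct [(0::int, Start), (0, Sim 1), (0, Sim 2)]" by simp
  have halt: "unit_moves ?d (0, Sim 1) a = ((0, Sim 1), a, 0)" "unit_moves ?d (0, Sim 2) a = ((0, Sim 2), a, 0)" for a
    by (simp_all add: unit_moves_def)
  obtain M' where M': "wf_tm M'" "\<And>w n b. set w \<subseteq> {..<4} \<Longrightarrow>
       fst ((gstep (unit_moves ?d) ^^ n) ((0, Start), snd (tm_init w))) = (if b then (0, Sim 1) else (0, Sim 2)) \<Longrightarrow>
       fst (tm_run M' w n) = (if b then 1 else 2)"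
    by (rule gtm_to_tm[OF fin mem dist closed halt]) blast+
  show thesis
  proof (rule that[OF M'(1)])
    fix w u :: "nat list" and n :: nat and T :: real and b :: bool
    assume w: "set w \<subseteq> {1, 2, 3}" and ex: "exec c (input_store w) n (input_store u)" and dec: "decides_within M u T b"
    obtain k where k: "real k \<le> T" "fst (tm_run M u k) = (if b then 1 else 2)"
      using dec by (auto simp: decides_within_def)
    have wfs: "wf_store K (input_store w)" using K w by (rule wf_input_store)
    have "wf_store K (input_store u)" using exec_wf[OF ex c wfs] by simp
    then have u: "set u \<subseteq> {1, 2, 3}" unfolding wf_store_def by (metis input_store_def)
    let ?t = "tape K (input_store w)" and ?t' = "tape K (input_store u)"
    have "reach ?d (1 + 1) (Start, ?t, 0) (Ctl [c], ?t(0 := ?t 0), 0 + - 1)"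
      by (rule reach_step) auto
    then have 1: "reach ?d 2 (Start, ?t, 0) (Ctl [c], ?t, - 1)" by (simp add: numeral_2_eq_2)
    have 2: "reach ?d (n * (10 * (K + 1) * (length w + n + 2))) (Ctl [c], ?t, - 1) (Ctl [], ?t', - 1)"
      by (rule exec_reach[OF ex c wfs]) (use store_size_input_store in simp)
    have "reach ?d (1 + 1) (Ctl [], ?t', - 1) (Sim 0, ?t'(- 1 := ?t' (- 1)), - 1 + 1)"
      by (rule reach_step) auto
    then have 3: "reach ?d 2 (Ctl [], ?t', - 1) (Sim 0, snd (tm_init u))"
      by (simp add: tape_input_store[of u K] numeral_2_eq_2)
    obtain q t h where r: "tm_run M u k = (q, t, h)" by (cases "tm_run M u k")
    have 4: "reach ?d (2 * k) (Sim 0, snd (tm_init u)) (Sim q, t, h)"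
    proof -
      have "case tm_run M u k of (q, t, h) \<Rightarrow> q < Q \<and> (\<forall>i. t i < 4) \<and>
          reach ?d (2 * k) (Sim 0, snd (tm_init u)) (Sim q, t, h)"
        by (rule sim_reach[OF MQ Q u])
      then show ?thesis using r by simp
    qed
    have "reach ?d (2 + n * (10 * (K + 1) * (length w + n + 2)) + 2 + 2 * k) (Start, ?t, 0) (Sim q, t, h)"
      by (rule reach_trans[OF reach_trans[OF reach_trans[OF 1 2] 3] 4])
    then obtain l where l: "l \<le> 2 + n * (10 * (K + 1) * (length w + n + 2)) + 2 + 2 * k"
      "(gstep (unit_moves ?d) ^^ l) ((0, Start), snd (tm_init w)) = ((0, Sim q), t, h)"
      by (auto simp: reach_def tape_input_store[of w K])
    have "fst (tm_run M' w l) = (if b then 1 else 2)"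
    proof (rule M'(2))
      show "set w \<subseteq> {..<4}" using w by auto
      have "q = (if b then 1 else 2)" using k(2) r by simp
      then show "fst ((gstep (unit_moves ?d) ^^ l) ((0, Start), snd (tm_init w))) = (if b then (0, Sim 1) else (0, Sim 2))"
        using l(2) by simp
    qed
    moreover have "real l \<le> real (4 + n * (10 * (K + 1) * (length w + n + 2))) + 2 * T"
    proof -
      have "real l \<le> real (4 + n * (10 * (K + 1) * (length w + n + 2)) + 2 * k)"
        using l(1) by (intro of_nat_mono) linarith
      then show ?thesis using k(1) by simp
    qed
    ultimately show "decides_within M' w (real (4 + n * (10 * (K + 1) * (length w + n + 2))) + 2 * T) b"
      unfolding decides_within_def by blast
  qed
qed

section \<open>A generator language with polynomially bounded programs\<close>

text \<open>Numbers are lengths of strings. \<open>GIf i j\<close> looks at the symbol of string i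
  whose index is the length of string j, and a loop variable takes the values
  \<open>replicate i 1\<close>.\<close>

datatype gen = GSkip | Emit nat | GSeq gen gen | GIf nat nat "nat set" gen gen
  | GFor nat nat gen | GLet nat gen gen

primrec gsem :: "gen \<Rightarrow> store \<Rightarrow> nat list" where
  "gsem GSkip e = []"
| "gsem (Emit a) e = [a]"
| "gsem (GSeq g h) e = gsem g e @ gsem h e"
| "gsem (GIf i j S g h) e = (if rd (e i) (length (e j)) \<in> S then gsem g e else gsem h e)"
| "gsem (GFor u v g) e = concat (map (\<lambda>i. gsem g (e(v := replicate i 1))) [0..<length (e u)])"
| "gsem (GLet v g h) e = gsem h (e(v := gsem g e))"

definition push :: "nat \<Rightarrow> nat \<Rightarrow> cmd" where
  "push j a = Do (PushI j a) (\<lambda>_. Skip)"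

definition clear :: "nat \<Rightarrow> cmd" where
  "clear j = Loop (PopI j) {0} (\<lambda>_. Skip)"

primrec comp :: "gen \<Rightarrow> nat \<Rightarrow> cmd" where
  "comp GSkip out = Skip"
| "comp (Emit a) out = push out a"
| "comp (GSeq g h) out = Seq (comp g out) (comp h out)"
| "comp (GIf i j S g h) out = Do (ReadI i j) (\<lambda>r. if r \<in> S then comp g out else comp h out)"
| "comp (GFor u v g) out = Seq (Loop (ReadI u v) {0} (\<lambda>_. Seq (comp g out) (push v 1))) (clear v)"
| "comp (GLet v g h) out = Seq (comp g v) (Seq (comp h out) (clear v))"

text \<open>V contains the variables that may be read; all binders are at least m.\<close>

primrec ok :: "gen \<Rightarrow> nat set \<Rightarrow> nat \<Rightarrow> bool" where
  "ok GSkip V m \<longleftrightarrow> True"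
| "ok (Emit a) V m \<longleftrightarrow> 0 < a \<and> a < 4"
| "ok (GSeq g h) V m \<longleftrightarrow> ok g V m \<and> ok h V m"
| "ok (GIf i j S g h) V m \<longleftrightarrow> i \<in> V \<and> j \<in> V \<and> ok g V m \<and> ok h V m"
| "ok (GFor u v g) V m \<longleftrightarrow> u \<in> V \<and> m \<le> v \<and> ok g (insert v V) (Suc v)"
| "ok (GLet v g h) V m \<longleftrightarrow> m \<le> v \<and> ok g V (Suc v) \<and> ok h (insert v V) (Suc v)"

text \<open>S bounds the lengths of all readable strings. In \<open>GFor\<close>, a round costs 4
  steps besides the body, and clearing the counter costs 2 more per round. In \<open>GLet\<close>,
  producing the string takes \<open>cost g S\<close> steps, clearing it at most twice as many, and h
  runs with readable strings longer by up to \<open>cost g S\<close>.\<close>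

primrec cost :: "gen \<Rightarrow> nat \<Rightarrow> nat" where
  "cost GSkip S = 1"
| "cost (Emit a) S = 2"
| "cost (GSeq g h) S = cost g S + cost h S + 1"
| "cost (GIf i j T g h) S = cost g S + cost h S + 1"
| "cost (GFor u v g) S = S * (cost g S + 6) + 3"
| "cost (GLet v g h) S = 3 * cost g S + cost h (S + cost g S) + 3"

primrec max_var :: "gen \<Rightarrow> nat" where
  "max_var GSkip = 0"
| "max_var (Emit a) = 0"
| "max_var (GSeq g h) = max (max_var g) (max_var h)"
| "max_var (GIf i j S g h) = max (max_var g) (max_var h)"
| "max_var (GFor u v g) = max v (max_var g)"
| "max_var (GLet v g h) = max v (max (max_var g) (max_var h))"

lemma wf_cmd_comp:
  "ok g V m \<Longrightarrow> V \<subseteq> {0<..<K} \<Longrightarrow> 0 < m \<Longrightarrow> out < K \<Longrightarrow> max_var g < K \<Longrightarrow> wf_cmd K (comp g out)"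
proof (induction g arbitrary: V m out)
  case (GFor u v g)
  then have "wf_cmd K (comp g out)" using GFor.IH[of "insert v V" "Suc v" out] by auto
  then show ?case using GFor.prems by (auto simp: push_def clear_def)
next
  case (GLet v g h)
  then have "wf_cmd K (comp g v)" "wf_cmd K (comp h out)"
    using GLet.IH(1)[of V "Suc v" v] GLet.IH(2)[of "insert v V" "Suc v" out] by auto
  then show ?case using GLet.prems by (auto simp: clear_def)
qed (auto simp: push_def)

text \<open>Used to see that appending to the output stack, which is not readable, does not
  influence what the remaining commands produce.\<close>

lemma gsem_cong:
  "ok g V m \<Longrightarrow> (\<And>x. x \<in> V \<Longrightarrow> e x = e' x) \<Longrightarrow> gsem g e = gsem g e'"
proof (induction g arbitrary: V m e e')
  case (GSeq g h)
  have "gsem g e = gsem g e'" "gsem h e = gsem h e'"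
    by (rule GSeq.IH[of V m]; use GSeq.prems in simp)+
  then show ?case by simp
next
  case (GIf i j S g h)
  have "gsem g e = gsem g e'" "gsem h e = gsem h e'"
    by (rule GIf.IH[of V m]; use GIf.prems in simp)+
  then show ?case using GIf.prems by simp
next
  case (GFor u v g)
  have "gsem g (e(v := replicate i 1)) = gsem g (e'(v := replicate i 1))" for i
    by (rule GFor.IH[of "insert v V" "Suc v"]) (use GFor.prems in auto)
  then show ?case using GFor.prems by simp
next
  case (GLet v g h)
  have "gsem g e = gsem g e'" by (rule GLet.IH(1)[of V "Suc v"]) (use GLet.prems in auto)
  moreover have "gsem h (e(v := gsem g e)) = gsem h (e'(v := gsem g e))"
    by (rule GLet.IH(2)[of "insert v V" "Suc v"]) (use GLet.prems in auto)
  ultimately show ?case by simp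
qed auto

lemma gsem_symbols: "ok g V m \<Longrightarrow> set (gsem g e) \<subseteq> {1, 2, 3}"
proof (induction g arbitrary: V m e)
  case (Emit a)
  then show ?case by auto
next
  case (GSeq g h)
  then show ?case using GSeq.IH[of V m e] by simp
next
  case (GIf i j T g h)
  then show ?case using GIf.IH[of V m e] by simp
next
  case (GFor u v g)
  then have "set (gsem g (e(v := replicate i 1))) \<subseteq> {1, 2, 3}" for i
    using GFor.IH[of "insert v V" "Suc v"] by simp
  then show ?case by fastforce
next
  case (GLet v g h)
  then show ?case using GLet.IH(2)[of "insert v V" "Suc v"] by simp
qed auto

lemma length_gsem:
  "ok g V m \<Longrightarrow> (\<And>x. x \<in> V \<Longrightarrow> length (e x) \<le> S) \<Longrightarrow> length (gsem g e) \<le> cost g S"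
proof (induction g arbitrary: V m e S)
  case (GSeq g h)
  have "length (gsem g e) \<le> cost g S" "length (gsem h e) \<le> cost h S"
    by (rule GSeq.IH[of V m]; use GSeq.prems in simp)+
  then show ?case by simp
next
  case (GIf i j T g h)
  have "length (gsem g e) \<le> cost g S" "length (gsem h e) \<le> cost h S"
    by (rule GIf.IH[of V m]; use GIf.prems in simp)+
  then show ?case by simp
next
  case (GFor u v g)
  have u: "length (e u) \<le> S" using GFor.prems by simp
  have "length (gsem g (e(v := replicate i 1))) \<le> cost g S" if "i < length (e u)" for i
    by (rule GFor.IH[of "insert v V" "Suc v"]) (use GFor.prems that u in \<open>auto split: if_splits intro: order_trans[of _ "length (e u)"]\<close>)
  then have "(\<Sum>i\<leftarrow>[0..<length (e u)]. length (gsem g (e(v := replicate i 1)))) \<le> (\<Sum>i\<leftarrow>[0..<length (e u)]. cost g S)"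
    by (intro sum_list_mono) auto
  also have "\<dots> = length (e u) * cost g S" by (simp add: sum_list_triv)
  also have "\<dots> \<le> S * (cost g S + 6)" using u by (intro mult_le_mono) auto
  finally show ?case by (simp add: length_concat o_def)
next
  case (GLet v g h)
  have 1: "length (gsem g e) \<le> cost g S" using GLet.IH(1)[of V "Suc v" e S] GLet.prems by simp
  have "length (gsem h (e(v := gsem g e))) \<le> cost h (S + cost g S)"
    by (rule GLet.IH(2)[of "insert v V" "Suc v"]) (use GLet.prems 1 in \<open>auto intro: trans_le_add1\<close>)
  then show ?case by simp
qed auto

lemma exec_push: "exec (push j a) s 2 (s(j := s j @ [a]))"
  using exec_Do[of "PushI j a" s 0 "s(j := s j @ [a])" "\<lambda>_. Skip" 1 "s(j := s j @ [a])"] exec_Skip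
  by (simp add: push_def numeral_2_eq_2)

lemma exec_clear: "0 \<notin> set xs \<Longrightarrow> s j = xs \<Longrightarrow> exec (clear j) s (2 * length xs + 1) (s(j := []))"
proof (induction xs arbitrary: s rule: rev_induct)
  case Nil
  have "exec (clear j) s 1 (s(j := []))"
    unfolding clear_def by (rule exec_LoopE[of _ _ 0]) (use Nil in auto)
  then show ?case by (simp add: fun_upd_def)
next
  case (snoc x xs)
  have "exec (clear j) (s(j := xs)) (2 * length xs + 1) (s(j := xs, j := []))"
    by (rule snoc.IH) (use snoc.prems in auto)
  then have IH: "exec (clear j) (s(j := xs)) (2 * length xs + 1) (s(j := []))" by (simp only: fun_upd_upd)
  have "istep (PopI j) s = (x, s(j := xs))" using snoc.prems by simp
  from exec_LoopC[OF this, of "{0}" "\<lambda>_. Skip" 1 "s(j := xs)"] IH exec_Skip[of "s(j := xs)"]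
  have "exec (clear j) s (1 + (2 * length xs + 1) + 1) (s(j := []))"
    using snoc.prems unfolding clear_def by auto
  then show ?case by (simp add: fun_upd_def)
qed

text \<open>The invariant separates three kinds of stacks: the readable ones in V, the output stack
  below m but outside V, and the stacks from m on, which are empty and free for binders.\<close>

lemma exec_comp:
  "ok g V m \<Longrightarrow> V \<subseteq> {..<m} \<Longrightarrow> out < m \<Longrightarrow> out \<notin> V \<Longrightarrow> (\<And>x. m \<le> x \<Longrightarrow> e x = []) \<Longrightarrow>
   (\<And>x. x \<in> V \<Longrightarrow> 0 \<notin> set (e x)) \<Longrightarrow> (\<And>x. x \<in> V \<Longrightarrow> length (e x) \<le> S) \<Longrightarrow>
   \<exists>n\<le>cost g S. exec (comp g out) e n (e(out := e out @ gsem g e))"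
proof (induction g arbitrary: V m out e S)
  case GSkip
  then show ?case using exec_Skip[of e] by (intro exI[of _ 1]) simp
next
  case (Emit a)
  then show ?case using exec_push[of out a e] by (intro exI[of _ 2]) (simp add: fun_upd_def)
next
  case (GSeq g h)
  obtain n1 where n1: "n1 \<le> cost g S" "exec (comp g out) e n1 (e(out := e out @ gsem g e))"
  proof -
    have "\<exists>n\<le>cost g S. exec (comp g out) e n (e(out := e out @ gsem g e))"
      by (rule GSeq.IH(1)[of V m]) (use GSeq.prems in auto)
    then show thesis using that by blast
  qed
  let ?e = "e(out := e out @ gsem g e)"
  have "\<exists>n\<le>cost h S. exec (comp h out) ?e n (?e(out := ?e out @ gsem h ?e))"
    by (rule GSeq.IH(2)[of V m]) (use GSeq.prems in auto)
  moreover have "gsem h ?e = gsem h e"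
    by (rule gsem_cong[of h V m]) (use GSeq.prems in auto)
  ultimately obtain n2 where n2: "n2 \<le> cost h S" "exec (comp h out) ?e n2 (e(out := e out @ gsem g e @ gsem h e))"
    by auto
  show ?case using exec_Seq[OF n1(2) n2(2)] n1(1) n2(1) by (intro exI[of _ "n1 + n2 + 1"]) (simp add: fun_upd_def)
next
  case (GIf i j T g h)
  let ?r = "rd (e i) (length (e j))" and ?k = "if rd (e i) (length (e j)) \<in> T then g else h"
  have "\<exists>n\<le>cost ?k S. exec (comp ?k out) e n (e(out := e out @ gsem ?k e))"
  proof (cases "?r \<in> T")
    case True
    have "\<exists>n\<le>cost g S. exec (comp g out) e n (e(out := e out @ gsem g e))"
      by (rule GIf.IH(1)[of V m]) (use GIf.prems in auto)
    then show ?thesis using True by (simp add: fun_upd_def)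
  next
    case False
    have "\<exists>n\<le>cost h S. exec (comp h out) e n (e(out := e out @ gsem h e))"
      by (rule GIf.IH(2)[of V m]) (use GIf.prems in auto)
    then show ?thesis using False by (simp add: fun_upd_def)
  qed
  then obtain n where n: "n \<le> cost ?k S" "exec (comp ?k out) e n (e(out := e out @ gsem ?k e))" by auto
  have "exec (comp (GIf i j T g h) out) e (n + 1) (e(out := e out @ gsem ?k e))"
    unfolding comp.simps by (rule exec_Do[of _ _ ?r e]) (use n in \<open>auto split: if_splits\<close>)
  then show ?case using n(1) by (intro exI[of _ "n + 1"]) (auto simp: fun_upd_def split: if_splits)
next
  case (GFor u v g)
  define N where "N = length (e u)"
  define G where "G i = gsem g (e(v := replicate i 1))" for i
  define lp where "lp = Loop (ReadI u v) {0} (\<lambda>_. Seq (comp g out) (push v 1))"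
  have u: "u \<in> V" "u \<noteq> v" "u \<noteq> out" "v \<noteq> out" "N \<le> S" using GFor.prems by (auto simp: N_def)
  \<comment> \<open>Invariant with k rounds to go: the counter holds i ones and \<open>acc\<close>
    is the output produced so far.\<close>
  have loop: "\<exists>n \<le> k * (cost g S + 4) + 1. exec lp (e(v := replicate i 1, out := acc)) n
     (e(v := replicate N 1, out := acc @ concat (map G [i..<N])))" if "i + k = N" for i k acc
    using that
  proof (induction k arbitrary: i acc)
    case 0
    have "rd (e u) N = 0" by (simp add: rd_def N_def)
    then have "exec lp (e(v := replicate i 1, out := acc)) 1 (e(v := replicate i 1, out := acc))"
      unfolding lp_def using 0 u by (intro exec_LoopE[of _ _ 0]) auto
    moreover have "i = N" using 0 by simp
    ultimately show ?case by (intro exI[of _ 1]) (simp add: fun_upd_def)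
  next
    case (Suc k)
    let ?e = "e(v := replicate i 1, out := acc)"
    have "\<exists>n\<le>cost g S. exec (comp g out) ?e n (?e(out := ?e out @ gsem g ?e))"
      by (rule GFor.IH[of "insert v V" "Suc v"]) (use GFor.prems u Suc.prems in auto)
    moreover have "gsem g ?e = G i" unfolding G_def
      by (rule gsem_cong[of g "insert v V" "Suc v"]) (use GFor.prems u in auto)
    ultimately obtain n1 where n1: "n1 \<le> cost g S"
      "exec (comp g out) ?e n1 (e(v := replicate i 1, out := acc @ G i))" by auto
    have "exec (push v 1) (e(v := replicate i 1, out := acc @ G i)) 2 (e(v := replicate (Suc i) 1, out := acc @ G i))"
      using exec_push[of v 1 "e(v := replicate i 1, out := acc @ G i)"] u
      by (simp add: fun_upd_twist replicate_append_same)
    from exec_Seq[OF n1(2) this]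
    have 1: "exec (Seq (comp g out) (push v 1)) ?e (n1 + 2 + 1) (e(v := replicate (Suc i) 1, out := acc @ G i))" .
    obtain n2 where n2: "n2 \<le> k * (cost g S + 4) + 1"
      "exec lp (e(v := replicate (Suc i) 1, out := acc @ G i)) n2
       (e(v := replicate N 1, out := (acc @ G i) @ concat (map G [Suc i..<N])))"
    proof -
      have "Suc i + k = N" using Suc.prems by simp
      from Suc.IH[OF this, of "acc @ G i"] show thesis using that by blast
    qed
    have iN: "i < N" using Suc.prems by simp
    have "rd (e u) i \<in> set (e u)" using iN by (simp add: rd_def N_def)
    then have "rd (e u) i \<noteq> 0" using GFor.prems(6)[OF u(1)] by metis
    then have "exec lp ?e (n1 + 2 + 1 + n2 + 1) (e(v := replicate N 1, out := (acc @ G i) @ concat (map G [Suc i..<N])))"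
      using n2(2) 1 u unfolding lp_def by (intro exec_LoopC[of _ _ "rd (e u) i" ?e]) auto
    moreover have "[i..<N] = i # [Suc i..<N]" using iN by (simp add: upt_rec)
    ultimately show ?case using n1(1) n2(1) by (intro exI[of _ "n1 + 2 + 1 + n2 + 1"]) (auto simp: fun_upd_def)
  qed
  have ev: "e v = []" using GFor.prems by simp
  then have "e(v := replicate 0 1, out := e out) = e" by (auto simp: fun_eq_iff)
  then obtain n where n: "n \<le> N * (cost g S + 4) + 1" "exec lp e n (e(v := replicate N 1, out := e out @ concat (map G [0..<N])))"
    using loop[of 0 N "e out"] by (metis add_0)
  have c: "exec (clear v) (e(v := replicate N 1, out := e out @ concat (map G [0..<N]))) (2 * N + 1)
     (e(out := e out @ concat (map G [0..<N])))"
  proof -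
    have id: "(e(v := replicate N 1, out := e out @ concat (map G [0..<N])))(v := []) = e(out := e out @ concat (map G [0..<N]))"
      using u ev by (auto simp: fun_eq_iff)
    have "exec (clear v) (e(v := replicate N 1, out := e out @ concat (map G [0..<N]))) (2 * length (replicate N (1::nat)) + 1)
       ((e(v := replicate N 1, out := e out @ concat (map G [0..<N])))(v := []))"
      by (rule exec_clear) (use u in auto)
    then show ?thesis unfolding id length_replicate .
  qed
  have "n + (2 * N + 1) + 1 \<le> S * (cost g S + 6) + 3"
  proof -
    have "N * (cost g S + 6) \<le> S * (cost g S + 6)" using u by (intro mult_le_mono1)
    then show ?thesis using n(1) by (simp add: algebra_simps)
  qed
  then show ?case using exec_Seq[OF n(2) c] unfolding lp_def G_def N_def
    by (intro exI[of _ "n + (2 * N + 1) + 1"]) (auto simp: N_def fun_upd_def)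
next
  case (GLet v g h)
  have ev: "e v = []" and vo: "v \<noteq> out" "v \<notin> V" using GLet.prems by auto
  define x where "x = gsem g e"
  have lenx: "length x \<le> cost g S" unfolding x_def
    by (rule length_gsem[of g V "Suc v"]) (use GLet.prems in auto)
  have nzx: "0 \<notin> set x" using gsem_symbols[of g V "Suc v" e] GLet.prems by (auto simp: x_def)
  have "\<exists>n\<le>cost g S. exec (comp g v) e n (e(v := e v @ gsem g e))"
    by (rule GLet.IH(1)[of V "Suc v"]) (use GLet.prems vo in auto)
  then obtain n1 where n1: "n1 \<le> cost g S" "exec (comp g v) e n1 (e(v := x))" using ev by (auto simp: x_def)
  let ?e = "e(v := x)"
  have "\<exists>n\<le>cost h (S + cost g S). exec (comp h out) ?e n (?e(out := ?e out @ gsem h ?e))"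
    by (rule GLet.IH(2)[of "insert v V" "Suc v"]) (use GLet.prems vo lenx nzx in \<open>auto intro: trans_le_add1\<close>)
  then obtain n2 where n2: "n2 \<le> cost h (S + cost g S)" "exec (comp h out) ?e n2 (?e(out := e out @ gsem h ?e))"
    using vo by auto
  have c: "exec (clear v) (?e(out := e out @ gsem h ?e)) (2 * length x + 1) (e(out := e out @ gsem h ?e))"
  proof -
    have id: "(?e(out := e out @ gsem h ?e))(v := []) = e(out := e out @ gsem h ?e)"
      using vo ev by (auto simp: fun_eq_iff)
    have "exec (clear v) (?e(out := e out @ gsem h ?e)) (2 * length x + 1) ((?e(out := e out @ gsem h ?e))(v := []))"
      by (rule exec_clear) (use vo nzx in auto)
    then show ?thesis unfolding id .
  qed
  show ?case using exec_Seq[OF n1(2) exec_Seq[OF n2(2) c]] n1(1) n2(1) lenx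
    by (intro exI[of _ "n1 + (n2 + (2 * length x + 1) + 1) + 1"]) (auto simp: x_def fun_upd_def)
qed

section \<open>Functions bounded by a polynomial\<close>

text \<open>The base S + 2 is at least 2, so constants and factors can be absorbed into the exponent
  and a single number a describes the bound.\<close>

definition poly_bounded_fun :: "(nat \<Rightarrow> nat) \<Rightarrow> bool" where
  "poly_bounded_fun f \<longleftrightarrow> (\<exists>a. \<forall>S. f S \<le> (S + 2) ^ a)"

lemma poly_bounded_const: "poly_bounded_fun (\<lambda>S. c)"
  unfolding poly_bounded_fun_def
proof (intro exI[of _ c] allI)
  fix S :: nat
  have "c \<le> 2 ^ c" by (simp add: less_imp_le)
  also have "\<dots> \<le> (S + 2) ^ c" by (intro power_mono) auto
  finally show "c \<le> (S + 2) ^ c" .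
qed

lemma poly_bounded_id: "poly_bounded_fun (\<lambda>S. S)"
  unfolding poly_bounded_fun_def by (intro exI[of _ 1]) simp

lemma poly_bounded_add:
  assumes "poly_bounded_fun f" "poly_bounded_fun g" shows "poly_bounded_fun (\<lambda>S. f S + g S)"
proof -
  obtain a b where a: "\<And>S. f S \<le> (S + 2) ^ a" and b: "\<And>S. g S \<le> (S + 2) ^ b"
    using assms unfolding poly_bounded_fun_def by blast
  have "f S + g S \<le> (S + 2) ^ Suc (max a b)" for S
  proof -
    have "f S \<le> (S + 2) ^ max a b" by (rule order_trans[OF a power_increasing]) auto
    moreover have "g S \<le> (S + 2) ^ max a b" by (rule order_trans[OF b power_increasing]) auto
    ultimately have "f S + g S \<le> 2 * (S + 2) ^ max a b" by linarith
    also have "\<dots> \<le> (S + 2) * (S + 2) ^ max a b" by (intro mult_le_mono1) simp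
    finally show ?thesis by simp
  qed
  then show ?thesis unfolding poly_bounded_fun_def by blast
qed

lemma poly_bounded_mult:
  assumes "poly_bounded_fun f" "poly_bounded_fun g" shows "poly_bounded_fun (\<lambda>S. f S * g S)"
proof -
  obtain a b where a: "\<And>S. f S \<le> (S + 2) ^ a" and b: "\<And>S. g S \<le> (S + 2) ^ b"
    using assms unfolding poly_bounded_fun_def by blast
  have "f S * g S \<le> (S + 2) ^ (a + b)" for S
    unfolding power_add using a b by (rule mult_le_mono)
  then show ?thesis unfolding poly_bounded_fun_def by blast
qed

lemma poly_bounded_compose:
  assumes "poly_bounded_fun f" "poly_bounded_fun g" shows "poly_bounded_fun (\<lambda>S. f (g S))"
proof -
  obtain a where a: "\<And>S. f S \<le> (S + 2) ^ a" using assms unfolding poly_bounded_fun_def by blast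
  obtain b where b: "\<And>S. g S + 2 \<le> (S + 2) ^ b"
    using poly_bounded_add[OF assms(2) poly_bounded_const[of 2]] unfolding poly_bounded_fun_def by blast
  have "f (g S) \<le> (S + 2) ^ (b * a)" for S
    unfolding power_mult by (rule order_trans[OF a power_mono[OF b]]) simp
  then show ?thesis unfolding poly_bounded_fun_def by blast
qed

lemmas poly_bounded_intros = poly_bounded_const poly_bounded_id poly_bounded_add poly_bounded_mult

text \<open>\<open>GLet\<close> is the only case that substitutes one cost into another. The nesting
  is fixed by the program, so finitely many compositions of polynomials occur.\<close>

lemma poly_bounded_cost: "poly_bounded_fun (cost g)"
proof (induction g)
  case (GLet v g h)
  show ?case unfolding cost.simps
    by (intro poly_bounded_intros poly_bounded_compose[OF GLet.IH(2)] GLet.IH)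
qed (simp_all only: cost.simps, (intro poly_bounded_intros; assumption)+)

section \<open>Preprocessing of the formula\<close>

definition runs :: "cmd \<Rightarrow> store \<Rightarrow> store \<Rightarrow> nat \<Rightarrow> bool" where
  "runs c s s' B \<longleftrightarrow> (\<exists>n\<le>B. exec c s n s')"

lemma runs_Skip: "runs Skip s s 1"
  unfolding runs_def using exec_Skip by blast

lemma runs_Seq: "runs a s s1 B1 \<Longrightarrow> runs b s1 s2 B2 \<Longrightarrow> runs (Seq a b) s s2 (B1 + B2 + 1)"
  unfolding runs_def using exec_Seq add_le_mono by (meson le_refl)

lemma runs_Do: "istep q s = (r, s1) \<Longrightarrow> runs (f r) s1 s2 B \<Longrightarrow> runs (Do q f) s s2 (B + 1)"
  unfolding runs_def using exec_Do add_le_mono by (meson le_refl)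

lemma runs_LoopE: "istep q s = (r, s1) \<Longrightarrow> r \<in> E \<Longrightarrow> runs (Loop q E f) s s1 1"
  unfolding runs_def using exec_LoopE by blast

lemma runs_LoopC: "istep q s = (r, s1) \<Longrightarrow> r \<notin> E \<Longrightarrow> runs (f r) s1 s2 B1 \<Longrightarrow>
    runs (Loop q E f) s2 s3 B2 \<Longrightarrow> runs (Loop q E f) s s3 (B1 + B2 + 1)"
  unfolding runs_def using exec_LoopC add_le_mono by (meson le_refl)

lemma runs_mono: "runs c s s' B \<Longrightarrow> B \<le> B' \<Longrightarrow> runs c s s' B'"
  unfolding runs_def using le_trans by blast

lemma bin_0 [simp]: "bin 0 = []"
  by simp

lemma bin_pos: "0 < n \<Longrightarrow> bin n = bin (n div 2) @ [n mod 2 + 1]"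
  by simp

declare bin.simps [simp del]

lemma bin_symbols: "set (bin n) \<subseteq> {1, 2}"
proof (induction n rule: less_induct)
  case (less n)
  show ?case
  proof (cases "n = 0")
    case False
    then have "set (bin (n div 2)) \<subseteq> {1, 2}" using less[of "n div 2"] by simp
    then show ?thesis using False by (auto simp: bin_pos)
  qed simp
qed

definition token :: "int \<Rightarrow> nat list" where
  "token z = (if z < 0 then 2 else 1) # bin (nat \<bar>z\<bar>)"

lemma enc_int_token: "enc_int z = token z @ [3]"
  by (simp add: enc_int_def token_def)

lemma token_symbols: "set (token z) \<subseteq> {1, 2}"
  using bin_symbols[of "nat \<bar>z\<bar>"] by (auto simp: token_def)

lemma enc_int_symbols: "set (enc_int z) \<subseteq> {1, 2, 3}"
  using token_symbols[of z] by (auto simp: enc_int_token)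

lemma enc_ints_symbols: "set (enc_ints zs) \<subseteq> {1, 2, 3}"
  using enc_int_symbols by (fastforce simp: enc_ints_def)

text \<open>Tokens end with the symbol 3; the empty token marks the beginning of a clause.\<close>

definition clause_string :: "int list list \<Rightarrow> nat list" where
  "clause_string cls = concat (map (\<lambda>C. 3 # concat (map enc_int C)) cls)"

text \<open>Stack 0 is the input, stack 1 the output, and stack 3 holds the unread rest x in
  reverse, so that popping reads it from left to right.\<close>

definition prep_store :: "nat list \<Rightarrow> nat list \<Rightarrow> nat list \<Rightarrow> store" where
  "prep_store p f x = (\<lambda>j. if j = 0 then p else if j = 1 then f else if j = 3 then rev x else [])"

definition load :: cmd where
  "load = Loop (PopI 0) {0} (\<lambda>s. if s = 0 then Skip else push 3 s)"

definition drop_symbol :: cmd where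
  "drop_symbol = Do (PopI 3) (\<lambda>_. Skip)"

definition drop_token :: cmd where
  "drop_token = Loop (PopI 3) {0, 3} (\<lambda>_. Skip)"

definition copy_token :: cmd where
  "copy_token = Seq (Loop (PopI 3) {0, 3} (\<lambda>s. if s = 0 then Skip else push 1 s)) (push 1 3)"

text \<open>The sign symbol of the clause length has already been popped by \<open>parse\<close>.
  What remains of the encoded lengths 0, 1, 2, 3 is 3; 2 3; 2 1 3; 2 2 3, and the nested tests
  distinguish these four cases by at most two symbols.\<close>

definition clause_body :: cmd where
  "clause_body = Seq (push 1 3) (Do (PopI 3) (\<lambda>s. if s = 2 then
      Do (PopI 3) (\<lambda>s. if s = 3 then copy_token
         else if s = 1 then Seq drop_symbol (Seq copy_token copy_token)
         else Seq drop_symbol (Seq copy_token (Seq copy_token copy_token)))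
    else Skip))"

definition parse :: cmd where
  "parse = Loop (PopI 3) {0} (\<lambda>_. clause_body)"

definition prep :: cmd where
  "prep = Seq load (Seq drop_token (Seq drop_token parse))"

lemma wf_cmd_prep: "4 \<le> K \<Longrightarrow> wf_cmd K prep"
  by (auto simp: prep_def load_def drop_token_def parse_def clause_body_def copy_token_def drop_symbol_def push_def)

lemma pop_prep: "istep (PopI 3) (prep_store p f (a # w)) = (a, prep_store p f w)"
  by (auto simp: prep_store_def fun_eq_iff butlast_append)

lemma pop_prep_Nil: "istep (PopI 3) (prep_store p f []) = (0, prep_store p f [])"
  by (auto simp: prep_store_def fun_eq_iff)

lemma runs_push_prep: "runs (push 1 a) (prep_store p f w) (prep_store p (f @ [a]) w) 2"
proof -
  have "(prep_store p f w)(1 := prep_store p f w 1 @ [a]) = prep_store p (f @ [a]) w"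
    by (auto simp: prep_store_def fun_eq_iff)
  then show ?thesis unfolding runs_def using exec_push[of 1 a "prep_store p f w"] by auto
qed

lemma runs_load: "0 \<notin> set p \<Longrightarrow> runs load (prep_store p [] x) (prep_store [] [] (p @ x)) (3 * length p + 1)"
proof (induction p arbitrary: x rule: rev_induct)
  case Nil
  have "istep (PopI 0) (prep_store [] [] x) = (0, prep_store [] [] x)"
    by (auto simp: prep_store_def fun_eq_iff)
  from runs_LoopE[OF this, of "{0}" "\<lambda>s. if s = 0 then Skip else push 3 s"]
  show ?case by (simp add: load_def)
next
  case (snoc a p)
  have 1: "istep (PopI 0) (prep_store (p @ [a]) [] x) = (a, prep_store p [] x)"
    by (auto simp: prep_store_def fun_eq_iff)
  have "(prep_store p [] x)(3 := prep_store p [] x 3 @ [a]) = prep_store p [] (a # x)"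
    by (auto simp: prep_store_def fun_eq_iff)
  then have "runs (push 3 a) (prep_store p [] x) (prep_store p [] (a # x)) 2"
    unfolding runs_def using exec_push[of 3 a "prep_store p [] x"] by auto
  then have 2: "runs (if a = 0 then Skip else push 3 a) (prep_store p [] x) (prep_store p [] (a # x)) 2"
    using snoc.prems by auto
  have 3: "runs load (prep_store p [] (a # x)) (prep_store [] [] (p @ a # x)) (3 * length p + 1)"
    by (rule snoc.IH) (use snoc.prems in auto)
  have "a \<notin> {0}" using snoc.prems by auto
  from runs_LoopC[OF 1 this, of "\<lambda>s. if s = 0 then Skip else push 3 s", OF 2 3[unfolded load_def]]
  show ?case unfolding load_def by (auto elim: runs_mono)
qed

lemma runs_drop_symbol: "runs drop_symbol (prep_store p f (a # w)) (prep_store p f w) 2"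
  using runs_Do[where f = "\<lambda>_. Skip", OF pop_prep runs_Skip, of p f a w]
  by (simp add: drop_symbol_def numeral_2_eq_2)

lemma runs_drop_token:
  "set bs \<subseteq> {1, 2} \<Longrightarrow> runs drop_token (prep_store p f (bs @ 3 # w)) (prep_store p f w) (2 * length bs + 1)"
proof (induction bs)
  case Nil
  show ?case using runs_LoopE[OF pop_prep, of 3 "{0,3}"] by (simp add: drop_token_def)
next
  case (Cons a bs)
  then have a: "a \<notin> {0, 3}" by auto
  from runs_LoopC[OF pop_prep a, of "\<lambda>_. Skip" p f "bs @ 3 # w", OF runs_Skip] Cons
  show ?case unfolding drop_token_def by (auto intro: runs_mono)
qed

lemma runs_copy_token:
  assumes "set bs \<subseteq> {1, 2}"
  shows "runs copy_token (prep_store p f (bs @ 3 # w)) (prep_store p (f @ bs @ [3]) w) (3 * length bs + 4)"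
proof -
  let ?l = "Loop (PopI 3) {0, 3} (\<lambda>s. if s = 0 then Skip else push 1 s)"
  have "runs ?l (prep_store p f (bs @ 3 # w)) (prep_store p (f @ bs) w) (3 * length bs + 1)"
    using assms
  proof (induction bs arbitrary: f)
    case Nil
    show ?case using runs_LoopE[OF pop_prep, of 3 "{0,3}"] by simp
  next
    case (Cons a bs)
    then have a: "a \<notin> {0, 3}" by auto
    have 1: "runs (if a = 0 then Skip else push 1 a) (prep_store p f (bs @ 3 # w)) (prep_store p (f @ [a]) (bs @ 3 # w)) 2"
      using a runs_push_prep by simp
    have 2: "runs ?l (prep_store p (f @ [a]) (bs @ 3 # w)) (prep_store p ((f @ [a]) @ bs) w) (3 * length bs + 1)"
      by (rule Cons.IH) (use Cons.prems in simp)
    from runs_LoopC[OF pop_prep a, of "\<lambda>s. if s = 0 then Skip else push 1 s" p f "bs @ 3 # w", OF 1 2]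
    show ?case by (auto intro: runs_mono)
  qed
  from runs_Seq[OF this runs_push_prep[of 3]] show ?thesis unfolding copy_token_def by (auto intro: runs_mono)
qed

lemma runs_copy_lit: "runs copy_token (prep_store p f (enc_int l @ w)) (prep_store p (f @ enc_int l) w) (4 * length (enc_int l))"
  using runs_mono[OF runs_copy_token[OF token_symbols[of l], of p f w], of "4 * length (enc_int l)"]
  by (simp add: enc_int_token)

definition enc_clause :: "int list \<Rightarrow> int list" where
  "enc_clause C = int (length C) # C"

lemma small_enc_int: "enc_int 0 = [1, 3]" "enc_int 1 = [1, 2, 3]" "enc_int 2 = [1, 2, 1, 3]" "enc_int 3 = [1, 2, 2, 3]"
  by (simp_all add: enc_int_def bin_pos)

lemma runs_pop: "runs (f a) (prep_store p g w) s B \<Longrightarrow> runs (Do (PopI 3) f) (prep_store p g (a # w)) s (B + 1)"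
  by (rule runs_Do[OF pop_prep])

text \<open>The \<open>tl\<close> accounts for the sign symbol consumed by the loop test of
  \<open>parse\<close>, which thereby distinguishes a further clause from the end of the
  input.\<close>

lemma runs_clause:
  assumes "length C \<le> 3"
  shows "runs clause_body (prep_store p f (tl (enc_ints (enc_clause C)) @ w))
    (prep_store p (f @ 3 # concat (map enc_int C)) w) (10 * length (enc_ints (enc_clause C)) - 1)"
proof -
  let ?f = "f @ [3]"
  note [simp] = enc_ints_def enc_clause_def small_enc_int
  define F2 where "F2 = (\<lambda>s::nat. if s = 3 then copy_token
         else if s = 1 then Seq drop_symbol (Seq copy_token copy_token)
         else Seq drop_symbol (Seq copy_token (Seq copy_token copy_token)))"
  define F1 where "F1 = (\<lambda>s::nat. if s = 2 then Do (PopI 3) F2 else Skip)"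
  have F: "F1 3 = Skip" "F1 2 = Do (PopI 3) F2" "F2 3 = copy_token" "F2 1 = Seq drop_symbol (Seq copy_token copy_token)"
    "F2 2 = Seq drop_symbol (Seq copy_token (Seq copy_token copy_token))"
    by (simp_all add: F1_def F2_def)
  have body: "runs clause_body (prep_store p f (a # x)) s (B + 4)" if "runs (F1 a) (prep_store p ?f x) s B" for a x s B
    using runs_Seq[OF runs_push_prep[of 3 p f] runs_pop[where f = F1, OF that]]
    unfolding clause_body_def F1_def F2_def by (rule runs_mono) simp
  have two: "runs (F1 2) (prep_store p ?f (a # x)) s (B + 1)" if "runs (F2 a) (prep_store p ?f x) s B" for a x s B
    unfolding F by (rule runs_pop[where f = F2, OF that])
  from assms consider "C = []" | l1 where "C = [l1]" | l1 l2 where "C = [l1, l2]" | l1 l2 l3 where "C = [l1, l2, l3]"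
    by (cases C; cases "tl C"; cases "tl (tl C)"; cases "tl (tl (tl C))") auto
  then show ?thesis
  proof cases
    case 1
    have "runs (F1 3) (prep_store p ?f w) (prep_store p ?f w) 1" unfolding F by (rule runs_Skip)
    from body[OF this] show ?thesis using 1 by (auto elim: runs_mono)
  next
    case (2 l1)
    have "runs (F2 3) (prep_store p ?f (enc_int l1 @ w)) (prep_store p (?f @ enc_int l1) w) (4 * length (enc_int l1))"
      unfolding F by (rule runs_copy_lit)
    from body[OF two[OF this]] show ?thesis using 2 by (auto elim: runs_mono)
  next
    case (3 l1 l2)
    have "runs (F2 1) (prep_store p ?f (3 # enc_int l1 @ enc_int l2 @ w)) (prep_store p ((?f @ enc_int l1) @ enc_int l2) w)
       (2 + (4 * length (enc_int l1) + 4 * length (enc_int l2) + 1) + 1)"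
      unfolding F by (rule runs_Seq[OF runs_drop_symbol runs_Seq[OF runs_copy_lit runs_copy_lit]])
    from body[OF two[OF this]] show ?thesis using 3 by (auto elim: runs_mono)
  next
    case (4 l1 l2 l3)
    have "runs (F2 2) (prep_store p ?f (3 # enc_int l1 @ enc_int l2 @ enc_int l3 @ w))
       (prep_store p (((?f @ enc_int l1) @ enc_int l2) @ enc_int l3) w)
       (2 + (4 * length (enc_int l1) + (4 * length (enc_int l2) + 4 * length (enc_int l3) + 1) + 1) + 1)"
      unfolding F by (rule runs_Seq[OF runs_drop_symbol runs_Seq[OF runs_copy_lit runs_Seq[OF runs_copy_lit runs_copy_lit]]])
    from body[OF two[OF this]] show ?thesis using 4 by (auto elim: runs_mono)
  qed
qed

lemma runs_parse:
  "\<forall>C\<in>set cls. length C \<le> 3 \<Longrightarrow>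
   runs parse (prep_store p f (enc_ints (concat (map enc_clause cls)))) (prep_store p (f @ clause_string cls) [])
     (10 * length (enc_ints (concat (map enc_clause cls))) + 1)"
proof (induction cls arbitrary: f)
  case Nil
  show ?case using runs_LoopE[OF pop_prep_Nil, of "{0}" "\<lambda>_. clause_body"]
    by (simp add: parse_def enc_ints_def clause_string_def)
next
  case (Cons C cls)
  let ?w = "enc_ints (concat (map enc_clause cls))" and ?c = "enc_ints (enc_clause C)"
  have eq: "enc_ints (concat (map enc_clause (C # cls))) = 1 # tl ?c @ ?w"
    by (simp add: enc_ints_def enc_clause_def enc_int_def)
  have ne: "?c \<noteq> []" by (simp add: enc_ints_def enc_clause_def enc_int_def)
  have 1: "runs clause_body (prep_store p f (tl ?c @ ?w)) (prep_store p (f @ 3 # concat (map enc_int C)) ?w) (10 * length ?c - 1)"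
    by (rule runs_clause) (use Cons.prems in simp)
  have 2: "runs parse (prep_store p (f @ 3 # concat (map enc_int C)) ?w)
     (prep_store p ((f @ 3 # concat (map enc_int C)) @ clause_string cls) []) (10 * length ?w + 1)"
    by (rule Cons.IH) (use Cons.prems in simp)
  have nz: "(1::nat) \<notin> {0}" by simp
  have 3: "runs parse (prep_store p f (1 # tl ?c @ ?w)) (prep_store p ((f @ 3 # concat (map enc_int C)) @ clause_string cls) [])
     ((10 * length ?c - 1) + (10 * length ?w + 1) + 1)"
    unfolding parse_def by (rule runs_LoopC[OF pop_prep nz 1 2[unfolded parse_def]])
  have fin: "(f @ 3 # concat (map enc_int C)) @ clause_string cls = f @ clause_string (C # cls)"
    by (simp add: clause_string_def)
  have "length ?c > 0" using ne by simp
  then have "(10 * length ?c - 1) + (10 * length ?w + 1) + 1 \<le> 10 * length (1 # tl ?c @ ?w) + 1" by simp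
  then show ?case unfolding eq using runs_mono[OF 3] unfolding fin by blast
qed

lemma enc_3sat_eq: "enc_3sat n cls = token (int n) @ 3 # token (int (length cls)) @ 3 # enc_ints (concat (map enc_clause cls))"
  by (simp add: enc_3sat_def enc_ints_def enc_int_token enc_clause_def[abs_def])

lemma runs_prep:
  assumes "is_3cnf n cls"
  shows "runs prep (input_store (enc_3sat n cls)) (prep_store [] (clause_string cls) []) (20 * length (enc_3sat n cls) + 10)"
proof -
  let ?w = "enc_3sat n cls" and ?t1 = "token (int n)" and ?t2 = "token (int (length cls))"
  let ?r = "enc_ints (concat (map enc_clause cls))"
  have init: "input_store ?w = prep_store ?w [] []" by (auto simp: input_store_def prep_store_def)
  have "0 \<notin> set ?w" using enc_ints_symbols unfolding enc_3sat_def by fastforce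
  then have 1: "runs load (prep_store ?w [] []) (prep_store [] [] ?w) (3 * length ?w + 1)"
    using runs_load[of ?w "[]"] by simp
  have 2: "runs drop_token (prep_store [] [] ?w) (prep_store [] [] (?t2 @ 3 # ?r)) (2 * length ?t1 + 1)"
    unfolding enc_3sat_eq by (rule runs_drop_token[OF token_symbols])
  have 3: "runs drop_token (prep_store [] [] (?t2 @ 3 # ?r)) (prep_store [] [] ?r) (2 * length ?t2 + 1)"
    by (rule runs_drop_token[OF token_symbols])
  have 4: "runs parse (prep_store [] [] ?r) (prep_store [] ([] @ clause_string cls) []) (10 * length ?r + 1)"
    by (rule runs_parse) (use assms in \<open>simp add: is_3cnf_def\<close>)
  have len: "length ?w = length ?t1 + length ?t2 + length ?r + 2" by (simp add: enc_3sat_eq)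
  show ?thesis unfolding prep_def init
    by (rule runs_mono[OF runs_Seq[OF 1 runs_Seq[OF 2 runs_Seq[OF 3 4]], simplified append_Nil]]) (use len in linarith)
qed


section \<open>The reduction as a Turing machine\<close>

definition gen_env :: "nat list \<Rightarrow> store" where
  "gen_env F = (\<lambda>j. if j = 1 then F else [])"

lemma clause_string_symbols: "set (clause_string cls) \<subseteq> {1, 2, 3}"
proof -
  have C: "set (concat (map enc_int C)) \<subseteq> {1, 2, 3}" for C
    using enc_ints_symbols[of C] by (simp add: enc_ints_def)
  show ?thesis
  proof (induction cls)
    case (Cons C cls)
    then show ?case using C[of C] by (simp add: clause_string_def)
  qed (simp add: clause_string_def)
qed

lemma length_clause_string: "length (clause_string cls) \<le> length (enc_3sat n cls)"
proof -
  have "length (clause_string cls) \<le> length (enc_ints (concat (map enc_clause cls)))"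
    by (induction cls) (auto simp: clause_string_def enc_ints_def enc_clause_def enc_int_def)
  then show ?thesis by (simp add: enc_3sat_eq)
qed

lemma poly_bounded_funD:
  assumes "poly_bounded_fun f" obtains a where "\<And>S. f S \<le> (S + 2) ^ a"
  using assms unfolding poly_bounded_fun_def by blast

text \<open>The generator reads the clause string in variable 1 and the always empty variable 2; its
  binders start at 3, a stack that the preprocessing leaves empty. Clearing stack 1 afterwards
  leaves the generated string alone on the tape.\<close>

lemma reduction_tm:
  assumes M: "wf_tm M" and g: "ok g {1, 2} 3"
  obtains M' a where "wf_tm M'"
    "\<And>n cls T b. is_3cnf n cls \<Longrightarrow> decides_within M (gsem g (gen_env (clause_string cls))) T b \<Longrightarrow>
       decides_within M' (enc_3sat n cls) (real ((length (enc_3sat n cls) + 2) ^ a) + 2 * T) b"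
proof -
  define K where "K = max_var g + 4"
  define c where "c = Seq prep (Seq (comp g 0) (clear 1))"
  have K: "0 < K" "4 \<le> K" "max_var g < K" by (simp_all add: K_def)
  have "wf_cmd K (comp g 0)" by (rule wf_cmd_comp[OF g]) (use K in auto)
  then have wfc: "wf_cmd K c" using wf_cmd_prep[OF K(2)] K by (simp add: c_def clear_def)
  define N where "N = (\<lambda>L. (20 * L + 10) + (cost g L + (2 * L + 1) + 1) + 1)"
  define B where "B = (\<lambda>L. 4 + N L * (10 * (K + 1) * (L + N L + 2)))"
  have "poly_bounded_fun B" unfolding B_def N_def
    by (intro poly_bounded_intros poly_bounded_cost)
  then obtain a where a: "\<And>S. B S \<le> (S + 2) ^ a" by (rule poly_bounded_funD) blast
  obtain M' where M': "wf_tm M'"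
    "\<And>w u n T b. set w \<subseteq> {1, 2, 3} \<Longrightarrow> exec c (input_store w) n (input_store u) \<Longrightarrow> decides_within M u T b \<Longrightarrow>
       decides_within M' w (real (4 + n * (10 * (K + 1) * (length w + n + 2))) + 2 * T) b"
    by (rule compose_tm[OF M K(1) wfc]) blast
  show thesis
  proof (rule that[OF M'(1)])
    fix n cls T b assume cnf: "is_3cnf n cls"
      and dec: "decides_within M (gsem g (gen_env (clause_string cls))) T b"
    let ?w = "enc_3sat n cls" and ?F = "clause_string cls"
    let ?u = "gsem g (gen_env ?F)" and ?L = "length ?w"
    have F: "0 \<notin> set ?F" using clause_string_symbols[of cls] by auto
    have env: "prep_store [] ?F [] = gen_env ?F" by (auto simp: prep_store_def gen_env_def)
    have 1: "runs prep (input_store ?w) (gen_env ?F) (20 * ?L + 10)"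
      using runs_prep[OF cnf] unfolding env .
    have 2: "runs (comp g 0) (gen_env ?F) ((gen_env ?F)(0 := gen_env ?F 0 @ ?u)) (cost g ?L)"
      unfolding runs_def
      by (rule exec_comp[OF g]) (use F length_clause_string[of cls n] in \<open>auto simp: gen_env_def\<close>)
    have fin: "((gen_env ?F)(0 := gen_env ?F 0 @ ?u))(1 := []) = input_store ?u"
      by (auto simp: gen_env_def input_store_def fun_eq_iff)
    have "exec (clear 1) ((gen_env ?F)(0 := gen_env ?F 0 @ ?u)) (2 * length ?F + 1) (((gen_env ?F)(0 := gen_env ?F 0 @ ?u))(1 := []))"
      by (rule exec_clear[OF F]) (simp add: gen_env_def)
    then have 3: "runs (clear 1) ((gen_env ?F)(0 := gen_env ?F 0 @ ?u)) (input_store ?u) (2 * ?L + 1)"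
      unfolding fin runs_def using length_clause_string[of cls n] by (intro exI[of _ "2 * length ?F + 1"]) auto
    obtain k where k: "k \<le> N ?L" "exec c (input_store ?w) k (input_store ?u)"
      using runs_Seq[OF 1 runs_Seq[OF 2 3]] unfolding c_def N_def runs_def by blast
    have sym: "set ?w \<subseteq> {1, 2, 3}" unfolding enc_3sat_def by (rule enc_ints_symbols)
    have "decides_within M' ?w (real (4 + k * (10 * (K + 1) * (?L + k + 2))) + 2 * T) b"
      by (rule M'(2)[OF sym k(2) dec])
    moreover have "4 + k * (10 * (K + 1) * (?L + k + 2)) \<le> B ?L"
      unfolding B_def using k(1) by (intro add_mono mult_le_mono) auto
    then have "real (4 + k * (10 * (K + 1) * (?L + k + 2))) \<le> real ((?L + 2) ^ a)"
      using a[of ?L] by (intro of_nat_mono) (rule order_trans)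
    ultimately show "decides_within M' ?w (real ((?L + 2) ^ a) + 2 * T) b"
      unfolding decides_within_def by (meson add_right_mono order_trans)
  qed
qed

section \<open>A polytope with prescribed integer points\<close>

text \<open>The coordinates of a bit and of its complement are adjacent, so that one loop over the
  bits writes a whole row; the last two coordinates are c and y.\<close>

definition row :: "nat \<Rightarrow> (nat \<Rightarrow> 'a) \<Rightarrow> (nat \<Rightarrow> 'a) \<Rightarrow> 'a \<Rightarrow> 'a \<Rightarrow> 'a list" where
  "row k a b c y = concat (map (\<lambda>j. [a j, b j]) [0..<k]) @ [c, y]"

lemma length_pairs: "length (concat (map (\<lambda>j. [a j, b j]) [0..<k])) = 2 * k"
  by (induction k) auto

lemma length_row [simp]: "length (row k a b c y) = 2 * k + 2"
  by (simp add: row_def length_pairs)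

lemma nth_pairs:
  "j < k \<Longrightarrow> concat (map (\<lambda>j. [a j, b j]) [0..<k]) ! (2 * j) = a j \<and>
     concat (map (\<lambda>j. [a j, b j]) [0..<k]) ! (2 * j + 1) = b j"
proof (induction k)
  case (Suc k)
  show ?case
  proof (cases "j < k")
    case True
    then show ?thesis using Suc by (simp add: nth_append length_pairs)
  next
    case False
    then have "j = k" using Suc by simp
    then show ?thesis by (simp add: nth_append length_pairs)
  qed
qed simp

lemma nth_row [simp]:
  "j < k \<Longrightarrow> row k a b c y ! (2 * j) = a j"
  "j < k \<Longrightarrow> row k a b c y ! (2 * j + 1) = b j"
  "j < k \<Longrightarrow> row k a b c y ! Suc (2 * j) = b j"
  "row k a b c y ! (2 * k) = c"
  "row k a b c y ! (2 * k + 1) = y"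
  "row k a b c y ! Suc (2 * k) = y"
  using nth_pairs[of j k a b] by (simp_all add: row_def nth_append length_pairs)

lemma sum_pairs:
  fixes k :: nat
  shows "(\<Sum>j<2 * k + 2. f j) = (\<Sum>j<k. f (2 * j) + f (2 * j + 1)) + f (2 * k) + (f (2 * k + 1) :: 'a::comm_monoid_add)"
  by (induction k) (simp_all add: add.assoc)

lemma less_pairs_cases:
  fixes i k :: nat
  assumes "i < 2 * k + 2"
  obtains j where "j < k" "i = 2 * j" | j where "j < k" "i = 2 * j + 1" | "i = 2 * k" | "i = 2 * k + 1"
proof -
  have "i = 2 * (i div 2) \<or> i = 2 * (i div 2) + 1" by linarith
  moreover have "i div 2 < k \<or> i div 2 = k" using assms by linarith
  ultimately show thesis using that by metis
qed

lemma row_eqI: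
  assumes "length x = 2 * k + 2" "\<And>j. j < k \<Longrightarrow> x ! (2 * j) = a j" "\<And>j. j < k \<Longrightarrow> x ! (2 * j + 1) = b j"
    "x ! (2 * k) = c" "x ! (2 * k + 1) = y"
  shows "x = row k a b c y"
proof (rule nth_equalityI)
  fix i assume "i < length x"
  then have "i < 2 * k + 2" using assms by simp
  then show "x ! i = row k a b c y ! i"
    by (rule less_pairs_cases) (use assms in auto)
qed (use assms in simp)

abbreviation bit_at :: "nat \<Rightarrow> nat \<Rightarrow> bool" where
  "bit_at i j \<equiv> odd (i div 2 ^ j)"

lemma bits_unique:
  assumes "i < 2 ^ k" "i' < 2 ^ k" "\<And>j. j < k \<Longrightarrow> bit_at i j = bit_at i' j"
  shows "i = i'"
proof (rule bit_eqI)
  fix n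
  show "bit i n \<longleftrightarrow> bit i' n"
  proof (cases "n < k")
    case True
    then show ?thesis using assms by (simp add: bit_iff_odd)
  next
    case False
    then have "(2::nat) ^ k \<le> 2 ^ n" by simp
    then have "i < 2 ^ n" "i' < 2 ^ n" using assms(1,2) by linarith+
    then show ?thesis by (simp add: bit_iff_odd)
  qed
qed

lemma bits_exist: "\<exists>i<2 ^ k. \<forall>j<k. bit_at i j = P j"
proof (induction k)
  case (Suc k)
  then obtain i where i: "i < 2 ^ k" "\<And>j. j < k \<Longrightarrow> bit_at i j = P j" by blast
  show ?case
  proof (cases "P k")
    case True
    have "bit_at (i + 2 ^ k) j = P j" if "j < Suc k" for j
    proof (cases "j = k")
      case True
      then show ?thesis using i(1) \<open>P k\<close> by simp
    next
      case False
      then have j: "j < k" using that by simp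
      then have "(2::nat) ^ k = 2 ^ (k - j) * 2 ^ j" by (simp flip: power_add)
      then have "(i + 2 ^ k) div 2 ^ j = i div 2 ^ j + 2 ^ (k - j)" by simp
      then show ?thesis using i(2)[OF j] j by simp
    qed
    then show ?thesis using i(1) by (intro exI[of _ "i + 2 ^ k"]) simp
  next
    case False
    then have "bit_at i j = P j" if "j < Suc k" for j
      using i that by (cases "j = k") auto
    then show ?thesis using i(1) by (intro exI[of _ i]) simp
  qed
qed auto

text \<open>The opposite vertex of the cube supplies the filling points. It is obtained by choice
  from \<open>bits_exist\<close>; that it is an involution follows from
  \<open>bits_unique\<close>.\<close>

lemma complement_exists:
  obtains cmp where "\<And>i. i < 2 ^ k \<Longrightarrow> cmp i < 2 ^ k" "\<And>i. i < 2 ^ k \<Longrightarrow> cmp (cmp i) = i"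
    "\<And>i j. i < 2 ^ k \<Longrightarrow> j < k \<Longrightarrow> bit_at (cmp i) j = (\<not> bit_at i j)"
proof -
  define cmp where "cmp i = (SOME i'. i' < 2 ^ k \<and> (\<forall>j<k. bit_at i' j = (\<not> bit_at i j)))" for i :: nat
  have c: "cmp i < 2 ^ k \<and> (\<forall>j<k. bit_at (cmp i) j = (\<not> bit_at i j))" for i
    unfolding cmp_def by (rule someI_ex) (use bits_exist[of k "\<lambda>j. \<not> bit_at i j"] in blast)
  have "cmp (cmp i) = i" if "i < 2 ^ k" for i
    by (rule bits_unique[of _ k]) (use c that in auto)
  then show thesis using that c by blast
qed

locale pic_gadget =
  fixes k :: nat and v :: "nat \<Rightarrow> nat" and T t :: nat
  assumes v_le: "i < 2 ^ k \<Longrightarrow> i' < 2 ^ k \<Longrightarrow> v i \<le> 2 * v i'"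
begin

definition pat1 :: "nat \<Rightarrow> nat \<Rightarrow> int" where
  "pat1 i j = (if bit_at i j then 0 else - int (v i))"

definition pat2 :: "nat \<Rightarrow> nat \<Rightarrow> int" where
  "pat2 i j = (if bit_at i j then - int (v i) else 0)"

definition unit_row :: "nat \<Rightarrow> int \<Rightarrow> int \<Rightarrow> int list" where
  "unit_row j \<alpha> \<beta> = row k (\<lambda>j'. if j' = j then \<alpha> else 0) (\<lambda>j'. if j' = j then \<beta> else 0) 0 0"

definition Amat :: "int list list" where
  "Amat = concat (map (\<lambda>i. [row k (pat1 i) (pat2 i) (- int (v i)) 1, row k (pat1 i) (pat2 i) (int (v i)) (- 1)]) [0..<2 ^ k])
     @ concat (map (\<lambda>j. [unit_row j 1 1, unit_row j (- 1) (- 1), unit_row j (- 1) 0, unit_row j 0 (- 1)]) [0..<k])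
     @ [row k (\<lambda>_. 0) (\<lambda>_. 0) 1 0, row k (\<lambda>_. 0) (\<lambda>_. 0) (- 1) 0]"

definition bvec :: "int list" where
  "bvec = concat (map (\<lambda>i. [0, 0]) [0..<(2::nat) ^ k]) @ concat (map (\<lambda>j. [1, - 1, 0, 0]) [0..<k]) @ [1, 0]"

definition qvec :: "int list" where
  "qvec = row k (\<lambda>_. int T) (\<lambda>_. int T) (int T) (int t)"

definition dim :: nat where
  "dim = 2 * k + 2"

text \<open>At a point with 0/1 bits and true complements this is the Hamming distance to i: where i
  has bit 1, the complement coordinate signals a difference, otherwise the bit itself does.
  \<open>pat1\<close> and \<open>pat2\<close> are the coefficients of this form times -v(i).\<close>

definition mismatch :: "real list \<Rightarrow> nat \<Rightarrow> real" where
  "mismatch x i = (\<Sum>j<k. if bit_at i j then x ! (2 * j + 1) else x ! (2 * j))"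

lemma zip_concat_map:
  "(\<And>x. length (f x) = length (g x)) \<Longrightarrow>
   zip (concat (map f xs)) (concat (map g xs)) = concat (map (\<lambda>x. zip (f x) (g x)) xs)"
  by (induction xs) auto

lemma length_concat_map_const: "(\<And>x. length (f x) = n) \<Longrightarrow> length (concat (map f xs)) = n * length xs"
  by (induction xs) auto

lemma length_Amat: "length Amat = 2 * 2 ^ k + 4 * k + 2"
  by (simp add: Amat_def length_concat_map_const[where n = 2] length_concat_map_const[where n = 4])

lemma length_bvec: "length bvec = length Amat"
  unfolding length_Amat
  by (simp add: bvec_def length_concat_map_const[where n = 2] length_concat_map_const[where n = 4])

lemma set_zip_Amat:
  "set (zip Amat bvec) =
    (\<Union>i<2 ^ k. {(row k (pat1 i) (pat2 i) (- int (v i)) 1, 0), (row k (pat1 i) (pat2 i) (int (v i)) (- 1), 0)}) \<union>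
    (\<Union>j<k. {(unit_row j 1 1, 1), (unit_row j (- 1) (- 1), - 1), (unit_row j (- 1) 0, 0), (unit_row j 0 (- 1), 0)}) \<union>
    {(row k (\<lambda>_. 0) (\<lambda>_. 0) 1 0, 1), (row k (\<lambda>_. 0) (\<lambda>_. 0) (- 1) 0, 0)}"
proof -
  have "zip Amat bvec = concat (map (\<lambda>i. zip [row k (pat1 i) (pat2 i) (- int (v i)) 1, row k (pat1 i) (pat2 i) (int (v i)) (- 1)] [0, 0]) [0..<2 ^ k])
     @ concat (map (\<lambda>j. zip [unit_row j 1 1, unit_row j (- 1) (- 1), unit_row j (- 1) 0, unit_row j 0 (- 1)] [1, - 1, 0, 0]) [0..<k])
     @ zip [row k (\<lambda>_. 0) (\<lambda>_. 0) 1 0, row k (\<lambda>_. 0) (\<lambda>_. 0) (- 1) 0] [1, 0]"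
    unfolding Amat_def bvec_def
    by (simp add: zip_append length_concat_map_const[where n = 2] length_concat_map_const[where n = 4]
        zip_concat_map)
  then show ?thesis by (simp add: lessThan_atLeast0 Un_assoc)
qed

text \<open>Stated for an arbitrary relation Q between a row and its right-hand side, so that the
  shape of the matrix is unfolded once, independently of the scalar products.\<close>

lemma ball_zip_Amat:
  "(\<forall>(r, \<beta>)\<in>set (zip Amat bvec). Q r \<beta>) \<longleftrightarrow>
    (\<forall>i<2 ^ k. Q (row k (pat1 i) (pat2 i) (- int (v i)) 1) 0 \<and> Q (row k (pat1 i) (pat2 i) (int (v i)) (- 1)) 0) \<and>
    (\<forall>j<k. Q (unit_row j 1 1) 1 \<and> Q (unit_row j (- 1) (- 1)) (- 1) \<and> Q (unit_row j (- 1) 0) 0 \<and> Q (unit_row j 0 (- 1)) 0) \<and>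
    Q (row k (\<lambda>_. 0) (\<lambda>_. 0) 1 0) 1 \<and> Q (row k (\<lambda>_. 0) (\<lambda>_. 0) (- 1) 0) 0"
  unfolding set_zip_Amat by (auto simp: ball_Un)

lemma row_dot:
  assumes "length x = dim"
  shows "(\<Sum>j<length x. real_of_int (row k a b c y ! j) * x ! j)
    = (\<Sum>j<k. real_of_int (a j) * x ! (2 * j) + real_of_int (b j) * x ! (2 * j + 1)) + real_of_int c * x ! (2 * k) + real_of_int y * x ! (2 * k + 1)"
  unfolding assms dim_def sum_pairs by simp

lemma pat_dot:
  assumes "length x = dim"
  shows "(\<Sum>j<length x. real_of_int (row k (pat1 i) (pat2 i) c y ! j) * x ! j)
    = - real (v i) * mismatch x i + real_of_int c * x ! (2 * k) + real_of_int y * x ! (2 * k + 1)"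
proof -
  have "(\<Sum>j<k. real_of_int (pat1 i j) * x ! (2 * j) + real_of_int (pat2 i j) * x ! (2 * j + 1)) = - real (v i) * mismatch x i"
    unfolding mismatch_def sum_distrib_left by (rule sum.cong) (auto simp: pat1_def pat2_def)
  then show ?thesis by (simp add: row_dot[OF assms])
qed

lemma unit_dot:
  assumes "length x = dim" "j < k"
  shows "(\<Sum>i<length x. real_of_int (unit_row j \<alpha> \<beta> ! i) * x ! i) = real_of_int \<alpha> * x ! (2 * j) + real_of_int \<beta> * x ! (2 * j + 1)"
proof -
  have "(\<Sum>j'<k. real_of_int (if j' = j then \<alpha> else 0) * x ! (2 * j') + real_of_int (if j' = j then \<beta> else 0) * x ! (2 * j' + 1))
    = (\<Sum>j'<k. if j' = j then real_of_int \<alpha> * x ! (2 * j) + real_of_int \<beta> * x ! (2 * j + 1) else 0)"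
    by (rule sum.cong) auto
  also have "\<dots> = real_of_int \<alpha> * x ! (2 * j) + real_of_int \<beta> * x ! (2 * j + 1)" using assms(2) by simp
  finally show ?thesis unfolding unit_row_def row_dot[OF assms(1)] by simp
qed

lemma in_poly_iff:
  assumes "length x = dim"
  shows "in_poly Amat bvec x \<longleftrightarrow>
    (\<forall>i<2 ^ k. x ! (2 * k + 1) \<le> real (v i) * (mismatch x i + x ! (2 * k)) \<and>
       real (v i) * (x ! (2 * k) - mismatch x i) \<le> x ! (2 * k + 1)) \<and>
    (\<forall>j<k. x ! (2 * j) + x ! (2 * j + 1) = 1 \<and> 0 \<le> x ! (2 * j) \<and> 0 \<le> x ! (2 * j + 1)) \<and>
    0 \<le> x ! (2 * k) \<and> x ! (2 * k) \<le> 1"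
proof -
  have "in_poly Amat bvec x \<longleftrightarrow> (\<forall>(r, \<beta>)\<in>set (zip Amat bvec). (\<Sum>j<length x. real_of_int (r ! j) * x ! j) \<le> real_of_int \<beta>)"
    unfolding in_poly_def set_zip using length_bvec by auto
  also have "\<dots> \<longleftrightarrow> (\<forall>i<2 ^ k. (\<Sum>j<length x. real_of_int (row k (pat1 i) (pat2 i) (- int (v i)) 1 ! j) * x ! j) \<le> 0 \<and>
       (\<Sum>j<length x. real_of_int (row k (pat1 i) (pat2 i) (int (v i)) (- 1) ! j) * x ! j) \<le> 0) \<and>
    (\<forall>j<k. (\<Sum>i<length x. real_of_int (unit_row j 1 1 ! i) * x ! i) \<le> 1 \<and>
       (\<Sum>i<length x. real_of_int (unit_row j (- 1) (- 1) ! i) * x ! i) \<le> - 1 \<and>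
       (\<Sum>i<length x. real_of_int (unit_row j (- 1) 0 ! i) * x ! i) \<le> 0 \<and>
       (\<Sum>i<length x. real_of_int (unit_row j 0 (- 1) ! i) * x ! i) \<le> 0) \<and>
    (\<Sum>j<length x. real_of_int (row k (\<lambda>_. 0) (\<lambda>_. 0) 1 0 ! j) * x ! j) \<le> 1 \<and>
    (\<Sum>j<length x. real_of_int (row k (\<lambda>_. 0) (\<lambda>_. 0) (- 1) 0 ! j) * x ! j) \<le> 0"
    by (rule ball_zip_Amat[where Q = "\<lambda>r \<beta>. (\<Sum>j<length x. real_of_int (r ! j) * x ! j) \<le> real_of_int \<beta>", simplified of_int_0 of_int_1 of_int_minus])
  also have "\<dots> \<longleftrightarrow> (\<forall>i<2 ^ k. - real (v i) * mismatch x i - real (v i) * x ! (2 * k) + x ! (2 * k + 1) \<le> 0 \<and>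
       - real (v i) * mismatch x i + real (v i) * x ! (2 * k) - x ! (2 * k + 1) \<le> 0) \<and>
    (\<forall>j<k. x ! (2 * j) + x ! (2 * j + 1) \<le> 1 \<and> - x ! (2 * j) - x ! (2 * j + 1) \<le> - 1 \<and>
       - x ! (2 * j) \<le> 0 \<and> - x ! (2 * j + 1) \<le> 0) \<and> x ! (2 * k) \<le> 1 \<and> - x ! (2 * k) \<le> 0"
    by (intro conj_cong all_cong1 imp_cong refl) (simp_all add: pat_dot[OF assms] unit_dot[OF assms] row_dot[OF assms])
  also have "\<dots> \<longleftrightarrow> (\<forall>i<2 ^ k. x ! (2 * k + 1) \<le> real (v i) * (mismatch x i + x ! (2 * k)) \<and>
       real (v i) * (x ! (2 * k) - mismatch x i) \<le> x ! (2 * k + 1)) \<and>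
    (\<forall>j<k. x ! (2 * j) + x ! (2 * j + 1) = 1 \<and> 0 \<le> x ! (2 * j) \<and> 0 \<le> x ! (2 * j + 1)) \<and>
    0 \<le> x ! (2 * k) \<and> x ! (2 * k) \<le> 1"
  proof -
    have e1: "- real (v i) * mismatch x i - real (v i) * x ! (2 * k) + x ! (2 * k + 1) \<le> 0 \<and>
        - real (v i) * mismatch x i + real (v i) * x ! (2 * k) - x ! (2 * k + 1) \<le> 0 \<longleftrightarrow>
        x ! (2 * k + 1) \<le> real (v i) * (mismatch x i + x ! (2 * k)) \<and>
        real (v i) * (x ! (2 * k) - mismatch x i) \<le> x ! (2 * k + 1)" for i
      by (auto simp: algebra_simps)
    have e2: "x ! (2 * j) + x ! (2 * j + 1) \<le> 1 \<and> - x ! (2 * j) - x ! (2 * j + 1) \<le> - 1 \<and>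
        - x ! (2 * j) \<le> 0 \<and> - x ! (2 * j + 1) \<le> 0 \<longleftrightarrow>
        x ! (2 * j) + x ! (2 * j + 1) = 1 \<and> 0 \<le> x ! (2 * j) \<and> 0 \<le> x ! (2 * j + 1)" for j
      by auto
    have e3: "x ! (2 * k) \<le> 1 \<and> - x ! (2 * k) \<le> 0 \<longleftrightarrow> 0 \<le> x ! (2 * k) \<and> x ! (2 * k) \<le> 1" by auto
    show ?thesis unfolding e1 e2 e3 ..
  qed
  finally show ?thesis .
qed

definition point :: "nat \<Rightarrow> nat \<Rightarrow> int list" where
  "point i c = row k (\<lambda>j. of_bool (bit_at i j)) (\<lambda>j. of_bool (\<not> bit_at i j)) (int c) (int (c * v i))"

lemma poly_bounded_Amat: "poly_bounded dim Amat bvec"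
  unfolding poly_bounded_def
proof (intro exI allI impI)
  fix x i assume x: "length x = dim \<and> in_poly Amat bvec x" and i: "i < dim"
  \<comment> \<open>The last coordinate is bounded by the two rows of item 0 alone: c is at most 1
    and the mismatch lies between 0 and k.\<close>
  let ?M = "real (v 0) * (real k + 1) + 1"
  have P: "x ! (2 * k + 1) \<le> real (v 0) * (mismatch x 0 + x ! (2 * k))"
    "real (v 0) * (x ! (2 * k) - mismatch x 0) \<le> x ! (2 * k + 1)"
    "\<And>j. j < k \<Longrightarrow> x ! (2 * j) + x ! (2 * j + 1) = 1 \<and> 0 \<le> x ! (2 * j) \<and> 0 \<le> x ! (2 * j + 1)"
    "0 \<le> x ! (2 * k)" "x ! (2 * k) \<le> 1"
    using x in_poly_iff[of x] by auto
  have m: "0 \<le> mismatch x 0" "mismatch x 0 \<le> real k"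
  proof -
    show "0 \<le> mismatch x 0" unfolding mismatch_def by (rule sum_nonneg) (use P(3) in auto)
    have "mismatch x 0 \<le> (\<Sum>j<k. 1)" unfolding mismatch_def by (rule sum_mono) (use P(3) in force)
    then show "mismatch x 0 \<le> real k" by simp
  qed
  have M: "1 \<le> ?M" by simp
  have "real (v 0) * (mismatch x 0 + x ! (2 * k)) \<le> real (v 0) * (real k + 1)"
    using m P by (intro mult_left_mono) auto
  moreover have "real (v 0) * (- real k - 1) \<le> real (v 0) * (x ! (2 * k) - mismatch x 0)"
    using m P by (intro mult_left_mono) auto
  ultimately have y: "\<bar>x ! (2 * k + 1)\<bar> \<le> ?M" using P(1,2) by (simp add: algebra_simps abs_le_iff)
  show "\<bar>x ! i\<bar> \<le> ?M"
    using i[unfolded dim_def]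
  proof (cases rule: less_pairs_cases)
    case (1 j)
    then show ?thesis unfolding 1(2) using P(3)[OF 1(1)] M by linarith
  next
    case (2 j)
    then show ?thesis unfolding 2(2) using P(3)[OF 2(1)] M by linarith
  next
    case 3
    then show ?thesis unfolding 3 using P M by linarith
  next
    case 4
    show ?thesis unfolding 4 by (rule y)
  qed
qed

lemma pic_instance_gadget: "pic_instance dim Amat bvec qvec"
proof -
  have "length r = dim" if "r \<in> set Amat" for r
    using that unfolding Amat_def by (auto simp: dim_def unit_row_def)
  then show ?thesis unfolding pic_instance_def using length_bvec poly_bounded_Amat
    by (simp add: dim_def qvec_def)
qed

text \<open>Two nonnegative integers with sum 1 are 0 and 1, so the bits spell some index i. Its own
  mismatch is 0, and the two rows of i then squeeze the last coordinate to v(i) c.\<close>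

lemma int_points_subset:
  assumes "x \<in> int_points dim Amat bvec"
  shows "\<exists>i<2 ^ k. \<exists>c<2. x = point i c"
proof -
  let ?x = "map real_of_int x"
  have len: "length x = dim" "length ?x = dim" using assms by (auto simp: int_points_def)
  have nth: "?x ! j = real_of_int (x ! j)" if "j < dim" for j using that len by simp
  have P: "\<And>i. i < 2 ^ k \<Longrightarrow> ?x ! (2 * k + 1) \<le> real (v i) * (mismatch ?x i + ?x ! (2 * k)) \<and>
       real (v i) * (?x ! (2 * k) - mismatch ?x i) \<le> ?x ! (2 * k + 1)"
    "\<And>j. j < k \<Longrightarrow> ?x ! (2 * j) + ?x ! (2 * j + 1) = 1 \<and> 0 \<le> ?x ! (2 * j) \<and> 0 \<le> ?x ! (2 * j + 1)"
    "0 \<le> ?x ! (2 * k)" "?x ! (2 * k) \<le> 1"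
    using assms in_poly_iff[OF len(2)] by (auto simp: int_points_def)
  have X: "x ! (2 * j) + x ! (2 * j + 1) = 1 \<and> 0 \<le> x ! (2 * j) \<and> 0 \<le> x ! (2 * j + 1)" if "j < k" for j
  proof -
    have "2 * j < dim" "2 * j + 1 < dim" using that by (auto simp: dim_def)
    then have "real_of_int (x ! (2 * j)) + real_of_int (x ! (2 * j + 1)) = 1"
      "0 \<le> real_of_int (x ! (2 * j))" "0 \<le> real_of_int (x ! (2 * j + 1))"
      using P(2)[OF that] nth by auto
    then show ?thesis by linarith
  qed
  have C: "x ! (2 * k) = 0 \<or> x ! (2 * k) = 1"
    using P(3,4) nth[of "2 * k"] by (auto simp: dim_def)
  obtain i where i: "i < 2 ^ k" "\<And>j. j < k \<Longrightarrow> bit_at i j = (x ! (2 * j) = 1)"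
    using bits_exist[of k "\<lambda>j. x ! (2 * j) = 1"] by blast
  have "mismatch ?x i = (\<Sum>j<k. 0)"
    unfolding mismatch_def
  proof (rule sum.cong)
    fix j assume "j \<in> {..<k}"
    then have j: "j < k" by simp
    then have "2 * j < dim" "2 * j + 1 < dim" by (auto simp: dim_def)
    then show "(if bit_at i j then ?x ! (2 * j + 1) else ?x ! (2 * j)) = 0"
      using X[OF j] i(2)[OF j] nth by auto
  qed simp
  then have "?x ! (2 * k + 1) = real (v i) * ?x ! (2 * k)" using P(1)[OF i(1)] by simp
  then have Y: "x ! (2 * k + 1) = int (v i) * x ! (2 * k)"
  proof -
    have "2 * k + 1 < dim" "2 * k < dim" by (simp_all add: dim_def)
    then have "real_of_int (x ! (2 * k + 1)) = real (v i) * real_of_int (x ! (2 * k))"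
      using \<open>?x ! (2 * k + 1) = real (v i) * ?x ! (2 * k)\<close> nth by metis
    also have "\<dots> = real_of_int (int (v i) * x ! (2 * k))" by simp
    finally show ?thesis by (rule of_int_eq_iff[THEN iffD1])
  qed
  define c where "c = nat (x ! (2 * k))"
  have c: "c < 2" "x ! (2 * k) = int c" using C by (auto simp: c_def)
  have "x = point i c" unfolding point_def
  proof (rule row_eqI)
    fix j assume j: "j < k"
    show "x ! (2 * j) = of_bool (bit_at i j)" using X[OF j] i(2)[OF j] by auto
    show "x ! (2 * j + 1) = of_bool (\<not> bit_at i j)" using X[OF j] i(2)[OF j] by auto
  qed (use len c Y in \<open>auto simp: dim_def\<close>)
  then show ?thesis using i c by blast
qed

text \<open>For i' different from i the mismatch D is at least 1. If c = 1, then v(i) <= 2 v(i') <=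
  v(i') (D + 1) by \<open>v_le\<close>, and v(i') (1 - D) <= 0. If c = 0, the last coordinate is 0
  and lies between bounds of opposite sign.\<close>

lemma point_in_int_points:
  assumes "i < 2 ^ k" "c < 2"
  shows "point i c \<in> int_points dim Amat bvec"
proof -
  let ?x = "map real_of_int (point i c)"
  have len: "length ?x = dim" by (simp add: point_def dim_def)
  have nth: "\<And>j. j < k \<Longrightarrow> ?x ! (2 * j) = of_bool (bit_at i j)" "\<And>j. j < k \<Longrightarrow> ?x ! (2 * j + 1) = of_bool (\<not> bit_at i j)"
    "?x ! (2 * k) = real c" "?x ! (2 * k + 1) = real (c * v i)"
    by (simp_all add: point_def)
  have mm: "mismatch ?x i' = (\<Sum>j<k. of_bool (bit_at i' j \<noteq> bit_at i j))" for i'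
    unfolding mismatch_def by (rule sum.cong) (use nth in auto)
  have m0: "mismatch ?x i = 0" by (simp add: mm)
  have m1: "1 \<le> mismatch ?x i'" if i': "i' < 2 ^ k" "i' \<noteq> i" for i'
  proof -
    obtain j where j: "j < k" "bit_at i' j \<noteq> bit_at i j" using bits_unique[OF i'(1) assms(1)] i'(2) by blast
    have "(1::real) = of_bool (bit_at i' j \<noteq> bit_at i j)" using j by simp
    also have "\<dots> \<le> (\<Sum>j<k. of_bool (bit_at i' j \<noteq> bit_at i j))"
      by (rule member_le_sum[where f = "\<lambda>j. of_bool (bit_at i' j \<noteq> bit_at i j) :: real"]) (use j in auto)
    finally show ?thesis by (simp add: mm)
  qed
  have "real (c * v i) \<le> real (v i') * (mismatch ?x i' + real c) \<and> real (v i') * (real c - mismatch ?x i') \<le> real (c * v i)"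
    if i': "i' < 2 ^ k" for i'
  proof (cases "i' = i")
    case True
    then show ?thesis by (simp add: m0)
  next
    case False
    have c: "c = 0 \<or> c = 1" using assms(2) by auto
    have "real (v i') * 1 \<le> real (v i') * mismatch ?x i'" using m1[OF i' False] by (intro mult_left_mono) auto
    moreover have "real (v i) \<le> 2 * real (v i')" using v_le[OF assms(1) i'] by linarith
    ultimately show ?thesis using c by (auto simp: algebra_simps)
  qed
  then have "in_poly Amat bvec ?x"
    unfolding in_poly_iff[OF len] using nth assms(2) by auto
  then show ?thesis by (simp add: int_points_def point_def dim_def)
qed

lemma int_points_eq: "int_points dim Amat bvec = (\<lambda>(i, c). point i c) ` ({..<2 ^ k} \<times> {..<2})"
  using int_points_subset point_in_int_points by fastforce

lemma point_inj: "inj_on (\<lambda>(i, c). point i c) ({..<2 ^ k} \<times> {..<2})"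
proof (rule inj_onI)
  fix x y assume xy: "x \<in> {..<2 ^ k} \<times> {..<2}" "y \<in> {..<2 ^ k} \<times> {..<2}"
    "(case x of (i, c) \<Rightarrow> point i c) = (case y of (i, c) \<Rightarrow> point i c)"
  obtain i c i' c' where e: "x = (i, c)" "y = (i', c')" by (cases x; cases y)
  then have a: "i < 2 ^ k" "i' < 2 ^ k" "point i c = point i' c'" using xy by auto
  have "point i c ! (2 * k) = point i' c' ! (2 * k)" using a(3) by simp
  then have "c = c'" by (simp add: point_def)
  moreover have "i = i'"
  proof (rule bits_unique[of _ k])
    fix j assume "j < k"
    moreover have "point i c ! (2 * j) = point i' c' ! (2 * j)" using a(3) by simp
    ultimately show "bit_at i j = bit_at i' j" by (auto simp: point_def of_bool_def split: if_splits)
  qed (use a in auto)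
  ultimately show "x = y" by (simp add: e)
qed

lemma sum_int_points:
  "(\<Sum>x\<in>{x \<in> int_points dim Amat bvec. cf x \<noteq> 0}. int (cf x) * f x)
   = (\<Sum>i<2 ^ k. int (cf (point i 0)) * f (point i 0) + int (cf (point i 1)) * f (point i 1))"
proof -
  have fin: "finite (int_points dim Amat bvec)" by (simp add: int_points_eq)
  have "(\<Sum>x\<in>{x \<in> int_points dim Amat bvec. cf x \<noteq> 0}. int (cf x) * f x) = (\<Sum>x\<in>int_points dim Amat bvec. int (cf x) * f x)"
    by (rule sum.mono_neutral_left) (use fin in auto)
  also have "\<dots> = (\<Sum>(i, c)\<in>{..<2 ^ k} \<times> {..<2}. int (cf (point i c)) * f (point i c))"
    unfolding int_points_eq by (subst sum.reindex[OF point_inj]) (simp add: o_def case_prod_unfold)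
  also have "\<dots> = (\<Sum>i<2 ^ k. \<Sum>c<2. int (cf (point i c)) * f (point i c))"
    by (simp add: sum.cartesian_product)
  also have "\<dots> = (\<Sum>i<2 ^ k. int (cf (point i 0)) * f (point i 0) + int (cf (point i 1)) * f (point i 1))"
    by (simp add: numeral_2_eq_2)
  finally show ?thesis .
qed

text \<open>Only the points with c = 1 contribute to the last two coordinates, and these give the
  two equations. Conversely, every use of \<open>point i 1\<close> is matched by one of
  \<open>point (cmp i) 0\<close>; their sum has 1 in all coordinates but the last, which is
  v(i).\<close>

lemma pic_answer_iff:
  "pic_answer dim Amat bvec qvec \<longleftrightarrow> (\<exists>lam. (\<Sum>i<2 ^ k. lam i) = T \<and> (\<Sum>i<2 ^ k. lam i * v i) = t)"
proof
  assume "pic_answer dim Amat bvec qvec"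
  then obtain cf :: "int list \<Rightarrow> nat" where
    cf: "\<And>i. i < dim \<Longrightarrow> qvec ! i = (\<Sum>x\<in>{x \<in> int_points dim Amat bvec. cf x \<noteq> 0}. int (cf x) * x ! i)"
    unfolding pic_answer_def IntCone_def by blast
  have "int T = int (\<Sum>i<2 ^ k. cf (point i 1))"
    using cf[of "2 * k"] unfolding sum_int_points by (simp add: dim_def qvec_def point_def)
  moreover have "int t = int (\<Sum>i<2 ^ k. cf (point i 1) * v i)"
    using cf[of "2 * k + 1"] unfolding sum_int_points by (simp add: dim_def qvec_def point_def)
  ultimately show "\<exists>lam. (\<Sum>i<2 ^ k. lam i) = T \<and> (\<Sum>i<2 ^ k. lam i * v i) = t"
    by (metis of_nat_eq_iff)
next
  assume "\<exists>lam. (\<Sum>i<2 ^ k. lam i) = T \<and> (\<Sum>i<2 ^ k. lam i * v i) = t"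
  then obtain lam where lam: "(\<Sum>i<2 ^ k. lam i) = T" "(\<Sum>i<2 ^ k. lam i * v i) = t" by blast
  obtain cmp where cmp: "\<And>i. i < 2 ^ k \<Longrightarrow> cmp i < 2 ^ k" "\<And>i. i < 2 ^ k \<Longrightarrow> cmp (cmp i) = i"
    "\<And>i j. i < 2 ^ k \<Longrightarrow> j < k \<Longrightarrow> bit_at (cmp i) j = (\<not> bit_at i j)"
    using complement_exists[of k] by blast
  \<comment> \<open>The multiplicity of \<open>point i 0\<close> is that of the opposite vertex with
    c = 1; reindexing along the involution \<open>cmp\<close> pairs the two sums.\<close>
  define cf where "cf = (\<lambda>(i, c). if c = (1::nat) then lam i else lam (cmp i)) \<circ> inv_into ({..<2 ^ k} \<times> {..<2}) (\<lambda>(i, c). point i c)"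
  have cfp: "cf (point i 1) = lam i" "cf (point i 0) = lam (cmp i)" if "i < 2 ^ k" for i
    using inv_into_f_f[OF point_inj, of "(i, 1)"] inv_into_f_f[OF point_inj, of "(i, 0)"] that by (auto simp: cf_def)
  have re: "(\<Sum>i<2 ^ k. int (lam (cmp i)) * g i) = (\<Sum>i<2 ^ k. int (lam i) * g (cmp i))" for g
    by (rule sum.reindex_bij_witness[of _ cmp cmp]) (use cmp in auto)
  have S: "(\<Sum>x\<in>{x \<in> int_points dim Amat bvec. cf x \<noteq> 0}. int (cf x) * f x)
     = (\<Sum>i<2 ^ k. int (lam i) * (f (point (cmp i) 0) + f (point i 1)))" for f
  proof -
    have "(\<Sum>x\<in>{x \<in> int_points dim Amat bvec. cf x \<noteq> 0}. int (cf x) * f x)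
      = (\<Sum>i<2 ^ k. int (lam (cmp i)) * f (point i 0) + int (lam i) * f (point i 1))"
      unfolding sum_int_points by (rule sum.cong) (use cfp in auto)
    also have "\<dots> = (\<Sum>i<2 ^ k. int (lam i) * f (point (cmp i) 0)) + (\<Sum>i<2 ^ k. int (lam i) * f (point i 1))"
      by (simp add: sum.distrib re)
    finally show ?thesis by (simp add: sum.distrib distrib_left)
  qed
  have T: "int T = (\<Sum>i<2 ^ k. int (lam i))" using lam(1) by (simp flip: of_nat_sum)
  have "qvec ! m = (\<Sum>x\<in>{x \<in> int_points dim Amat bvec. cf x \<noteq> 0}. int (cf x) * x ! m)" if "m < dim" for m
    using that[unfolded dim_def]
  proof (cases rule: less_pairs_cases)
    case (1 j)
    then show ?thesis unfolding S qvec_def by (simp add: T point_def) (rule sum.cong, use cmp(3) in auto)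
  next
    case (2 j)
    then show ?thesis unfolding S qvec_def by (simp add: T point_def) (rule sum.cong, use cmp(3) in auto)
  next
    case 3
    then show ?thesis unfolding S qvec_def by (simp add: T point_def)
  next
    case 4
    have "int t = (\<Sum>i<2 ^ k. int (lam i) * int (v i))" using lam(2) by (simp flip: of_nat_sum of_nat_mult)
    with 4 show ?thesis unfolding S qvec_def by (simp add: point_def)
  qed
  moreover have "finite {x \<in> int_points dim Amat bvec. cf x \<noteq> 0}" by (simp add: int_points_eq)
  ultimately show "pic_answer dim Amat bvec qvec"
    unfolding pic_answer_def IntCone_def by (auto simp: qvec_def dim_def)
qed

end

section \<open>Items and target of the knapsack equation\<close>

definition bval :: "nat list \<Rightarrow> nat" where
  "bval xs = foldl (\<lambda>a s. 2 * a + (s - 1)) 0 xs"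

lemma bval_Nil [simp]: "bval [] = 0"
  by (simp add: bval_def)

lemma bval_snoc: "bval (xs @ [s]) = 2 * bval xs + (s - 1)"
  by (simp add: bval_def)

lemma bval_append: "bval (xs @ ys) = bval xs * 2 ^ length ys + bval ys"
proof (induction ys rule: rev_induct)
  case (snoc y ys)
  have "bval (xs @ ys @ [y]) = 2 * bval (xs @ ys) + (y - 1)" using bval_snoc[of "xs @ ys" y] by simp
  then show ?case using snoc by (simp add: bval_snoc)
qed simp

lemma bval_single: "bval [s] = s - 1"
  using bval_snoc[of "[]" s] by simp

lemma bval_zeros: "bval (replicate n 1) = 0"
proof (induction n)
  case (Suc n)
  have "bval (replicate n 1 @ [1]) = 0" using Suc by (simp add: bval_snoc)
  then show ?case by (simp add: replicate_append_same)
qed simp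

text \<open>The leading symbol 2 is the bit 1, so the string has no leading zero and is the
  canonical form demanded by the encoding. All items and the target are written this way.\<close>

lemma bin_bval: "set xs \<subseteq> {1, 2} \<Longrightarrow> bin (bval (2 # xs)) = 2 # xs \<and> 0 < bval (2 # xs)"
proof (induction xs rule: rev_induct)
  case Nil
  then show ?case using bval_single[of 2] by (simp add: bin_pos)
next
  case (snoc x xs)
  have x: "x = 1 \<or> x = 2" using snoc.prems by auto
  have IH: "bin (bval (2 # xs)) = 2 # xs" "0 < bval (2 # xs)" using snoc by auto
  have e: "bval (2 # xs @ [x]) = 2 * bval (2 # xs) + (x - 1)" using bval_snoc[of "2 # xs" x] by simp
  have "(2 * bval (2 # xs) + (x - 1)) div 2 = bval (2 # xs)" "(2 * bval (2 # xs) + (x - 1)) mod 2 + 1 = x"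
    using x by auto
  then have "bin (2 * bval (2 # xs) + (x - 1)) = (2 # xs) @ [x]"
    using IH bin_pos[of "2 * bval (2 # xs) + (x - 1)"] by simp
  then show ?case using IH e by simp
qed

text \<open>The most significant digit comes first.\<close>

primrec hval :: "nat \<Rightarrow> (nat \<Rightarrow> nat) \<Rightarrow> nat \<Rightarrow> nat" where
  "hval B d 0 = 0"
| "hval B d (Suc n) = hval B d n * B + d n"

lemma hval_less: "(\<And>p. p < n \<Longrightarrow> d p < B) \<Longrightarrow> hval B d n < B ^ n"
proof (induction n)
  case (Suc n)
  have "hval B d n + 1 \<le> B ^ n" using Suc by (simp add: Suc_leI)
  then have "(hval B d n + 1) * B \<le> B ^ n * B" by (rule mult_le_mono1)
  moreover have "d n < B" using Suc.prems by simp
  ultimately show ?case by (simp add: algebra_simps)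
qed simp

text \<open>With all digits below B there are no carries, and division by B strips off the last
  digit. This turns one numerical equation into N separate ones.\<close>

lemma hval_inject:
  "(\<And>p. p < n \<Longrightarrow> d p < B) \<Longrightarrow> (\<And>p. p < n \<Longrightarrow> d' p < B) \<Longrightarrow>
   hval B d n = hval B d' n \<longleftrightarrow> (\<forall>p<n. d p = d' p)"
proof (induction n)
  case (Suc n)
  have l: "d n < B" "d' n < B" using Suc.prems by auto
  have "hval B d n * B + d n = hval B d' n * B + d' n \<longleftrightarrow> hval B d n = hval B d' n \<and> d n = d' n"
  proof
    assume a: "hval B d n * B + d n = hval B d' n * B + d' n"
    have "(hval B d n * B + d n) div B = hval B d n" "(hval B d' n * B + d' n) div B = hval B d' n"
      using l by auto
    then have "hval B d n = hval B d' n" using a by metis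
    then show "hval B d n = hval B d' n \<and> d n = d' n" using a by simp
  qed simp
  also have "\<dots> \<longleftrightarrow> (\<forall>p<n. d p = d' p) \<and> d n = d' n" using Suc by simp
  finally show ?case by (auto simp: less_Suc_eq)
qed simp

lemma hval_sum: "(\<Sum>i\<in>I. l i * hval B (d i) n) = hval B (\<lambda>p. \<Sum>i\<in>I. l i * d i p) n"
proof (induction n)
  case (Suc n)
  have "(\<Sum>i\<in>I. l i * hval B (d i) (Suc n)) = (\<Sum>i\<in>I. l i * hval B (d i) n) * B + (\<Sum>i\<in>I. l i * d i n)"
    by (simp add: distrib_left sum.distrib sum_distrib_right mult.assoc)
  then show ?case using Suc by simp
qed simp

section \<open>Strings of items and of the target\<close>

definition bsym :: "bool \<Rightarrow> nat" where
  "bsym b = (if b then 2 else 1)"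

text \<open>A digit in base 2^(3 N + 4) with a high bit of weight 2^(N + 1) and a low bit of weight
  1. The widths are chosen as runs of length N and a few single symbols, which a generator writes
  without arithmetic.\<close>

definition block :: "nat \<Rightarrow> bool \<Rightarrow> bool \<Rightarrow> nat list" where
  "block N g l = replicate N 1 @ replicate N 1 @ [1, 1, bsym g] @ replicate N 1 @ [bsym l]"

lemma length_block: "length (block N g l) = 3 * N + 4"
  by (simp add: block_def)

lemma block_symbols: "set (block N g l) \<subseteq> {1, 2}"
  by (auto simp: block_def bsym_def)

lemma bval_block: "bval (block N g l) = of_bool g * 2 ^ (N + 1) + of_bool l"
proof -
  have "bval (replicate N 1 @ [bsym l]) = of_bool l" by (simp add: bval_snoc bval_zeros[simplified] bsym_def)
  moreover have "bval [1, 1, bsym g] = of_bool g" using bval_append[of "[1,1]" "[bsym g]"] bval_append[of "[1]" "[1]"]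
    by (simp add: bval_single bsym_def)
  ultimately show ?thesis unfolding block_def bval_append by (simp add: bval_zeros[simplified] algebra_simps)
qed

lemma bval_blocks:
  "bval (x @ concat (map (\<lambda>p. block N (g p) (l p)) [0..<n])) =
    bval x * (2 ^ (3 * N + 4)) ^ n + hval (2 ^ (3 * N + 4)) (\<lambda>p. of_bool (g p) * 2 ^ (N + 1) + of_bool (l p)) n"
proof (induction n)
  case (Suc n)
  have "bval (x @ concat (map (\<lambda>p. block N (g p) (l p)) [0..<Suc n]))
    = bval (x @ concat (map (\<lambda>p. block N (g p) (l p)) [0..<n])) * 2 ^ (3 * N + 4) + bval (block N (g n) (l n))"
    using bval_append[of "x @ concat (map (\<lambda>p. block N (g p) (l p)) [0..<n])" "block N (g n) (l n)"]
    by (simp add: length_block)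
  then show ?case unfolding Suc bval_block by (simp add: algebra_simps)
qed simp

text \<open>A token starts where the preceding symbol is a separator.\<close>

definition lit :: "nat list \<Rightarrow> nat \<Rightarrow> bool" where
  "lit F p \<longleftrightarrow> rd (3 # F) p = 3 \<and> rd F p \<in> {1, 2}"

definition mark :: "nat list \<Rightarrow> nat \<Rightarrow> bool" where
  "mark F p \<longleftrightarrow> rd (3 # F) p = 3 \<and> rd F p = 3"

text \<open>Together with \<open>mark F p\<close> this says that the last mark before i is p, that
  is, a literal at i belongs to the clause beginning at p.\<close>

definition own :: "nat list \<Rightarrow> nat \<Rightarrow> nat \<Rightarrow> bool" where
  "own F i p \<longleftrightarrow> p < i \<and> \<not> (\<exists>x<i. p < x \<and> mark F x)"

text \<open>Both symbols have to be proper bits, so separators and positions beyond the end never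
  agree.\<close>

definition agree :: "nat list \<Rightarrow> nat \<Rightarrow> nat \<Rightarrow> bool" where
  "agree F x y \<longleftrightarrow> rd F x = 1 \<and> rd F y = 1 \<or> rd F x = 2 \<and> rd F y = 2"

text \<open>Opposite literals: the sign symbols differ, and the binary digits agree up to separators
  at the same offset l. The doubly negated quantifier mirrors the generator, where a loop can only
  report the existence of a witness by a nonempty output.\<close>

definition conf :: "nat list \<Rightarrow> nat \<Rightarrow> nat \<Rightarrow> bool" where
  "conf F i p \<longleftrightarrow> lit F i \<and> lit F p \<and> \<not> agree F i p \<and>
     (\<exists>l<length F. rd F (i + 1 + l) = 3 \<and> rd F (p + 1 + l) = 3 \<and> \<not> (\<exists>a<l. \<not> agree F (i + 1 + a) (p + 1 + a)))"

definition hi_bit :: "nat list \<Rightarrow> nat \<Rightarrow> nat \<Rightarrow> bool" where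
  "hi_bit F i p \<longleftrightarrow> i = p \<and> lit F p"

text \<open>The three alternatives are the slack item N + p in the equation of an occurrence p, the
  occurrence i in the equation of its clause, and the occurrence i in the equation of an opposite
  occurrence p.\<close>

definition lo_bit :: "nat list \<Rightarrow> nat \<Rightarrow> nat \<Rightarrow> bool" where
  "lo_bit F i p \<longleftrightarrow> i = length F + p \<and> lit F p \<or> lit F i \<and> mark F p \<and> own F i p \<or> conf F i p"

definition item_string :: "nat list \<Rightarrow> nat \<Rightarrow> nat list" where
  "item_string F i = 2 # concat (map (\<lambda>p. block (length F) (hi_bit F i p) (lo_bit F i p)) [0..<length F])"

definition target_string :: "nat list \<Rightarrow> nat list" where
  "target_string F = 2 # replicate (2 * length F + 2) 1 @
     concat (map (\<lambda>p. block (length F) (lit F p) (mark F p)) [0..<length F])"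

text \<open>Choosing one literal occurrence per clause such that no two chosen literals are opposite.\<close>

definition selectable :: "nat list \<Rightarrow> bool" where
  "selectable F \<longleftrightarrow> (\<exists>S \<subseteq> {i. lit F i}. (\<forall>p. mark F p \<longrightarrow> (\<exists>!i. i \<in> S \<and> own F i p)) \<and>
     (\<forall>i\<in>S. \<forall>p\<in>S. \<not> conf F i p))"

lemma lit_less: "lit F p \<Longrightarrow> p < length F"
  by (auto simp: lit_def rd_def split: if_splits)

lemma mark_less: "mark F p \<Longrightarrow> p < length F"
  by (auto simp: mark_def rd_def split: if_splits)

lemma not_lit_mark: "lit F p \<Longrightarrow> \<not> mark F p"
  by (auto simp: lit_def mark_def)

lemma conf_lit: "conf F i p \<Longrightarrow> lit F i \<and> lit F p"
  by (simp add: conf_def)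

lemma conf_irrefl: "\<not> conf F i i"
  by (auto simp: conf_def lit_def agree_def)

text \<open>G exceeds N, hence the number of chosen occurrences that can conflict with a given one.
  T has room for at most N chosen items and N slacks of size at most G. B = 2 T G exceeds T (G + 1),
  the largest possible column sum. All are powers of two, so their binary strings are
  simple.\<close>

context
  fixes F :: "nat list" and N G T B :: nat
  defines "N \<equiv> length F" and "G \<equiv> 2 ^ (length F + 1)" and "T \<equiv> 2 ^ (2 * length F + 2)" and "B \<equiv> 2 ^ (3 * length F + 4)"
begin

definition digit :: "nat \<Rightarrow> nat \<Rightarrow> nat" where
  "digit i p = of_bool (hi_bit F i p) * G + of_bool (lo_bit F i p)"

definition tdigit :: "nat \<Rightarrow> nat" where
  "tdigit p = of_bool (lit F p) * G + of_bool (mark F p)"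

lemma TG_less: "T * (G + 1) < B"
proof -
  have "1 < G" unfolding G_def by (rule one_less_power) auto
  then have "G + 1 < 2 * G" by simp
  then have "T * (G + 1) < T * (2 * G)" unfolding T_def by (intro mult_strict_left_mono) auto
  also have "\<dots> = B" unfolding T_def G_def B_def by (simp flip: power_add power_Suc)
  finally show ?thesis .
qed

lemma digit_le: "digit i p \<le> G + 1" "tdigit p \<le> G + 1"
  by (auto simp: digit_def tdigit_def)

lemma digit_less: "digit i p < B" "tdigit p < B"
proof -
  have "1 * (G + 1) \<le> T * (G + 1)" unfolding T_def by (intro mult_le_mono1) simp
  then have "G + 1 < B" using TG_less by simp
  then show "digit i p < B" "tdigit p < B" using digit_le(1)[of i p] digit_le(2)[of p] by simp_all
qed

lemma bval_item: "bval (item_string F i) = B ^ N + hval B (digit i) N"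
  using bval_blocks[of "[2]" "length F" "hi_bit F i" "lo_bit F i" "length F"]
  unfolding item_string_def digit_def[abs_def] B_def G_def N_def by (simp add: bval_single)

lemma bval_target: "bval (target_string F) = T * B ^ N + hval B tdigit N"
proof -
  have "bval (2 # replicate (2 * length F + 2) 1) = T"
    using bval_append[of "[2]" "replicate (2 * length F + 2) 1"] unfolding T_def
    by (simp add: bval_single bval_zeros del: replicate_Suc One_nat_def)
  then show ?thesis
    using bval_blocks[of "2 # replicate (2 * length F + 2) 1" "length F" "lit F" "mark F" "length F"]
    unfolding target_string_def tdigit_def[abs_def] B_def G_def N_def by simp
qed

text \<open>The common leading digit 1 dominates the rest of the number. This yields the hypothesis
  \<open>v_le\<close> of the gadget.\<close>

lemma item_range: "B ^ N \<le> bval (item_string F i)" "bval (item_string F i) < 2 * B ^ N"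
  using hval_less[of N "digit i" B] digit_less unfolding bval_item by auto

text \<open>As the multiplicities add up to T, every column sum is at most T (G + 1) < B, so there
  are no carries. The leading digits contribute T on both sides.\<close>

lemma system_iff:
  assumes "(\<Sum>i<R. lam i) = T"
  shows "(\<Sum>i<R. lam i * bval (item_string F i)) = bval (target_string F) \<longleftrightarrow>
    (\<forall>p<N. (\<Sum>i<R. lam i * digit i p) = tdigit p)"
proof -
  have less: "(\<Sum>i<R. lam i * digit i p) < B" for p
  proof -
    have "(\<Sum>i<R. lam i * digit i p) \<le> (\<Sum>i<R. lam i * (G + 1))"
      by (intro sum_mono mult_le_mono2 digit_le)
    also have "\<dots> = T * (G + 1)" using assms by (simp only: sum_distrib_right[symmetric])
    finally show ?thesis using TG_less by simp
  qed
  have "(\<Sum>i<R. lam i * bval (item_string F i)) = T * B ^ N + hval B (\<lambda>p. \<Sum>i<R. lam i * digit i p) N"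
    unfolding bval_item distrib_left sum.distrib hval_sum using assms by (simp only: sum_distrib_right[symmetric])
  then show ?thesis unfolding bval_target using hval_inject[of N "\<lambda>p. \<Sum>i<R. lam i * digit i p" B tdigit] less digit_less
    by simp
qed

lemma digit_mark: "mark F p \<Longrightarrow> digit i p = of_bool (lit F i \<and> own F i p)"
  using not_lit_mark[of F p] conf_lit[of F i p] by (auto simp: digit_def hi_bit_def lo_bit_def)

lemma digit_lit: "lit F p \<Longrightarrow> digit i p = of_bool (i = p) * G + of_bool (i = N + p \<or> conf F i p)"
  using not_lit_mark[of F p] by (auto simp: digit_def hi_bit_def lo_bit_def N_def)

lemma digit_other: "\<not> lit F p \<Longrightarrow> \<not> mark F p \<Longrightarrow> digit i p = 0"
  using conf_lit[of F i p] by (auto simp: digit_def hi_bit_def lo_bit_def)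

text \<open>Choose the occurrences with positive multiplicity. A clause column has sum 1, which
  singles out one occurrence. In the column of a chosen p, the item p already contributes G, so no
  chosen item may conflict with it.\<close>

lemma system_imp_selectable:
  assumes R: "2 * N < R" and sys: "\<And>p. p < N \<Longrightarrow> (\<Sum>i<R. lam i * digit i p) = tdigit p"
  shows "selectable F"
  unfolding selectable_def
proof (intro exI conjI allI impI ballI)
  let ?S = "{i. lit F i \<and> 0 < lam i}"
  show "?S \<subseteq> {i. lit F i}" by auto
  fix p assume p: "mark F p"
  have "(\<Sum>i<R. lam i * digit i p) = 1"
    using sys[of p] mark_less[OF p] p not_lit_mark[of F p] by (auto simp: N_def tdigit_def)
  then obtain i where i: "i < R" "lam i * digit i p = 1" "\<And>j. j < R \<Longrightarrow> i \<noteq> j \<Longrightarrow> lam j * digit j p = 0"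
    by (subst (asm) sum_eq_1_iff) (simp, metis lessThan_iff)
  show "\<exists>!i. i \<in> ?S \<and> own F i p"
  proof (rule ex1I[of _ i])
    have "0 < lam i" "digit i p \<noteq> 0" using i(2) by (auto intro: Nat.gr0I)
    then show "i \<in> ?S \<and> own F i p" unfolding digit_mark[OF p] by simp
    fix j assume j: "j \<in> ?S \<and> own F j p"
    then have "j < R" using lit_less[of F j] R by (auto simp: N_def)
    moreover have "lam j * digit j p \<noteq> 0" using j unfolding digit_mark[OF p] by simp
    ultimately show "j = i" using i(3)[of j] by metis
  qed
next
  fix i p assume ip: "i \<in> {i. lit F i \<and> 0 < lam i}" "p \<in> {i. lit F i \<and> 0 < lam i}"
  show "\<not> conf F i p"
  proof
    assume c: "conf F i p"
    then have ne: "i \<noteq> p" using conf_irrefl by auto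
    have less: "i < R" "p < R" "p < N" using ip lit_less[of F i] lit_less[of F p] R by (auto simp: N_def)
    \<comment> \<open>Two terms of column p already exceed its target G: at least G from p itself
      and at least 1 from the conflicting i.\<close>
    have "(\<Sum>j\<in>{i, p}. lam j * digit j p) \<le> (\<Sum>j<R. lam j * digit j p)"
      by (rule sum_mono2) (use less in auto)
    also have "\<dots> = G" using sys[OF less(3)] ip not_lit_mark[of F p] by (simp add: tdigit_def)
    finally have "lam i * digit i p + lam p * digit p p \<le> G" using ne by simp
    moreover have "1 \<le> lam i * digit i p" using digit_lit[of p i] ip c by simp
    moreover have "G \<le> lam p * digit p p"
    proof -
      have "1 * G \<le> lam p * digit p p" using ip digit_lit[of p p] by (intro mult_le_mono) auto
      then show ?thesis by simp
    qed
    ultimately show False by simp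
  qed
qed

lemma sum_split3:
  assumes "2 * N < R"
  shows "(\<Sum>i<R. f i) = (\<Sum>i<N. f i) + (\<Sum>i<N. f (N + i)) + (\<Sum>i\<in>{2 * N..<R}. f i :: nat)"
proof -
  have "(\<Sum>i<R. f i) = (\<Sum>i\<in>{0..<N}. f i) + (\<Sum>i\<in>{N..<2 * N}. f i) + (\<Sum>i\<in>{2 * N..<R}. f i)"
  proof -
    have "(\<Sum>i\<in>{0..<R}. f i) = (\<Sum>i\<in>{0..<2 * N}. f i) + (\<Sum>i\<in>{2 * N..<R}. f i)"
      by (rule sum.atLeastLessThan_concat[symmetric]) (use assms in auto)
    moreover have "(\<Sum>i\<in>{0..<2 * N}. f i) = (\<Sum>i\<in>{0..<N}. f i) + (\<Sum>i\<in>{N..<2 * N}. f i)"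
      by (rule sum.atLeastLessThan_concat[symmetric]) auto
    ultimately show ?thesis by (simp only: lessThan_atLeast0)
  qed
  moreover have "(\<Sum>i\<in>{N..<2 * N}. f i) = (\<Sum>i<N. f (N + i))"
    by (rule sum.reindex_bij_witness[of _ "\<lambda>i. N + i" "\<lambda>i. i - N"]) auto
  ultimately show ?thesis by (simp add: lessThan_atLeast0)
qed

text \<open>Chosen occurrences get multiplicity 1, the slack item of p fills its column up to G, and
  the item 2 N, all of whose digits below the leading one are 0, brings the total to T.\<close>

lemma selectable_imp_system:
  assumes R: "2 * N < R" and sel: "selectable F"
  shows "\<exists>lam. (\<Sum>i<R. lam i) = T \<and> (\<forall>p<N. (\<Sum>i<R. lam i * digit i p) = tdigit p)"
proof -
  from sel obtain S where S0: "S \<subseteq> {i. lit F i} \<and> (\<forall>p. mark F p \<longrightarrow> (\<exists>!i. i \<in> S \<and> own F i p)) \<and>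
     (\<forall>i\<in>S. \<forall>p\<in>S. \<not> conf F i p)"
    unfolding selectable_def by (elim exE)
  then have S: "S \<subseteq> {i. lit F i}" "\<And>p. mark F p \<Longrightarrow> \<exists>!i. i \<in> S \<and> own F i p"
    "\<And>i p. i \<in> S \<Longrightarrow> p \<in> S \<Longrightarrow> \<not> conf F i p"
    by simp_all
  have SN: "S \<subseteq> {..<N}" using S(1) lit_less by (auto simp: N_def)
  then have finS: "finite S" using finite_subset by blast
  have cardS: "card S \<le> N" using card_mono[OF _ SN] by simp
  define C where "C p = card {i \<in> S. conf F i p}" for p
  define slack where "slack p = (if lit F p then G - of_bool (p \<in> S) * G - C p else 0)" for p
  \<comment> \<open>A chosen p has no conflicts within S; for any other p their number is at most
    card S <= N <= G. Hence the truncated subtraction in \<open>slack\<close> is exact.\<close>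
  have C_le: "of_bool (p \<in> S) * G + C p \<le> G" for p
  proof (cases "p \<in> S")
    case True
    then have "{i \<in> S. conf F i p} = {}" using S(3) by blast
    then show ?thesis unfolding C_def using True by (simp only: card.empty) simp
  next
    case False
    have "C p \<le> card S" unfolding C_def by (rule card_mono) (use finS in auto)
    also have "\<dots> \<le> 2 ^ N" using cardS less_exp[of N] by linarith
    also have "\<dots> \<le> G" unfolding G_def N_def by simp
    finally show ?thesis using False by simp
  qed
  define rest where "rest = T - ((\<Sum>i<N. of_bool (i \<in> S)) + (\<Sum>i<N. slack i))"
  define lam where "lam i = (if i < N then of_bool (i \<in> S) else if i < 2 * N then slack (i - N) else if i = 2 * N then rest else 0)" for i
  have bound: "(\<Sum>i<N. of_bool (i \<in> S)) + (\<Sum>i<N. slack i) \<le> T"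
  proof -
    have "(\<Sum>i<N. of_bool (i \<in> S)) \<le> of_nat (card {..<N}) * (1::nat)" by (rule sum_bounded_above) simp
    then have "(\<Sum>i<N. of_bool (i \<in> S)) \<le> N" by simp
    moreover have "(\<Sum>i<N. slack i) \<le> of_nat (card {..<N}) * G" by (rule sum_bounded_above) (simp add: slack_def)
    then have "(\<Sum>i<N. slack i) \<le> N * G" by simp
    moreover have "N \<le> 2 ^ N" by (simp add: less_imp_le)
    moreover have "N * G \<le> 2 ^ N * G" using \<open>N \<le> 2 ^ N\<close> by (rule mult_le_mono1)
    moreover have "2 ^ N \<le> 2 ^ N * G" unfolding G_def by simp
    moreover have "2 ^ N * G + 2 ^ N * G = T"
    proof -
      have "2 ^ N * G + 2 ^ N * G = 2 * (2 ^ N * G)" by simp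
      also have "\<dots> = T" unfolding G_def T_def N_def by (simp flip: power_add power_Suc add: mult_2)
      finally show ?thesis .
    qed
    ultimately show ?thesis by linarith
  qed
  have lam: "\<And>i. i < N \<Longrightarrow> lam i = of_bool (i \<in> S)" "\<And>i. i < N \<Longrightarrow> lam (N + i) = slack i"
    by (auto simp: lam_def)
  have lam3: "(\<Sum>i\<in>{2 * N..<R}. lam i) = rest"
  proof -
    have "(\<Sum>i\<in>{2 * N..<R}. lam i) = (\<Sum>i\<in>{2 * N..<R}. if i = 2 * N then rest else 0)"
      by (rule sum.cong) (auto simp: lam_def)
    then show ?thesis using R by simp
  qed
  have tot: "(\<Sum>i<R. lam i) = T"
    unfolding sum_split3[OF R] lam3 using bound lam by (simp add: rest_def)
  have "(\<Sum>i<R. lam i * digit i p) = tdigit p" if p: "p < N" for p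
  proof -
    have z: "digit i p = 0" if "2 * N \<le> i" for i
    proof -
      have "\<not> lit F i" using lit_less[of F i] that p by (auto simp: N_def)
      then show ?thesis using that p conf_lit[of F i p]
        by (auto simp: digit_def hi_bit_def lo_bit_def N_def)
    qed
    have s: "(\<Sum>i<R. lam i * digit i p) = (\<Sum>i<N. of_bool (i \<in> S) * digit i p) + (\<Sum>i<N. slack i * digit (N + i) p)"
      unfolding sum_split3[OF R] using z lam by simp
    have cnt: "(\<Sum>i<N. of_bool (i \<in> S) * (of_bool (Q i) :: nat)) = card {i \<in> S. Q i}" for Q
    proof -
      have "(\<Sum>i<N. of_bool (i \<in> S) * (of_bool (Q i) :: nat)) = (\<Sum>i<N. of_bool (i \<in> {i \<in> S. Q i}))"
        by (rule sum.cong) auto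
      also have "\<dots> = card ({..<N} \<inter> {i \<in> S. Q i})" by (simp add: Int_def)
      also have "{..<N} \<inter> {i \<in> S. Q i} = {i \<in> S. Q i}" using SN by auto
      finally show ?thesis .
    qed
    have nlit: "\<not> lit F (N + i)" for i using lit_less[of F "N + i"] by (auto simp: N_def)
    show ?thesis
    proof (cases "mark F p")
      case True
      obtain i where i: "i \<in> S \<and> own F i p" "\<And>j. j \<in> S \<and> own F j p \<Longrightarrow> j = i" using S(2)[OF True] by (elim ex1E) metis
      have "{i \<in> S. lit F i \<and> own F i p} = {i}" using i S(1) by blast
      then have "(\<Sum>i<N. of_bool (i \<in> S) * digit i p) = 1" unfolding digit_mark[OF True] cnt by simp
      moreover have "(\<Sum>i<N. slack i * digit (N + i) p) = 0" unfolding digit_mark[OF True] using nlit by simp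
      ultimately show ?thesis using s True not_lit_mark[of F p] by (auto simp: tdigit_def)
    next
      case nm: False
      show ?thesis
      proof (cases "lit F p")
        case True
        have "(\<Sum>i<N. of_bool (i \<in> S) * digit i p) = (\<Sum>i<N. of_bool (i \<in> S) * (of_bool (i = p) * G) + of_bool (i \<in> S) * of_bool (conf F i p))"
        proof (rule sum.cong)
          fix i assume "i \<in> {..<N}"
          then have "i \<noteq> N + p" by simp
          then show "of_bool (i \<in> S) * digit i p = of_bool (i \<in> S) * (of_bool (i = p) * G) + of_bool (i \<in> S) * of_bool (conf F i p)"
            unfolding digit_lit[OF True] by simp
        qed simp
        also have "\<dots> = (\<Sum>i<N. if i = p then of_bool (p \<in> S) * G else 0) + C p"
          unfolding sum.distrib cnt C_def by (auto intro!: sum.cong)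
        also have "\<dots> = of_bool (p \<in> S) * G + C p" using p by simp
        finally have 1: "(\<Sum>i<N. of_bool (i \<in> S) * digit i p) = of_bool (p \<in> S) * G + C p" .
        have "(\<Sum>i<N. slack i * digit (N + i) p) = (\<Sum>i<N. if i = p then slack p else 0)"
        proof (rule sum.cong)
          fix i assume "i \<in> {..<N}"
          have "\<not> conf F (N + i) p" using conf_lit nlit by blast
          moreover have "N + i \<noteq> p" using p by simp
          ultimately show "slack i * digit (N + i) p = (if i = p then slack p else 0)"
            unfolding digit_lit[OF True] by simp
        qed simp
        also have "\<dots> = slack p" using p by simp
        finally show ?thesis using s 1 C_le[of p] True nm by (simp add: slack_def tdigit_def)
      next
        case False
        then show ?thesis using s digit_other[OF False nm] nm by (simp add: tdigit_def)
      qed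
    qed
  qed
  then show ?thesis using tot by blast
qed

lemma knapsack_iff_selectable:
  assumes "2 * N < R"
  shows "(\<exists>lam. (\<Sum>i<R. lam i) = T \<and> (\<Sum>i<R. lam i * bval (item_string F i)) = bval (target_string F)) \<longleftrightarrow> selectable F"
proof
  assume "\<exists>lam. (\<Sum>i<R. lam i) = T \<and> (\<Sum>i<R. lam i * bval (item_string F i)) = bval (target_string F)"
  then obtain lam where "(\<Sum>i<R. lam i) = T" "(\<Sum>i<R. lam i * bval (item_string F i)) = bval (target_string F)" by blast
  then show "selectable F" using system_iff system_imp_selectable[OF assms] by blast
next
  assume "selectable F"
  then obtain lam where lam: "(\<Sum>i<R. lam i) = T" "\<forall>p<N. (\<Sum>i<R. lam i * digit i p) = tdigit p"
    using selectable_imp_system[OF assms] by blast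
  then show "\<exists>lam. (\<Sum>i<R. lam i) = T \<and> (\<Sum>i<R. lam i * bval (item_string F i)) = bval (target_string F)"
    using system_iff[OF lam(1)] by blast
qed

end

section \<open>Selections and satisfying assignments\<close>

text \<open>Offset of block c in a concatenation. It is used on two levels: for tokens within the
  string, and for clauses within the list of tokens.\<close>

definition cpos :: "'a list list \<Rightarrow> nat \<Rightarrow> nat" where
  "cpos xss c = length (concat (take c xss))"

lemma cpos_0 [simp]: "cpos xss 0 = 0"
  by (simp add: cpos_def)

lemma cpos_Suc: "c < length xss \<Longrightarrow> cpos xss (Suc c) = cpos xss c + length (xss ! c)"
  by (simp add: cpos_def take_Suc_conv_app_nth)

lemma cpos_length: "cpos xss (length xss) = length (concat xss)"
  by (simp add: cpos_def)

lemma cpos_mono: "c < c' \<Longrightarrow> c' \<le> length xss \<Longrightarrow> cpos xss c + length (xss ! c) \<le> cpos xss c'"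
proof (induction c')
  case (Suc c')
  show ?case
  proof (cases "c = c'")
    case True
    then show ?thesis using Suc.prems by (simp add: cpos_Suc)
  next
    case False
    then show ?thesis using Suc by (simp add: cpos_Suc)
  qed
qed simp

lemma concat_nth_cpos: "c < length xss \<Longrightarrow> r < length (xss ! c) \<Longrightarrow>
  cpos xss c + r < length (concat xss) \<and> concat xss ! (cpos xss c + r) = xss ! c ! r"
proof (induction xss arbitrary: c)
  case (Cons xs xss)
  then show ?case by (cases c) (auto simp: cpos_def nth_append add.assoc)
qed simp

lemma cpos_decomp: "i < length (concat xss) \<Longrightarrow> \<exists>c<length xss. \<exists>r<length (xss ! c). i = cpos xss c + r"
proof (induction xss arbitrary: i)
  case (Cons xs xss)
  show ?case
  proof (cases "i < length xs")
    case True
    then show ?thesis by (intro exI[of _ 0]) auto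
  next
    case False
    then have "i - length xs < length (concat xss)" using Cons.prems by auto
    then obtain c r where c: "c < length xss" "r < length (xss ! c)" "i - length xs = cpos xss c + r"
      using Cons.IH by blast
    then show ?thesis using False by (intro exI[of _ "Suc c"]) (auto simp: cpos_def)
  qed
qed simp

context
  fixes ts :: "nat list list" and pos :: "nat \<Rightarrow> nat" and F :: "nat list"
  assumes ts: "\<And>t. t \<in> set ts \<Longrightarrow> set t \<subseteq> {1, 2}"
  defines "pos \<equiv> cpos (map (\<lambda>t. t @ [3]) ts)" and "F \<equiv> concat (map (\<lambda>t. t @ [3]) ts)"
begin

lemma pos_Suc: "m < length ts \<Longrightarrow> pos (Suc m) = pos m + length (ts ! m) + 1"
  by (simp add: pos_def cpos_Suc)

lemma pos_mono: "m < m' \<Longrightarrow> m' \<le> length ts \<Longrightarrow> pos m + length (ts ! m) < pos m'"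
  using cpos_mono[of m m' "map (\<lambda>t. t @ [3]) ts"] by (simp add: pos_def)

lemma pos_less_iff: "m \<le> length ts \<Longrightarrow> m' \<le> length ts \<Longrightarrow> pos m < pos m' \<longleftrightarrow> m < m'"
  using pos_mono[of m m'] pos_mono[of m' m] by (cases m m' rule: linorder_cases) auto

lemma rd_F: "m < length ts \<Longrightarrow> r \<le> length (ts ! m) \<Longrightarrow> rd F (pos m + r) = (ts ! m @ [3]) ! r"
  using concat_nth_cpos[of m "map (\<lambda>t. t @ [3]) ts" r] by (simp add: rd_def F_def pos_def)

lemma rd_F_tok: "m < length ts \<Longrightarrow> r < length (ts ! m) \<Longrightarrow> rd F (pos m + r) = ts ! m ! r \<and> ts ! m ! r \<in> {1, 2}"
proof -
  assume a: "m < length ts" "r < length (ts ! m)"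
  have "ts ! m ! r \<in> set (ts ! m)" using a by simp
  moreover have "set (ts ! m) \<subseteq> {1, 2}" using ts a by simp
  ultimately have "ts ! m ! r \<in> {1, 2}" by blast
  then show ?thesis using rd_F[of m r] a by (simp add: nth_append)
qed

lemma rd_F_end: "m < length ts \<Longrightarrow> rd F (pos m + length (ts ! m)) = 3"
  using rd_F[of m "length (ts ! m)"] by simp

lemma rd_F_length: "rd F (pos (length ts)) = 0"
  using cpos_length[of "map (\<lambda>t. t @ [3]) ts"] by (simp add: rd_def F_def pos_def)

text \<open>Tokens contain only 1 and 2, so a separator always ends a token. The case m =
  \<open>length ts\<close> is the end of the string; it is excluded later because reading there
  yields 0.\<close>

lemma prev_sep_iff: "rd (3 # F) p = 3 \<longleftrightarrow> (\<exists>m\<le>length ts. p = pos m)"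
proof
  assume a: "rd (3 # F) p = 3"
  show "\<exists>m\<le>length ts. p = pos m"
  proof (cases p)
    case 0
    then show ?thesis by (intro exI[of _ 0]) (simp add: pos_def)
  next
    case (Suc p')
    then have p': "rd F p' = 3" using a by (simp add: rd_def split: if_splits)
    then have "p' < length F" by (auto simp: rd_def split: if_splits)
    then obtain m r where m: "m < length ts" "r \<le> length (ts ! m)" "p' = pos m + r"
      using cpos_decomp[of p' "map (\<lambda>t. t @ [3]) ts"] by (auto simp: F_def pos_def less_Suc_eq_le)
    then have "r = length (ts ! m)" using p' rd_F_tok[of m r] by (cases "r < length (ts ! m)") auto
    then show ?thesis using m Suc by (intro exI[of _ "Suc m"]) (simp add: pos_Suc)
  qed
next
  assume "\<exists>m\<le>length ts. p = pos m"
  then obtain m where m: "m \<le> length ts" "p = pos m" by blast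
  show "rd (3 # F) p = 3"
  proof (cases m)
    case 0
    then show ?thesis using m by (simp add: pos_def rd_def)
  next
    case (Suc m')
    then have "rd F (pos m' + length (ts ! m')) = 3" "p = Suc (pos m' + length (ts ! m'))"
      using m rd_F_end[of m'] by (auto simp: pos_Suc)
    then show ?thesis by (simp add: rd_def split: if_splits)
  qed
qed

lemma rd_start: "m < length ts \<Longrightarrow> rd F (pos m) = (if ts ! m = [] then 3 else hd (ts ! m)) \<and>
    (ts ! m \<noteq> [] \<longrightarrow> hd (ts ! m) \<in> {1, 2})"
  using rd_F_end[of m] rd_F_tok[of m 0] by (auto simp: hd_conv_nth)

lemma mark_iff: "mark F p \<longleftrightarrow> (\<exists>m<length ts. p = pos m \<and> ts ! m = [])"
proof
  assume a: "mark F p"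
  then obtain m where m: "m \<le> length ts" "p = pos m" unfolding mark_def prev_sep_iff by blast
  moreover have "m \<noteq> length ts" using a m rd_F_length by (auto simp: mark_def)
  ultimately have "m < length ts" by simp
  then show "\<exists>m<length ts. p = pos m \<and> ts ! m = []" using a m rd_start[of m] by (auto simp: mark_def split: if_splits)
next
  assume "\<exists>m<length ts. p = pos m \<and> ts ! m = []"
  then show "mark F p" using rd_start unfolding mark_def prev_sep_iff by (metis less_imp_le)
qed

lemma lit_iff: "lit F p \<longleftrightarrow> (\<exists>m<length ts. p = pos m \<and> ts ! m \<noteq> [])"
proof
  assume a: "lit F p"
  then obtain m where m: "m \<le> length ts" "p = pos m" unfolding lit_def prev_sep_iff by blast
  moreover have "m \<noteq> length ts" using a m rd_F_length by (auto simp: lit_def)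
  ultimately have "m < length ts" by simp
  then show "\<exists>m<length ts. p = pos m \<and> ts ! m \<noteq> []" using a m rd_start[of m] by (auto simp: lit_def split: if_splits)
next
  assume "\<exists>m<length ts. p = pos m \<and> ts ! m \<noteq> []"
  then show "lit F p" using rd_start unfolding lit_def prev_sep_iff by (metis less_imp_le)
qed

lemma own_iff:
  assumes "m < length ts" "m' < length ts"
  shows "own F (pos m) (pos m') \<longleftrightarrow> m' < m \<and> \<not> (\<exists>x. m' < x \<and> x < m \<and> ts ! x = [])"
proof -
  have "(\<exists>x<pos m. pos m' < x \<and> mark F x) \<longleftrightarrow> (\<exists>x. m' < x \<and> x < m \<and> ts ! x = [])"
  proof
    assume "\<exists>x<pos m. pos m' < x \<and> mark F x"
    then obtain x where x: "x < pos m" "pos m' < x" "mark F x" by blast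
    then obtain y where y: "y < length ts" "x = pos y" "ts ! y = []" using mark_iff by blast
    then have "m' < y" "y < m" using x assms pos_less_iff by auto
    then show "\<exists>x. m' < x \<and> x < m \<and> ts ! x = []" using y by blast
  next
    assume "\<exists>x. m' < x \<and> x < m \<and> ts ! x = []"
    then obtain y where y: "m' < y" "y < m" "ts ! y = []" by blast
    then have "pos m' < pos y" "pos y < pos m" using assms pos_less_iff by auto
    moreover have "mark F (pos y)" unfolding mark_iff using y assms by (intro exI[of _ y]) auto
    ultimately show "\<exists>x<pos m. pos m' < x \<and> mark F x" by blast
  qed
  then show ?thesis using assms by (simp add: own_def pos_less_iff)
qed

text \<open>A common offset l of separators with agreeing symbols before it must be the length of
  both tails: a smaller l would hit a bit, and a larger one would pass a separator.\<close>

lemma conf_iff: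
  assumes m: "m < length ts" "m' < length ts" "ts ! m \<noteq> []" "ts ! m' \<noteq> []"
  shows "conf F (pos m) (pos m') \<longleftrightarrow> hd (ts ! m) \<noteq> hd (ts ! m') \<and> tl (ts ! m) = tl (ts ! m')"
proof -
  have lits: "lit F (pos m)" "lit F (pos m')" using m lit_iff by auto
  have ag: "agree F (pos m) (pos m') \<longleftrightarrow> hd (ts ! m) = hd (ts ! m')"
    using rd_start[OF m(1)] rd_start[OF m(2)] m by (auto simp: agree_def)
  have tok: "rd F (pos n + 1 + a) = tl (ts ! n) ! a \<and> tl (ts ! n) ! a \<in> {1, 2}" if "n < length ts" "a < length (tl (ts ! n))" for n a
    using rd_F_tok[of n "a + 1"] that by (auto simp: nth_tl add.commute)
  have end': "rd F (pos n + 1 + length (tl (ts ! n))) = 3" if "n < length ts" "ts ! n \<noteq> []" for n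
  proof -
    have "pos n + 1 + length (tl (ts ! n)) = pos n + length (ts ! n)" using that by (cases "ts ! n") auto
    then show ?thesis using rd_F_end[OF that(1)] by metis
  qed
  have "(\<exists>l<length F. rd F (pos m + 1 + l) = 3 \<and> rd F (pos m' + 1 + l) = 3 \<and> \<not> (\<exists>a<l. \<not> agree F (pos m + 1 + a) (pos m' + 1 + a)))
    \<longleftrightarrow> tl (ts ! m) = tl (ts ! m')" (is "?L \<longleftrightarrow> ?R")
  proof
    assume ?L
    then obtain l where l: "rd F (pos m + 1 + l) = 3" "rd F (pos m' + 1 + l) = 3"
      "\<And>a. a < l \<Longrightarrow> agree F (pos m + 1 + a) (pos m' + 1 + a)" by blast
    have len: "l = length (tl (ts ! n))" if n: "n < length ts" "ts ! n \<noteq> []" "rd F (pos n + 1 + l) = 3"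
      "\<And>a. a < l \<Longrightarrow> rd F (pos n + 1 + a) \<noteq> 3" for n
    proof (cases l "length (tl (ts ! n))" rule: linorder_cases)
      case less
      then show ?thesis using tok[OF n(1) less] n(3) by auto
    next
      case greater
      then show ?thesis using end'[OF n(1,2)] n(4) by auto
    qed
    have n3: "rd F (pos m + 1 + a) \<noteq> 3" "rd F (pos m' + 1 + a) \<noteq> 3" if "a < l" for a
      using l(3)[OF that] by (auto simp: agree_def)
    have "l = length (tl (ts ! m))" by (rule len[OF m(1,3) l(1) n3(1)])
    moreover have "l = length (tl (ts ! m'))" by (rule len[OF m(2,4) l(2) n3(2)])
    moreover have "tl (ts ! m) ! a = tl (ts ! m') ! a" if "a < l" for a
    proof -
      have "rd F (pos m + 1 + a) = rd F (pos m' + 1 + a)" using l(3)[OF that] by (auto simp: agree_def)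
      then show ?thesis using tok[of m a] tok[of m' a] m that calculation by metis
    qed
    ultimately show ?R by (metis nth_equalityI)
  next
    assume R: ?R
    let ?l = "length (tl (ts ! m))"
    have e: "rd F (pos m + 1 + ?l) = 3" "rd F (pos m' + 1 + ?l) = 3"
      using end'[of m] end'[of m'] m R by auto
    then have "?l < length F" by (auto simp: rd_def split: if_splits)
    moreover have "agree F (pos m + 1 + a) (pos m' + 1 + a)" if "a < ?l" for a
      using tok[of m a] tok[of m' a] m R that by (auto simp: agree_def)
    ultimately show ?L using e by blast
  qed
  then show ?thesis using lits ag by (auto simp: conf_def)
qed

end

lemma bval_bin: "bval (bin n) = n"
proof (induction n rule: less_induct)
  case (less n)
  show ?case
  proof (cases "n = 0")
    case False
    then have "bval (bin (n div 2)) = n div 2" using less[of "n div 2"] by simp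
    then show ?thesis using False by (simp add: bin_pos bval_snoc)
  qed simp
qed

text \<open>A token is a sign followed by the magnitude. Zero has to be excluded, as it equals its
  own negative but has only one sign.\<close>

lemma token_opposite:
  assumes "a \<noteq> 0" "b \<noteq> 0"
  shows "hd (token a) \<noteq> hd (token b) \<and> tl (token a) = tl (token b) \<longleftrightarrow> a = - b"
proof -
  have "bin (nat \<bar>a\<bar>) = bin (nat \<bar>b\<bar>) \<longleftrightarrow> nat \<bar>a\<bar> = nat \<bar>b\<bar>" using bval_bin by metis
  then show ?thesis using assms by (auto simp: token_def)
qed

text \<open>From a selection, set a variable to true iff one of its positive occurrences is chosen;
  a chosen negative literal is then true, as otherwise it would conflict. Conversely, choose a true
  literal in each clause, and two true literals are never opposite.\<close>

lemma selectable_iff_sat: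
  assumes nz: "\<And>C l. C \<in> set cls \<Longrightarrow> l \<in> set C \<Longrightarrow> l \<noteq> 0"
  shows "selectable (clause_string cls) \<longleftrightarrow> cnf_sat cls"
proof -
  \<comment> \<open>Clauses as blocks of tokens, each beginning with the empty token that serves as
    its mark; \<open>mi c\<close> is the token index of that mark.\<close>
  define css where "css = map (\<lambda>C. [] # map token C) cls"
  define ts where "ts = concat css"
  define mi where "mi = cpos css"
  define pos where "pos = cpos (map (\<lambda>t. t @ [3]) ts)"
  define F where "F = concat (map (\<lambda>t. t @ [3]) ts)"
  have F: "clause_string cls = F"
    unfolding F_def ts_def css_def clause_string_def
    by (induction cls) (auto simp: enc_int_token[abs_def] o_def)
  have tsym: "set t \<subseteq> {1, 2}" if "t \<in> set ts" for t
  proof -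
    have "t = [] \<or> (\<exists>z. t = token z)" using that unfolding ts_def css_def by (auto split: if_splits)
    then show ?thesis using token_symbols by auto
  qed
  have mark_iff': "mark F p \<longleftrightarrow> (\<exists>m<length ts. p = pos m \<and> ts ! m = [])" for p
    unfolding F_def pos_def by (rule mark_iff[OF tsym])
  have lit_iff': "lit F p \<longleftrightarrow> (\<exists>m<length ts. p = pos m \<and> ts ! m \<noteq> [])" for p
    unfolding F_def pos_def by (rule lit_iff[OF tsym])
  have own_iff': "own F (pos m) (pos m') \<longleftrightarrow> m' < m \<and> \<not> (\<exists>x. m' < x \<and> x < m \<and> ts ! x = [])"
    if "m < length ts" "m' < length ts" for m m'
    unfolding F_def pos_def by (rule own_iff[OF tsym that])
  have conf_iff': "conf F (pos m) (pos m') \<longleftrightarrow> hd (ts ! m) \<noteq> hd (ts ! m') \<and> tl (ts ! m) = tl (ts ! m')"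
    if "m < length ts" "m' < length ts" "ts ! m \<noteq> []" "ts ! m' \<noteq> []" for m m'
    unfolding F_def pos_def by (rule conf_iff[OF tsym that])
  have len: "length css = length cls" "\<And>c. c < length cls \<Longrightarrow> length (css ! c) = Suc (length (cls ! c))"
    by (simp_all add: css_def)
  have M: "mi c < length ts" "ts ! mi c = []" if "c < length cls" for c
    using concat_nth_cpos[of c css 0] that by (auto simp: len mi_def ts_def css_def)
  have L: "mi c + Suc l < length ts" "ts ! (mi c + Suc l) = token (cls ! c ! l)" if "c < length cls" "l < length (cls ! c)" for c l
    using concat_nth_cpos[of c css "Suc l"] that by (auto simp: len mi_def ts_def css_def)
  have tne: "token z \<noteq> []" for z by (simp add: token_def)
  have dec: "\<exists>c<length cls. m = mi c \<or> (\<exists>l<length (cls ! c). m = mi c + Suc l)" if "m < length ts" for m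
  proof -
    obtain c r where c: "c < length css" "r < length (css ! c)" "m = cpos css c + r"
      using cpos_decomp[of m css] \<open>m < length ts\<close> unfolding ts_def by blast
    then show ?thesis by (cases r) (auto simp: len mi_def)
  qed
  have mi_mono: "mi c + length (cls ! c) < mi c'" if "c < c'" "c' < length cls" for c c'
    using cpos_mono[of c c' css] that len by (simp add: mi_def)
  \<comment> \<open>String positions of marks and literals in terms of clause and literal indices.
    The facts K1 to K4 express the predicates through them, after which the argument is purely
    combinatorial.\<close>
  define MP where "MP c = pos (mi c)" for c
  define LP where "LP c l = pos (mi c + Suc l)" for c l
  have K1: "mark F p \<longleftrightarrow> (\<exists>c<length cls. p = MP c)" for p
  proof
    assume "mark F p"
    then obtain m where m: "m < length ts" "p = pos m" "ts ! m = []" using mark_iff' by blast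
    from dec[OF m(1)] obtain c where c: "c < length cls" "m = mi c \<or> (\<exists>l<length (cls ! c). m = mi c + Suc l)" by blast
    have "m = mi c" using c L(2)[OF c(1)] m(3) tne by auto
    then show "\<exists>c<length cls. p = MP c" using c(1) m(2) by (auto simp: MP_def)
  next
    assume "\<exists>c<length cls. p = MP c"
    then show "mark F p" unfolding mark_iff' MP_def using M by auto
  qed
  have K2: "lit F p \<longleftrightarrow> (\<exists>c<length cls. \<exists>l<length (cls ! c). p = LP c l)" for p
  proof
    assume "lit F p"
    then obtain m where m: "m < length ts" "p = pos m" "ts ! m \<noteq> []" using lit_iff' by blast
    from dec[OF m(1)] obtain c where c: "c < length cls" "m = mi c \<or> (\<exists>l<length (cls ! c). m = mi c + Suc l)" by blast
    have "m \<noteq> mi c" using M(2)[OF c(1)] m(3) by auto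
    then show "\<exists>c<length cls. \<exists>l<length (cls ! c). p = LP c l" using c m(2) by (auto simp: LP_def)
  next
    assume "\<exists>c<length cls. \<exists>l<length (cls ! c). p = LP c l"
    then obtain c l where c: "c < length cls" "l < length (cls ! c)" "p = LP c l" by blast
    have "mi c + Suc l < length ts" "ts ! (mi c + Suc l) \<noteq> []" using L[OF c(1,2)] tne by auto
    then show "lit F p" unfolding lit_iff' c(3) LP_def by blast
  qed
  have K3: "own F (LP c l) (MP c') \<longleftrightarrow> c = c'" if c: "c < length cls" "l < length (cls ! c)" "c' < length cls" for c l c'
  proof -
    have iff: "own F (LP c l) (MP c') \<longleftrightarrow> mi c' < mi c + Suc l \<and> \<not> (\<exists>x. mi c' < x \<and> x < mi c + Suc l \<and> ts ! x = [])"
      unfolding LP_def MP_def by (rule own_iff') (use L M c in auto)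
    show ?thesis
    proof (cases c c' rule: linorder_cases)
      case less
      then show ?thesis using iff mi_mono[OF less c(3)] c(2) by auto
    next
      case equal
      have "ts ! x \<noteq> []" if x: "mi c < x" "x < mi c + Suc l" for x
      proof -
        obtain l' where "x = mi c + Suc l'" using x(1) less_iff_Suc_add by auto
        then show ?thesis using L(2)[of c l'] c x tne by auto
      qed
      then show ?thesis using iff equal by auto
    next
      case greater
      then have "mi c' < mi c" using mi_mono[OF greater c(1)] by simp
      then show ?thesis using iff greater M(2)[OF c(1)] by auto
    qed
  qed
  have K4: "conf F (LP c l) (LP c' l') \<longleftrightarrow> cls ! c ! l = - (cls ! c' ! l')"
    if c: "c < length cls" "l < length (cls ! c)" "c' < length cls" "l' < length (cls ! c')" for c l c' l'
  proof -
    have "conf F (LP c l) (LP c' l') \<longleftrightarrow> hd (token (cls ! c ! l)) \<noteq> hd (token (cls ! c' ! l')) \<and>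
        tl (token (cls ! c ! l)) = tl (token (cls ! c' ! l'))"
      unfolding LP_def L(2)[OF c(1,2), symmetric] L(2)[OF c(3,4), symmetric]
      by (rule conf_iff') (use L c tne in auto)
    also have "\<dots> \<longleftrightarrow> cls ! c ! l = - (cls ! c' ! l')"
    proof (rule token_opposite)
      show "cls ! c ! l \<noteq> 0" by (rule nz[of "cls ! c"]) (use c in auto)
      show "cls ! c' ! l' \<noteq> 0" by (rule nz[of "cls ! c'"]) (use c in auto)
    qed
    finally show ?thesis .
  qed
  show ?thesis unfolding F
  proof
    assume "selectable F"
    then obtain S where S0: "S \<subseteq> {i. lit F i} \<and> (\<forall>p. mark F p \<longrightarrow> (\<exists>!i. i \<in> S \<and> own F i p)) \<and>
       (\<forall>i\<in>S. \<forall>p\<in>S. \<not> conf F i p)"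
      unfolding selectable_def by (elim exE)
    have S_lit: "lit F i" if "i \<in> S" for i using S0 that by auto
    have S_own: "\<exists>i. i \<in> S \<and> own F i p" if "mark F p" for p using S0 that by (meson ex1_implies_ex)
    have S_conf: "\<not> conf F i p" if "i \<in> S" "p \<in> S" for i p using S0 that by simp
    define \<alpha> where "\<alpha> x = (\<exists>c<length cls. \<exists>l<length (cls ! c). LP c l \<in> S \<and> cls ! c ! l = int x)" for x
    have "\<exists>l\<in>set C. l > 0 \<and> \<alpha> (nat l) \<or> l < 0 \<and> \<not> \<alpha> (nat (- l))" if C: "C \<in> set cls" for C
    proof -
      obtain c where c: "c < length cls" "C = cls ! c" using C by (auto simp: in_set_conv_nth)
      then have "mark F (MP c)" using K1 by blast
      then obtain i where i: "i \<in> S" "own F i (MP c)" using S_own by blast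
      obtain c1 l where l: "c1 < length cls" "l < length (cls ! c1)" "i = LP c1 l"
        using S_lit[OF i(1)] unfolding K2 by blast
      then have c1: "c1 = c" using K3[OF l(1,2) c(1)] i by simp
      let ?z = "cls ! c ! l"
      have zC: "?z \<in> set C" using l c c1 by simp
      then have z0: "?z \<noteq> 0" using nz C by blast
      have "?z > 0 \<Longrightarrow> \<alpha> (nat ?z)" unfolding \<alpha>_def using l c1 c i by (intro exI[of _ c] exI[of _ l] conjI) auto
      moreover have "\<not> \<alpha> (nat (- ?z))" if neg: "?z < 0"
      proof
        assume "\<alpha> (nat (- ?z))"
        then obtain c2 l2 where c2: "c2 < length cls" "l2 < length (cls ! c2)" "LP c2 l2 \<in> S" "cls ! c2 ! l2 = - ?z"
          using neg unfolding \<alpha>_def by auto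
        then have "conf F (LP c2 l2) (LP c l)" using K4[of c2 l2 c l] c l c1 by simp
        then show False using S_conf[OF c2(3) i(1)] l(3) c1 by simp
      qed
      ultimately show ?thesis using zC z0 by (meson linorder_neqE_linordered_idom)
    qed
    then show "cnf_sat cls" unfolding cnf_sat_def by blast
  next
    assume "cnf_sat cls"
    then obtain \<alpha> where \<alpha>: "\<And>C. C \<in> set cls \<Longrightarrow> \<exists>l\<in>set C. l > 0 \<and> \<alpha> (nat l) \<or> l < 0 \<and> \<not> \<alpha> (nat (- l))"
      unfolding cnf_sat_def by blast
    have "\<exists>l<length (cls ! c). cls ! c ! l > 0 \<and> \<alpha> (nat (cls ! c ! l)) \<or> cls ! c ! l < 0 \<and> \<not> \<alpha> (nat (- (cls ! c ! l)))"
      if "c < length cls" for c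
      using \<alpha>[of "cls ! c"] that by (metis in_set_conv_nth nth_mem)
    then obtain ch where ch: "\<And>c. c < length cls \<Longrightarrow> ch c < length (cls ! c)"
      "\<And>c. c < length cls \<Longrightarrow> cls ! c ! ch c > 0 \<and> \<alpha> (nat (cls ! c ! ch c)) \<or> cls ! c ! ch c < 0 \<and> \<not> \<alpha> (nat (- (cls ! c ! ch c)))"
      by metis
    let ?S = "(\<lambda>c. LP c (ch c)) ` {..<length cls}"
    show "selectable F" unfolding selectable_def
    proof (intro exI[of _ ?S] conjI allI impI ballI)
      show "?S \<subseteq> {i. lit F i}" using K2 ch(1) by blast
    next
      fix p assume "mark F p"
      then obtain c where c: "c < length cls" "p = MP c" using K1 by blast
      show "\<exists>!i. i \<in> ?S \<and> own F i p"
      proof (rule ex1I[of _ "LP c (ch c)"])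
        show "LP c (ch c) \<in> ?S \<and> own F (LP c (ch c)) p" using c K3[OF c(1) ch(1)[OF c(1)] c(1)] by auto
        fix i assume "i \<in> ?S \<and> own F i p"
        then obtain c' where "c' < length cls" "i = LP c' (ch c')" "own F (LP c' (ch c')) (MP c)" using c by auto
        then show "i = LP c (ch c)" using K3[of c' "ch c'" c] ch(1) c by auto
      qed
    next
      fix i p assume "i \<in> ?S" "p \<in> ?S"
      then obtain c c' where c: "c < length cls" "i = LP c (ch c)" "c' < length cls" "p = LP c' (ch c')" by auto
      show "\<not> conf F i p"
        using K4[of c "ch c" c' "ch c'"] ch(2)[OF c(1)] ch(2)[OF c(3)] ch(1) c by auto
    qed
  qed
qed

section \<open>Arithmetic in the generator language\<close>

text \<open>Programs whose output is determined by its length: unary numbers, and flags that are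
  true iff the output is nonempty.\<close>

primrec only_ones :: "gen \<Rightarrow> bool" where
  "only_ones GSkip \<longleftrightarrow> True"
| "only_ones (Emit a) \<longleftrightarrow> a = 1"
| "only_ones (GSeq g h) \<longleftrightarrow> only_ones g \<and> only_ones h"
| "only_ones (GIf i j S g h) \<longleftrightarrow> only_ones g \<and> only_ones h"
| "only_ones (GFor u v g) \<longleftrightarrow> only_ones g"
| "only_ones (GLet v g h) \<longleftrightarrow> only_ones h"

lemma only_ones_gsem: "only_ones g \<Longrightarrow> set (gsem g e) \<subseteq> {1}"
  by (induction g arbitrary: e) auto

lemma rd_replicate [simp]: "rd (replicate k a) i = (if i < k then a else 0)"
  by (simp add: rd_def)

lemma set_replicate_subset [simp]: "set (replicate k a) \<subseteq> {a}"
  by (auto simp: set_replicate_conv_if)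

lemma rd_ones: "set xs \<subseteq> {1} \<Longrightarrow> rd xs i = (if i < length xs then 1 else 0)"
proof -
  assume "set xs \<subseteq> {1}"
  then have "i < length xs \<Longrightarrow> xs ! i = 1" using nth_mem[of i xs] by blast
  then show ?thesis by (simp add: rd_def)
qed

lemma ones_eq: "set xs \<subseteq> {1} \<Longrightarrow> xs = replicate (length xs) 1"
  by (rule replicate_eqI) auto

fun emits :: "nat list \<Rightarrow> gen" where
  "emits [] = GSkip"
| "emits (a # as) = GSeq (Emit a) (emits as)"

lemma gsem_emits [simp]: "gsem (emits xs) e = xs"
  by (induction xs) auto

lemma ok_emits [simp]: "ok (emits xs) V m \<longleftrightarrow> set xs \<subseteq> {1, 2, 3}"
  by (induction xs) auto

lemma only_ones_emits [simp]: "only_ones (emits xs) \<longleftrightarrow> set xs \<subseteq> {1}"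
  by (induction xs) auto

definition g_copy :: "nat \<Rightarrow> nat \<Rightarrow> gen" where
  "g_copy n x = GFor x n (GIf x n {1} (Emit 1) (GIf x n {2} (Emit 2) (Emit 3)))"

definition g_len :: "nat \<Rightarrow> nat \<Rightarrow> gen" where
  "g_len n x = GFor x n (Emit 1)"

text \<open>For a string b of ones, the symbol at index \<open>length a\<close> is 1 exactly if a is
  shorter than b; otherwise it is blank.\<close>

definition if_less :: "nat \<Rightarrow> nat \<Rightarrow> gen \<Rightarrow> gen \<Rightarrow> gen" where
  "if_less a b g h = GIf b a {1} g h"

definition if_eq :: "nat \<Rightarrow> nat \<Rightarrow> gen \<Rightarrow> gen \<Rightarrow> gen" where
  "if_eq a b g h = if_less a b h (if_less b a h g)"

text \<open>Variable 2 is always empty, so that its length is the index of the first symbol of f.\<close>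

definition cond :: "nat \<Rightarrow> gen \<Rightarrow> gen \<Rightarrow> gen \<Rightarrow> gen" where
  "cond n f g h = GLet n f (GIf n 2 {1} g h)"

lemma ok_basic [simp]:
  "ok (g_copy n x) V m \<longleftrightarrow> x \<in> V \<and> m \<le> n"
  "ok (g_len n x) V m \<longleftrightarrow> x \<in> V \<and> m \<le> n"
  "ok (if_less a b g h) V m \<longleftrightarrow> a \<in> V \<and> b \<in> V \<and> ok g V m \<and> ok h V m"
  "ok (if_eq a b g h) V m \<longleftrightarrow> a \<in> V \<and> b \<in> V \<and> ok g V m \<and> ok h V m"
  "ok (cond n f g h) V m \<longleftrightarrow> m \<le> n \<and> ok f V (Suc n) \<and> (2 \<in> V \<or> n = 2) \<and> ok g (insert n V) (Suc n) \<and> ok h (insert n V) (Suc n)"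
  by (auto simp: g_copy_def g_len_def if_less_def if_eq_def cond_def)

lemma only_ones_basic [simp]:
  "only_ones (g_len n x)"
  "only_ones (if_less a b g h) \<longleftrightarrow> only_ones g \<and> only_ones h"
  "only_ones (if_eq a b g h) \<longleftrightarrow> only_ones g \<and> only_ones h"
  "only_ones (cond n f g h) \<longleftrightarrow> only_ones g \<and> only_ones h"
  by (auto simp: g_len_def if_less_def if_eq_def cond_def)

lemma gsem_len [simp]: "gsem (g_len n x) e = replicate (length (e x)) 1"
proof -
  have "concat (map (\<lambda>i. [1::nat]) [0..<k]) = replicate k 1" for k
    by (induction k) (auto simp: replicate_append_same)
  then show ?thesis by (simp add: g_len_def)
qed

lemma gsem_copy:
  assumes "set (e x) \<subseteq> {1, 2, 3}" "n \<noteq> x"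
  shows "gsem (g_copy n x) e = e x"
proof -
  have "gsem (g_copy n x) e = concat (map (\<lambda>i. [e x ! i]) [0..<length (e x)])"
    unfolding g_copy_def gsem.simps
  proof (rule arg_cong[where f = concat], rule map_cong)
    fix i assume "i \<in> set [0..<length (e x)]"
    then have i: "i < length (e x)" by simp
    then have "e x ! i \<in> {1, 2, 3}" using assms(1) nth_mem by blast
    then show "(if rd ((e(n := replicate i 1)) x) (length ((e(n := replicate i 1)) n)) \<in> {1} then [1]
        else if rd ((e(n := replicate i 1)) x) (length ((e(n := replicate i 1)) n)) \<in> {2} then [2] else [3]) = [e x ! i]"
      using assms(2) i by (auto simp: rd_def)
  qed simp
  also have "\<dots> = map ((!) (e x)) [0..<length (e x)]" by (induction "[0..<length (e x)]") auto
  finally show ?thesis by (simp add: map_nth)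
qed

lemma gsem_if_less [simp]:
  "set (e b) \<subseteq> {1} \<Longrightarrow> gsem (if_less a b g h) e = (if length (e a) < length (e b) then gsem g e else gsem h e)"
  by (simp add: if_less_def rd_ones)

lemma gsem_if_eq [simp]:
  "set (e a) \<subseteq> {1} \<Longrightarrow> set (e b) \<subseteq> {1} \<Longrightarrow>
   gsem (if_eq a b g h) e = (if length (e a) = length (e b) then gsem g e else gsem h e)"
  by (simp add: if_eq_def)

lemma gsem_cond:
  assumes "only_ones f" "e 2 = []" "n \<noteq> 2"
  shows "gsem (cond n f g h) e = (if gsem f e \<noteq> [] then gsem g (e(n := gsem f e)) else gsem h (e(n := [])))"
  using only_ones_gsem[OF assms(1), of e] assms(2,3) by (auto simp: cond_def rd_ones)

lemma concat_map_ne: "concat (map f [0..<k]) \<noteq> [] \<longleftrightarrow> (\<exists>i<k. f i \<noteq> [])"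
  by auto

definition pow2 :: "nat \<Rightarrow> bool" where
  "pow2 u \<longleftrightarrow> (\<exists>j. u = 2 ^ j)"

text \<open>A positive number is a power of two iff it has no odd divisor 3 + 2 a. Both a and the
  cofactor b are below u, so two loops over u find such a divisor without any division.\<close>

lemma pow2_iff: "pow2 u \<longleftrightarrow> 0 < u \<and> \<not> (\<exists>a<u. \<exists>b<u. b * (3 + a * 2) = u)"
proof
  assume "pow2 u"
  then obtain j where j: "u = 2 ^ j" by (auto simp: pow2_def)
  have False if "b * (3 + a * 2) = u" for a b
  proof -
    have "(3 + a * 2) dvd (2::nat) ^ j" using that j dvd_triv_right by metis
    moreover have "coprime (3 + a * 2) ((2::nat) ^ j)"
    proof (rule coprime_power_right_iff[THEN iffD2])
      have "odd (3 + a * 2)" by simp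
      then have "coprime (3 + a * 2) 2" using coprime_right_2_iff_odd by blast
      then show "coprime (3 + a * 2) 2 \<or> j = 0" ..
    qed
    ultimately have "is_unit (3 + a * 2)" by (meson coprime_common_divisor dvd_refl)
    then show False by simp
  qed
  then show "0 < u \<and> \<not> (\<exists>a<u. \<exists>b<u. b * (3 + a * 2) = u)" using j by auto
next
  assume a: "0 < u \<and> \<not> (\<exists>a<u. \<exists>b<u. b * (3 + a * 2) = u)"
  have "\<exists>j m. u = 2 ^ j * m \<and> odd m" if "0 < u" for u :: nat
    using that
  proof (induction u rule: less_induct)
    case (less u)
    show ?case
    proof (cases "odd u")
      case True
      then show ?thesis by (intro exI[of _ 0] exI[of _ u]) simp
    next
      case False
      then have "even u" by simp
      then obtain w where w: "u = 2 * w" by (elim evenE)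
      then have "w < u" "0 < w" using less.prems by auto
      then obtain j m where "w = 2 ^ j * m" "odd m" using less.IH by blast
      then show ?thesis using w by (intro exI[of _ "Suc j"] exI[of _ m]) simp
    qed
  qed
  then obtain j m where jm: "u = 2 ^ j * m" "odd m" using a by blast
  have "m = 1"
  proof (rule ccontr)
    assume "m \<noteq> 1"
    then have "3 \<le> m" using jm(2) by (cases "m = 0 \<or> m = 2") auto
    then obtain c where c: "m = 3 + c * 2" using jm(2)
      by (metis (no_types, lifting) even_add even_numeral evenE le_add_diff_inverse mult.commute odd_numeral)
    have "2 ^ j * (3 + c * 2) = u" using jm c by simp
    moreover have "c < u" "2 ^ j < u"
    proof -
      have "1 * m \<le> 2 ^ j * m" by (intro mult_le_mono1) simp
      then have "m \<le> u" using jm by simp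
      moreover have "c < m" using c by simp
      ultimately show "c < u" by (rule less_le_trans[rotated])
      have "2 ^ j * 1 < 2 ^ j * m" using \<open>3 \<le> m\<close> by (intro mult_strict_left_mono) auto
      then show "2 ^ j < u" using jm by simp
    qed
    ultimately show False using a by blast
  qed
  then show "pow2 u" using jm by (auto simp: pow2_def)
qed

lemma only_ones_replicate: "only_ones g \<Longrightarrow> length (gsem g e) = k \<Longrightarrow> gsem g e = replicate k 1"
  using ones_eq[OF only_ones_gsem] by blast

definition g_add :: "nat \<Rightarrow> nat \<Rightarrow> nat \<Rightarrow> gen" where
  "g_add n a b = GSeq (g_len n a) (g_len n b)"

definition g_add1 :: "nat \<Rightarrow> nat \<Rightarrow> nat \<Rightarrow> gen" where
  "g_add1 n a b = GSeq (g_len n a) (GSeq (Emit 1) (g_len n b))"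

definition g_diff :: "nat \<Rightarrow> nat \<Rightarrow> nat \<Rightarrow> gen" where
  "g_diff n a b = GFor a n (if_less n b GSkip (Emit 1))"

definition g_mul3 :: "nat \<Rightarrow> nat \<Rightarrow> nat \<Rightarrow> gen" where
  "g_mul3 n a b = GFor b n (GSeq (emits [1, 1, 1]) (GFor a (n + 1) (emits [1, 1])))"

definition g_odd_mul :: "nat \<Rightarrow> nat \<Rightarrow> nat \<Rightarrow> gen" where
  "g_odd_mul n u q = GSeq (g_len n u) (GFor q n (GFor u (n + 1) (emits [1, 1])))"

lemma ok_arith [simp]:
  "ok (g_add n a b) V m \<longleftrightarrow> a \<in> V \<and> b \<in> V \<and> m \<le> n"
  "ok (g_add1 n a b) V m \<longleftrightarrow> a \<in> V \<and> b \<in> V \<and> m \<le> n"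
  "a \<in> V \<and> b \<in> V \<and> m \<le> n \<Longrightarrow> ok (g_diff n a b) V m"
  "a \<in> V \<and> b \<in> V \<and> m \<le> n \<Longrightarrow> ok (g_mul3 n a b) V m"
  "a \<in> V \<and> b \<in> V \<and> m \<le> n \<Longrightarrow> ok (g_odd_mul n a b) V m"
  by (auto simp: g_add_def g_add1_def g_diff_def g_mul3_def g_odd_mul_def)

lemma gsem_add [simp]: "gsem (g_add n a b) e = replicate (length (e a) + length (e b)) 1"
  by (simp add: g_add_def replicate_add)

lemma gsem_add1 [simp]: "gsem (g_add1 n a b) e = replicate (length (e a) + 1 + length (e b)) 1"
  by (rule only_ones_replicate) (simp_all add: g_add1_def)

lemma gsem_diff:
  assumes "set (e b) \<subseteq> {1}" "b \<noteq> n"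
  shows "gsem (g_diff n a b) e = replicate (length (e a) - length (e b)) 1"
proof -
  have "concat (map (\<lambda>i. if i < m then [] else [1::nat]) [0..<k]) = replicate (k - m) 1" for k m
    by (induction k) (auto simp: Suc_diff_le replicate_append_same)
  then show ?thesis using assms by (simp add: g_diff_def cong: if_cong)
qed

lemma gsem_mul3:
  assumes "a \<noteq> n"
  shows "gsem (g_mul3 n a b) e = replicate (length (e b) * (3 + length (e a) * 2)) 1"
  by (rule only_ones_replicate) (use assms in \<open>simp_all add: g_mul3_def length_concat sum_list_triv o_def algebra_simps\<close>)

lemma gsem_odd_mul:
  assumes "u \<noteq> n"
  shows "gsem (g_odd_mul n u q) e = replicate (length (e u) + length (e q) * (length (e u) * 2)) 1"
  by (rule only_ones_replicate) (use assms in \<open>simp_all add: g_odd_mul_def length_concat sum_list_triv o_def algebra_simps\<close>)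

text \<open>Nonempty iff the number stored in u is not a power of two.\<close>

definition g_not_pow2 :: "nat \<Rightarrow> nat \<Rightarrow> gen" where
  "g_not_pow2 n u = GSeq (if_less 2 u GSkip (Emit 1))
     (GFor u n (GFor u (n + 1) (GLet (n + 2) (g_mul3 (n + 3) n (n + 1)) (if_eq (n + 2) u (Emit 1) GSkip))))"

lemma gsem_not_pow2:
  assumes "e 2 = []" "set (e u) \<subseteq> {1}" "u < n" "2 < n"
  shows "gsem (g_not_pow2 n u) e = [] \<longleftrightarrow> pow2 (length (e u))"
proof -
  let ?K = "length (e u)"
  have inner: "gsem (GLet (n + 2) (g_mul3 (n + 3) n (n + 1)) (if_eq (n + 2) u (Emit 1) GSkip)) (e(n := replicate a 1, n + 1 := replicate b 1))
    = (if b * (3 + a * 2) = ?K then [1] else [])" for a b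
    using assms by (simp add: gsem_mul3 del: One_nat_def)
  have first: "gsem (if_less 2 u GSkip (Emit 1)) e = (if 0 < ?K then [] else [1])" using assms by simp
  have "gsem (g_not_pow2 n u) e = (if 0 < ?K then [] else [1]) @
     concat (map (\<lambda>a. concat (map (\<lambda>b. if b * (3 + a * 2) = ?K then [1] else []) [0..<?K])) [0..<?K])"
  proof -
    have "(e(n := replicate a 1)) u = e u" for a using assms(3) by simp
    then show ?thesis unfolding g_not_pow2_def gsem.simps(3,5) inner first by simp
  qed
  then have "gsem (g_not_pow2 n u) e = [] \<longleftrightarrow> 0 < ?K \<and> (\<forall>a<?K. \<forall>b<?K. b * (3 + a * 2) \<noteq> ?K)"
  proof -
    have c: "concat (map f [0..<k]) = [] \<longleftrightarrow> (\<forall>i<k. f i = [])" for f :: "nat \<Rightarrow> nat list" and k by auto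
    assume "gsem (g_not_pow2 n u) e = (if 0 < ?K then [] else [1]) @
     concat (map (\<lambda>a. concat (map (\<lambda>b. if b * (3 + a * 2) = ?K then [1] else []) [0..<?K])) [0..<?K])"
    then show ?thesis by (simp only: append_is_Nil_conv c) (simp split: if_split, blast)
  qed
  then show ?thesis unfolding pow2_iff by metis
qed

definition g_bit :: "nat \<Rightarrow> nat \<Rightarrow> nat \<Rightarrow> gen" where
  "g_bit n x u = GFor x n (GLet (n + 1) (g_odd_mul (n + 2) u n)
     (if_less x (n + 1) GSkip (GLet (n + 2) (g_add (n + 3) (n + 1) u) (if_less x (n + 2) (Emit 1) GSkip))))"

text \<open>The quotient is odd iff X lies in an interval from (2 q + 1) U to (2 q + 2) U, the upper
  end excluded. Then q < X, so the interval is found by a loop over X with additions and comparisons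
  only.\<close>

lemma bit_at_iff:
  fixes U X :: nat
  assumes "0 < U"
  shows "odd (X div U) \<longleftrightarrow> (\<exists>q<X. U + q * (U * 2) \<le> X \<and> X < U + q * (U * 2) + U)"
proof
  assume "odd (X div U)"
  then obtain q where q: "X div U = 2 * q + 1" by (elim oddE)
  have 1: "X div U * U \<le> X" "X < X div U * U + U"
    using assms div_times_less_eq_dividend[of X U] dividend_less_div_times[of U X] by auto
  moreover have "X div U * U = U + q * (U * 2)" unfolding q by (simp add: algebra_simps)
  moreover have "q < X" using q div_le_dividend[of X U] by simp
  ultimately show "\<exists>q<X. U + q * (U * 2) \<le> X \<and> X < U + q * (U * 2) + U" by auto
next
  assume "\<exists>q<X. U + q * (U * 2) \<le> X \<and> X < U + q * (U * 2) + U"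
  then obtain q where q: "U + q * (U * 2) \<le> X" "X < U + q * (U * 2) + U" by blast
  have "X div U = 2 * q + 1"
    by (rule div_nat_eqI) (use q in \<open>simp_all add: algebra_simps\<close>)
  then show "odd (X div U)" by simp
qed

lemma gsem_bit:
  assumes "set (e x) \<subseteq> {1}" "0 < length (e u)" "u < n" "x < n"
  shows "gsem (g_bit n x u) e \<noteq> [] \<longleftrightarrow> odd (length (e x) div length (e u))"
proof -
  have "gsem (g_bit n x u) e = concat (map (\<lambda>q. if length (e u) + q * (length (e u) * 2) \<le> length (e x) \<and>
      length (e x) < length (e u) + q * (length (e u) * 2) + length (e u) then [1] else []) [0..<length (e x)])"
    unfolding g_bit_def gsem.simps
    by (rule arg_cong[where f = concat], rule map_cong) (use assms in \<open>simp_all add: gsem_odd_mul not_less\<close>)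
  then show ?thesis unfolding bit_at_iff[OF assms(2)] by (simp only: concat_map_ne) auto
qed

lemma only_ones_flags [simp]: "only_ones (g_not_pow2 n u)" "only_ones (g_bit n x u)"
  by (simp_all add: g_not_pow2_def g_bit_def)

lemma ok_not_pow2 [simp]: "2 \<in> V \<and> u \<in> V \<and> m \<le> n \<Longrightarrow> ok (g_not_pow2 n u) V m"
  by (simp add: g_not_pow2_def)

lemma ok_bit [simp]: "x \<in> V \<and> u \<in> V \<and> m \<le> n \<Longrightarrow> ok (g_bit n x u) V m"
  by (simp add: g_bit_def)

text \<open>Lets a loop over exponents be written as a loop over all smaller numbers that skips
  those which are not powers of two.\<close>

lemma pow2_list:
  assumes "\<And>j. (2::nat) ^ j < m \<longleftrightarrow> j < k"
  shows "filter pow2 [0..<m] = map (\<lambda>j. 2 ^ j) [0..<k]"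
proof (rule sorted_distinct_set_unique)
  show "sorted (map (\<lambda>j. (2::nat) ^ j) [0..<k])"
    by (auto simp: sorted_iff_nth_mono intro: power_increasing)
  show "distinct (map (\<lambda>j. (2::nat) ^ j) [0..<k])"
    by (auto simp: distinct_map inj_on_def)
  show "set (filter pow2 [0..<m]) = set (map (\<lambda>j. 2 ^ j) [0..<k])"
  proof (intro equalityI subsetI)
    fix u assume "u \<in> set (filter pow2 [0..<m])"
    then obtain j where "u = 2 ^ j" "u < m" by (auto simp: pow2_def)
    then show "u \<in> set (map (\<lambda>j. 2 ^ j) [0..<k])" using assms[of j] by simp
  next
    fix u assume "u \<in> set (map (\<lambda>j. (2::nat) ^ j) [0..<k])"
    then obtain j where "u = 2 ^ j" "j < k" by auto
    then show "u \<in> set (filter pow2 [0..<m])" using assms[of j] by (auto simp: pow2_def)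
  qed
qed (simp_all add: sorted_wrt_filter)

lemma concat_map_if: "concat (map (\<lambda>x. if P x then f x else []) xs) = concat (map f (filter P xs))"
  by (induction xs) auto

definition num_bits :: "nat \<Rightarrow> nat" where
  "num_bits n = length (bin n)"

lemma less_num_bits: "2 ^ j \<le> n \<longleftrightarrow> j < num_bits n"
proof (induction n arbitrary: j rule: less_induct)
  case (less n)
  show ?case
  proof (cases "n = 0")
    case False
    then have nb: "num_bits n = Suc (num_bits (n div 2))" by (simp add: num_bits_def bin_pos)
    have IH: "2 ^ j \<le> n div 2 \<longleftrightarrow> j < num_bits (n div 2)" for j using less[of "n div 2"] False by simp
    show ?thesis
    proof (cases j)
      case 0
      then show ?thesis using False nb by simp
    next
      case (Suc j')
      have "2 ^ Suc j' \<le> n \<longleftrightarrow> 2 ^ j' \<le> n div 2" by (auto simp: less_eq_div_iff_mult_less_eq mult.commute)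
      then show ?thesis using IH nb Suc by simp
    qed
  qed (simp add: num_bits_def)
qed

lemma bin_bits: "bin n = map (\<lambda>j. bsym (bit_at n j)) (rev [0..<num_bits n])"
proof (induction n rule: less_induct)
  case (less n)
  show ?case
  proof (cases "n = 0")
    case False
    then have nb: "num_bits n = Suc (num_bits (n div 2))" by (simp add: num_bits_def bin_pos)
    have "rev [0..<Suc k] = map Suc (rev [0..<k]) @ [0]" for k
      by (simp only: rev_map[symmetric] map_Suc_upt upt_conv_Cons[of 0 "Suc k"] zero_less_Suc rev.simps)
    then have "map (\<lambda>j. bsym (bit_at n j)) (rev [0..<num_bits n])
      = map (\<lambda>j. bsym (bit_at (n div 2) j)) (rev [0..<num_bits (n div 2)]) @ [bsym (odd n)]"
      unfolding nb by (simp add: o_def div_mult2_eq)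
    also have "\<dots> = bin (n div 2) @ [n mod 2 + 1]" using less[of "n div 2"] False
      by (simp add: bsym_def mod2_eq_if)
    finally show ?thesis using False by (simp add: bin_pos)
  qed (simp add: num_bits_def)
qed

text \<open>The variable n + 1 runs through X - i, that is, downwards from X to 1. Each power of two
  met on the way contributes the bit of X of that weight, so the most significant bit comes
  first.\<close>

definition g_number :: "nat \<Rightarrow> nat \<Rightarrow> gen" where
  "g_number n x = GSeq (Emit 1) (GSeq
     (GFor x n (GLet (n + 1) (g_diff (n + 2) x n)
        (cond (n + 2) (g_not_pow2 (n + 3) (n + 1)) GSkip
          (cond (n + 3) (g_bit (n + 4) x (n + 1)) (Emit 2) (Emit 1))))) (Emit 3))"

lemma ok_number [simp]: "2 \<in> V \<and> x \<in> V \<and> m \<le> n \<Longrightarrow> ok (g_number n x) V m"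
  by (simp add: g_number_def)

lemma gsem_number:
  assumes "e 2 = []" "e x = replicate X 1" "x < n" "2 < n"
  shows "gsem (g_number n x) e = enc_int (int X)"
proof -
  have "concat (map (\<lambda>i. gsem (GLet (n + 1) (g_diff (n + 2) x n)
        (cond (n + 2) (g_not_pow2 (n + 3) (n + 1)) GSkip
          (cond (n + 3) (g_bit (n + 4) x (n + 1)) (Emit 2) (Emit 1)))) (e(n := replicate i 1))) [0..<X])
    = concat (map (\<lambda>i. if pow2 (X - i) then [bsym (odd (X div (X - i)))] else []) [0..<X])"
  proof (rule arg_cong[where f = concat], rule map_cong)
    fix i assume "i \<in> set [0..<X]"
    then have "i < X" by simp
    then show "gsem (GLet (n + 1) (g_diff (n + 2) x n)
        (cond (n + 2) (g_not_pow2 (n + 3) (n + 1)) GSkip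
          (cond (n + 3) (g_bit (n + 4) x (n + 1)) (Emit 2) (Emit 1)))) (e(n := replicate i 1)) =
       (if pow2 (X - i) then [bsym (odd (X div (X - i)))] else [])"
      using assms by (simp add: gsem_diff gsem_cond gsem_not_pow2 gsem_bit[simplified] bsym_def del: One_nat_def)
  qed simp
  also have "map (\<lambda>i. if pow2 (X - i) then [bsym (odd (X div (X - i)))] else []) [0..<X]
     = map (\<lambda>u. if pow2 u then [bsym (odd (X div u))] else []) (rev [1..<Suc X])"
  proof -
    have "rev [1..<Suc X] = map (\<lambda>i. X - i) [0..<X]"
      by (rule nth_equalityI) (auto simp: rev_nth nth_upt simp del: upt_Suc)
    then show ?thesis by (simp add: o_def)
  qed
  \<comment> \<open>The value 0 may be added to the range since it is not a power of two; the range
    then has the form required by \<open>pow2_list\<close>.\<close>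
  also have "concat \<dots> = concat (map (\<lambda>u. if pow2 u then [bsym (odd (X div u))] else []) (rev [0..<Suc X]))"
    by (simp add: upt_conv_Cons[of 0 "Suc X"] pow2_def del: upt_Suc)
  also have "\<dots> = concat (map (\<lambda>u. [bsym (odd (X div u))]) (rev (map (\<lambda>j. 2 ^ j) [0..<num_bits X])))"
    using pow2_list[of "Suc X" "num_bits X"] less_num_bits[of _ X]
    by (simp only: concat_map_if rev_filter[symmetric] less_Suc_eq_le)
  also have "\<dots> = bin X" unfolding bin_bits[of X] by (simp add: rev_map o_def)
  finally have fin: "concat (map (\<lambda>i. gsem (GLet (n + 1) (g_diff (n + 2) x n)
        (cond (n + 2) (g_not_pow2 (n + 3) (n + 1)) GSkip
          (cond (n + 3) (g_bit (n + 4) x (n + 1)) (Emit 2) (Emit 1)))) (e(n := replicate i 1))) [0..<X]) = bin X" .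
  show ?thesis by (simp only: g_number_def gsem.simps(2,3,5) assms(2) length_replicate fin enc_int_def) simp
qed

section \<open>Generating the items and the target\<close>

definition if_lit :: "nat \<Rightarrow> gen \<Rightarrow> gen \<Rightarrow> gen" where
  "if_lit p g h = GIf 3 p {3} (GIf 1 p {1, 2} g h) h"

definition if_mark :: "nat \<Rightarrow> gen \<Rightarrow> gen \<Rightarrow> gen" where
  "if_mark p g h = GIf 3 p {3} (GIf 1 p {3} g h) h"

definition if_agree :: "nat \<Rightarrow> nat \<Rightarrow> gen \<Rightarrow> gen \<Rightarrow> gen" where
  "if_agree x y g h = GIf 1 x {1} (GIf 1 y {1} g h) (GIf 1 x {2} (GIf 1 y {2} g h) h)"

lemma ok_if [simp]:
  "ok (if_lit p g h) V m \<longleftrightarrow> 1 \<in> V \<and> 3 \<in> V \<and> p \<in> V \<and> ok g V m \<and> ok h V m"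
  "ok (if_mark p g h) V m \<longleftrightarrow> 1 \<in> V \<and> 3 \<in> V \<and> p \<in> V \<and> ok g V m \<and> ok h V m"
  "ok (if_agree p q g h) V m \<longleftrightarrow> 1 \<in> V \<and> p \<in> V \<and> q \<in> V \<and> ok g V m \<and> ok h V m"
  by (auto simp: if_lit_def if_mark_def if_agree_def)

lemma only_ones_if [simp]:
  "only_ones (if_lit p g h) \<longleftrightarrow> only_ones g \<and> only_ones h"
  "only_ones (if_mark p g h) \<longleftrightarrow> only_ones g \<and> only_ones h"
  "only_ones (if_agree p q g h) \<longleftrightarrow> only_ones g \<and> only_ones h"
  by (auto simp: if_lit_def if_mark_def if_agree_def)

text \<open>Variable 3 is the clause string shifted by one, so that its symbol at index p is the one
  preceding p. The initial separator makes position 0 the start of a token.\<close>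

definition base_env :: "nat list \<Rightarrow> store \<Rightarrow> bool" where
  "base_env F e \<longleftrightarrow> e 1 = F \<and> e 2 = [] \<and> e 3 = 3 # F"

lemma base_env_upd [simp]: "base_env F e \<Longrightarrow> 3 < n \<Longrightarrow> base_env F (e(n := x))"
  by (simp add: base_env_def)

lemma gsem_if_lit: "base_env F e \<Longrightarrow> gsem (if_lit p g h) e = (if lit F (length (e p)) then gsem g e else gsem h e)"
  by (simp add: if_lit_def lit_def base_env_def)

lemma gsem_if_mark: "base_env F e \<Longrightarrow> gsem (if_mark p g h) e = (if mark F (length (e p)) then gsem g e else gsem h e)"
  by (simp add: if_mark_def mark_def base_env_def)

lemma gsem_if_agree: "base_env F e \<Longrightarrow> gsem (if_agree x y g h) e = (if agree F (length (e x)) (length (e y)) then gsem g e else gsem h e)"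
  by (auto simp: if_agree_def agree_def base_env_def)

lemma gsem_cond': "only_ones f \<Longrightarrow> base_env F e \<Longrightarrow> 3 < n \<Longrightarrow>
  gsem (cond n f g h) e = (if gsem f e \<noteq> [] then gsem g (e(n := gsem f e)) else gsem h (e(n := [])))"
  by (rule gsem_cond) (auto simp: base_env_def)

definition g_hi :: "nat \<Rightarrow> nat \<Rightarrow> gen" where
  "g_hi i p = if_eq i p (if_lit p (Emit 1) GSkip) GSkip"

definition g_own :: "nat \<Rightarrow> nat \<Rightarrow> nat \<Rightarrow> gen" where
  "g_own n i p = if_less p i (cond n
     (GFor i (n + 1) (if_less p (n + 1) (if_mark (n + 1) (Emit 1) GSkip) GSkip)) GSkip (Emit 1)) GSkip"

definition g_disagree :: "nat \<Rightarrow> nat \<Rightarrow> nat \<Rightarrow> nat \<Rightarrow> gen" where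
  "g_disagree n i p l = GFor l n (GLet (n + 1) (g_add1 (n + 2) i n) (GLet (n + 2) (g_add1 (n + 3) p n)
     (if_agree (n + 1) (n + 2) GSkip (Emit 1))))"

definition g_conf :: "nat \<Rightarrow> nat \<Rightarrow> nat \<Rightarrow> gen" where
  "g_conf n i p = if_lit i (if_lit p (if_agree i p GSkip
     (GFor 1 n (GLet (n + 1) (g_add1 (n + 2) i n) (GLet (n + 2) (g_add1 (n + 3) p n)
        (GIf 1 (n + 1) {3} (GIf 1 (n + 2) {3}
          (cond (n + 3) (g_disagree (n + 4) i p n) GSkip (Emit 1)) GSkip) GSkip))))) GSkip) GSkip"

text \<open>Concatenation of flags acts as disjunction, because only nonemptiness of the output
  counts.\<close>

definition g_lo :: "nat \<Rightarrow> nat \<Rightarrow> nat \<Rightarrow> gen" where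
  "g_lo n i p = GSeq (if_lit p (GLet n (g_add (n + 1) 1 p) (if_eq i n (Emit 1) GSkip)) GSkip)
     (GSeq (if_lit i (if_mark p (g_own n i p) GSkip) GSkip) (g_conf n i p))"

lemma only_ones_items [simp]: "only_ones (g_hi i p)" "only_ones (g_own n i p)" "only_ones (g_disagree n i p l)"
  "only_ones (g_conf n i p)" "only_ones (g_lo n i p)"
  by (simp_all add: g_hi_def g_own_def g_disagree_def g_conf_def g_lo_def)

lemma ok_items [simp]:
  "{1, 2, 3, i, p} \<subseteq> V \<Longrightarrow> ok (g_hi i p) V m"
  "{1, 2, 3, i, p} \<subseteq> V \<and> m \<le> n \<Longrightarrow> ok (g_own n i p) V m"
  "{1, 2, 3, i, p, l} \<subseteq> V \<and> m \<le> n \<Longrightarrow> ok (g_disagree n i p l) V m"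
  "{1, 2, 3, i, p} \<subseteq> V \<and> m \<le> n \<Longrightarrow> ok (g_conf n i p) V m"
  "{1, 2, 3, i, p} \<subseteq> V \<and> m \<le> n \<Longrightarrow> ok (g_lo n i p) V m"
  by (simp_all add: g_hi_def g_own_def g_disagree_def g_conf_def g_lo_def)

lemma concat_map_flag: "concat (map (\<lambda>i. if P i then [1] else []) [0..<k]) \<noteq> ([] :: nat list) \<longleftrightarrow> (\<exists>i<k. P i)"
  unfolding concat_map_ne by auto

context
  fixes F :: "nat list" and e :: store and i p n :: nat
  assumes env: "base_env F e" and ei: "set (e i) \<subseteq> {1}" and ep: "set (e p) \<subseteq> {1}"
    and less: "i < n" "p < n" "3 < n"
begin

lemma gsem_hi: "gsem (g_hi i p) e \<noteq> [] \<longleftrightarrow> hi_bit F (length (e i)) (length (e p))"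
  using env ei ep by (simp add: g_hi_def gsem_if_lit[where F = F] hi_bit_def)

lemma gsem_own: "gsem (g_own n i p) e \<noteq> [] \<longleftrightarrow> own F (length (e i)) (length (e p))"
proof -
  let ?f = "GFor i (n + 1) (if_less p (n + 1) (if_mark (n + 1) (Emit 1) GSkip) GSkip)"
  have f0: "gsem ?f e = concat (map (\<lambda>x. if length (e p) < x \<and> mark F x then [1] else []) [0..<length (e i)])"
    unfolding gsem.simps(5)
    by (rule arg_cong[where f = concat], rule map_cong) (use env less in \<open>simp_all add: gsem_if_mark[where F = F]\<close>)
  define fl where "fl = gsem ?f e"
  have f: "fl \<noteq> [] \<longleftrightarrow> (\<exists>x<length (e i). length (e p) < x \<and> mark F x)"
    unfolding fl_def f0 by (simp only: concat_map_flag)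
  have "gsem (g_own n i p) e = (if length (e p) < length (e i) then (if fl \<noteq> [] then [] else [1]) else [])"
    unfolding g_own_def fl_def using env ei less
    by (simp only: gsem_if_less gsem_cond'[where F = F] only_ones.simps only_ones_basic only_ones_if gsem.simps(1,2) simp_thms split: if_split)
  then show ?thesis unfolding own_def f[symmetric] by simp
qed

lemma gsem_disagree:
  assumes "l < n"
  shows "gsem (g_disagree n i p l) e \<noteq> [] \<longleftrightarrow>
    (\<exists>a<length (e l). \<not> agree F (length (e i) + 1 + a) (length (e p) + 1 + a))"
proof -
  have "gsem (g_disagree n i p l) e = concat (map (\<lambda>a. if \<not> agree F (length (e i) + 1 + a) (length (e p) + 1 + a) then [1] else []) [0..<length (e l)])"
    unfolding g_disagree_def gsem.simps(5)
    by (rule arg_cong[where f = concat], rule map_cong) (use env less assms in \<open>simp_all add: gsem_if_agree[where F = F]\<close>)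
  then show ?thesis by (simp only: concat_map_flag)
qed

end

lemma gsem_conf:
  assumes env: "base_env F e" and ei: "set (e i) \<subseteq> {1}" and ep: "set (e p) \<subseteq> {1}"
    and less: "i < n" "p < n" "3 < n"
  shows "gsem (g_conf n i p) e \<noteq> [] \<longleftrightarrow> conf F (length (e i)) (length (e p))"
proof -
  let ?I = "length (e i)" and ?P = "length (e p)"
  let ?b = "GLet (n + 1) (g_add1 (n + 2) i n) (GLet (n + 2) (g_add1 (n + 3) p n)
        (GIf 1 (n + 1) {3} (GIf 1 (n + 2) {3}
          (cond (n + 3) (g_disagree (n + 4) i p n) GSkip (Emit 1)) GSkip) GSkip))"
  have inner: "gsem ?b (e(n := replicate l 1)) = (if rd F (?I + 1 + l) = 3 \<and> rd F (?P + 1 + l) = 3 \<and>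
      \<not> (\<exists>a<l. \<not> agree F (?I + 1 + a) (?P + 1 + a)) then [1] else [])" for l
  proof -
    let ?e = "e(n := replicate l 1, n + 1 := replicate (?I + 1 + l) 1, n + 2 := replicate (?P + 1 + l) 1)"
    have e: "base_env F ?e" "?e i = e i" "?e p = e p" "?e n = replicate l 1" "?e 1 = F" using env less by (simp_all add: base_env_def)
    have d: "gsem (g_disagree (n + 4) i p n) ?e \<noteq> [] \<longleftrightarrow> (\<exists>a<l. \<not> agree F (?I + 1 + a) (?P + 1 + a))"
      using gsem_disagree[OF e(1), of i p "n + 4" n] e ei ep less by simp
    have c: "gsem (cond (n + 3) (g_disagree (n + 4) i p n) GSkip (Emit 1)) ?e =
       (if \<exists>a<l. \<not> agree F (?I + 1 + a) (?P + 1 + a) then [] else [1])"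
      using gsem_cond'[OF _ e(1), of "g_disagree (n + 4) i p n" "n + 3"] less d by simp
    have "gsem ?b (e(n := replicate l 1)) =
      gsem (GIf 1 (n + 1) {3} (GIf 1 (n + 2) {3} (cond (n + 3) (g_disagree (n + 4) i p n) GSkip (Emit 1)) GSkip) GSkip) ?e"
      using less by simp
    also have "\<dots> = (if rd F (?I + 1 + l) = 3 then (if rd F (?P + 1 + l) = 3 then (if \<exists>a<l. \<not> agree F (?I + 1 + a) (?P + 1 + a) then [] else [1]) else []) else [])"
      unfolding gsem.simps(4) c e(5) by simp
    finally show ?thesis by simp
  qed
  define lp where "lp = gsem (GFor 1 n ?b) e"
  have loop: "lp \<noteq> [] \<longleftrightarrow> (\<exists>l<length F. rd F (?I + 1 + l) = 3 \<and> rd F (?P + 1 + l) = 3 \<and>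
      \<not> (\<exists>a<l. \<not> agree F (?I + 1 + a) (?P + 1 + a)))"
    unfolding lp_def gsem.simps(5) inner concat_map_flag using env by (simp add: base_env_def)
  have "gsem (g_conf n i p) e = (if lit F ?I then if lit F ?P then if agree F ?I ?P then [] else lp else [] else [])"
    unfolding g_conf_def lp_def using env by (simp only: gsem_if_lit[where F = F] gsem_if_agree[where F = F] gsem.simps(1))
  then show ?thesis unfolding conf_def loop[symmetric] by simp
qed

lemma gsem_lo:
  assumes env: "base_env F e" and ei: "set (e i) \<subseteq> {1}" and ep: "set (e p) \<subseteq> {1}"
    and less: "i < n" "p < n" "3 < n"
  shows "gsem (g_lo n i p) e \<noteq> [] \<longleftrightarrow> lo_bit F (length (e i)) (length (e p))"
proof -
  let ?I = "length (e i)" and ?P = "length (e p)"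
  have "gsem (if_lit p (GLet n (g_add (n + 1) 1 p) (if_eq i n (Emit 1) GSkip)) GSkip) e
    = (if lit F ?P then if ?I = length F + ?P then [1] else [] else [])"
    using env less ei by (simp add: gsem_if_lit[where F = F] base_env_def)
  moreover have "gsem (if_lit i (if_mark p (g_own n i p) GSkip) GSkip) e \<noteq> [] \<longleftrightarrow> lit F ?I \<and> mark F ?P \<and> own F ?I ?P"
    using env gsem_own[OF assms] by (simp add: gsem_if_lit[where F = F] gsem_if_mark[where F = F])
  ultimately show ?thesis using gsem_conf[OF assms] unfolding g_lo_def lo_bit_def by (auto split: if_splits)
qed

definition g_block :: "nat \<Rightarrow> gen \<Rightarrow> gen \<Rightarrow> gen" where
  "g_block n f h = GSeq (g_len n 1) (GSeq (g_len n 1) (GSeq (emits [1, 1]) (GSeq (cond n f (Emit 2) (Emit 1))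
     (GSeq (g_len n 1) (cond n h (Emit 2) (Emit 1))))))"

lemma gsem_block:
  assumes "base_env F e" "only_ones f" "only_ones h" "3 < n" "gsem f e \<noteq> [] \<longleftrightarrow> P" "gsem h e \<noteq> [] \<longleftrightarrow> Q"
  shows "gsem (g_block n f h) e = block (length F) P Q"
  using assms by (simp add: g_block_def block_def bsym_def gsem_cond'[where F = F] base_env_def)

definition g_item :: "nat \<Rightarrow> nat \<Rightarrow> gen" where
  "g_item n i = GSeq (Emit 2) (GFor 1 n (g_block (n + 1) (g_hi i n) (g_lo (n + 2) i n)))"

lemma gsem_item:
  assumes env: "base_env F e" and ei: "e i = replicate I 1" and less: "i < n" "3 < n"
  shows "gsem (g_item n i) e = item_string F I"
proof -
  have "gsem (g_block (n + 1) (g_hi i n) (g_lo (n + 2) i n)) (e(n := replicate p 1)) = block (length F) (hi_bit F I p) (lo_bit F I p)" for p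
  proof (rule gsem_block)
    have e: "base_env F (e(n := replicate p 1))" using env less by simp
    then show "base_env F (e(n := replicate p 1))" .
    show "gsem (g_hi i n) (e(n := replicate p 1)) \<noteq> [] \<longleftrightarrow> hi_bit F I p"
      using gsem_hi[OF e, of i n "n + 1"] ei less by simp
    show "gsem (g_lo (n + 2) i n) (e(n := replicate p 1)) \<noteq> [] \<longleftrightarrow> lo_bit F I p"
      using gsem_lo[OF e, of i n "n + 2"] ei less by simp
  qed (use less in simp_all)
  then show ?thesis using env unfolding g_item_def item_string_def gsem.simps by (simp add: base_env_def)
qed

definition g_target :: "nat \<Rightarrow> gen" where
  "g_target n = GSeq (Emit 2) (GSeq (g_add n 1 1) (GSeq (emits [1, 1])
     (GFor 1 n (g_block (n + 1) (if_lit n (Emit 1) GSkip) (if_mark n (Emit 1) GSkip)))))"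

lemma gsem_target:
  assumes env: "base_env F e" and less: "3 < n"
  shows "gsem (g_target n) e = target_string F"
proof -
  have "gsem (g_block (n + 1) (if_lit n (Emit 1) GSkip) (if_mark n (Emit 1) GSkip)) (e(n := replicate p 1)) = block (length F) (lit F p) (mark F p)" for p
  proof (rule gsem_block)
    have e: "base_env F (e(n := replicate p 1))" using env less by simp
    then show "base_env F (e(n := replicate p 1))" .
    show "gsem (if_lit n (Emit 1) GSkip) (e(n := replicate p 1)) \<noteq> [] \<longleftrightarrow> lit F p"
      using gsem_if_lit[OF e] by simp
    show "gsem (if_mark n (Emit 1) GSkip) (e(n := replicate p 1)) \<noteq> [] \<longleftrightarrow> mark F p"
      using gsem_if_mark[OF e] by simp
  qed (use less in simp_all)
  moreover have "replicate (length F + length F) 1 @ [1, 1] = replicate (2 * length F + 2) (1::nat)"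
    using replicate_add[of "length F + length F" 2 "1::nat"] by (simp add: numeral_2_eq_2)
  ultimately show ?thesis using env unfolding g_target_def target_string_def gsem.simps
    by (simp add: base_env_def del: replicate_Suc)
qed

lemma ok_strings [simp]:
  "1 \<in> V \<and> 2 \<in> V \<and> m \<le> n \<and> ok f V (Suc n) \<and> ok h V (Suc n) \<Longrightarrow> ok (g_block n f h) V m"
  "{1, 2, 3, i} \<subseteq> V \<and> m \<le> n \<Longrightarrow> ok (g_item n i) V m"
  "{1, 2, 3} \<subseteq> V \<and> m \<le> n \<Longrightarrow> ok (g_target n) V m"
  by (simp_all add: g_block_def g_item_def g_target_def)

section \<open>Generating the instance\<close>

text \<open>A loop over the bits j in which the variable n has length 2^j rather than j. This is the
  weight that \<open>g_bit\<close> expects, and equality of two bit indices can be tested on the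
  weights. Variable 5 holds the precomputed marks of the powers of two.\<close>

definition g_bits :: "nat \<Rightarrow> gen \<Rightarrow> gen" where
  "g_bits n g = GFor 5 n (GIf 5 n {2} g GSkip)"

definition pow_marks :: "nat \<Rightarrow> nat list" where
  "pow_marks m = map (\<lambda>u. if pow2 u then 2 else 1) [0..<m]"

text \<open>Chosen so that 2^k > 2 N: there are indices for N occurrences, N slack items and at
  least one padding item. At the same time 2^k is at most 4 N if N is positive.\<close>

definition dims :: "nat list \<Rightarrow> nat" where
  "dims F = num_bits (2 * length F)"

lemma ok_g_bits [simp]: "ok (g_bits n g) V m \<longleftrightarrow> 5 \<in> V \<and> m \<le> n \<and> ok g (insert n V) (Suc n)"
  by (auto simp: g_bits_def)

lemma only_ones_g_bits [simp]: "only_ones (g_bits n g) \<longleftrightarrow> only_ones g"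
  by (simp add: g_bits_def)

lemma gsem_bits:
  assumes "e 5 = pow_marks (2 * length F + 1)" "5 < n"
  shows "gsem (g_bits n g) e = concat (map (\<lambda>j. gsem g (e(n := replicate (2 ^ j) 1))) [0..<dims F])"
proof -
  let ?m = "2 * length F + 1"
  have "gsem (g_bits n g) e = concat (map (\<lambda>u. if pow2 u then gsem g (e(n := replicate u 1)) else []) [0..<?m])"
    unfolding g_bits_def gsem.simps
  proof (rule arg_cong[where f = concat], rule map_cong)
    show "[0..<length (e 5)] = [0..<?m]" by (simp add: assms(1) pow_marks_def)
    fix u assume "u \<in> set [0..<?m]"
    then have "u < ?m" by (simp only: set_upt atLeastLessThan_iff)
    then have "rd (pow_marks ?m) u = (if pow2 u then 2 else 1)" by (simp add: rd_def pow_marks_def del: upt_Suc)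
    then show "(if rd ((e(n := replicate u 1)) 5) (length ((e(n := replicate u 1)) n)) \<in> {2} then gsem g (e(n := replicate u 1)) else [])
      = (if pow2 u then gsem g (e(n := replicate u 1)) else [])"
      using assms by simp
  qed
  also have "\<dots> = concat (map (\<lambda>u. gsem g (e(n := replicate u 1))) (map (\<lambda>j. 2 ^ j) [0..<dims F]))"
    using pow2_list[of ?m "dims F"] less_num_bits[of _ "2 * length F"]
    by (simp only: concat_map_if dims_def Suc_eq_plus1[symmetric] less_Suc_eq_le)
  finally show ?thesis by (simp add: o_def)
qed

definition g_int :: "int \<Rightarrow> gen" where
  "g_int z = emits (enc_int z)"

definition g_neg :: "nat \<Rightarrow> nat \<Rightarrow> gen" where
  "g_neg n x = GSeq (Emit 2) (GSeq (g_copy n x) (Emit 3))"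

definition g_pos :: "nat \<Rightarrow> nat \<Rightarrow> gen" where
  "g_pos n x = GSeq (Emit 1) (GSeq (g_copy n x) (Emit 3))"

lemma gsem_int [simp]: "gsem (g_int z) e = enc_int z"
  by (simp add: g_int_def)

lemma ok_signed [simp]:
  "ok (g_int z) V m"
  "ok (g_neg n x) V m \<longleftrightarrow> x \<in> V \<and> m \<le> n"
  "ok (g_pos n x) V m \<longleftrightarrow> x \<in> V \<and> m \<le> n"
  using enc_int_symbols[of z] by (simp_all add: g_int_def g_neg_def g_pos_def)

definition num_string :: "nat list \<Rightarrow> bool" where
  "num_string s \<longleftrightarrow> (\<exists>xs. s = 2 # xs \<and> set xs \<subseteq> {1, 2})"

lemma enc_int_num_string:
  assumes "num_string s"
  shows "enc_int (int (bval s)) = 1 # s @ [3]" "enc_int (- int (bval s)) = 2 # s @ [3]" "set s \<subseteq> {1, 2, 3}"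
proof -
  obtain xs where xs: "s = 2 # xs" "set xs \<subseteq> {1, 2}" using assms by (auto simp: num_string_def)
  have "bin (bval s) = s" "0 < bval s" using bin_bval[OF xs(2)] xs(1) by auto
  then show "enc_int (int (bval s)) = 1 # s @ [3]" "enc_int (- int (bval s)) = 2 # s @ [3]"
    by (simp_all add: enc_int_def)
  show "set s \<subseteq> {1, 2, 3}" using xs by auto
qed

lemma gsem_signed:
  assumes "num_string (e x)" "n \<noteq> x"
  shows "gsem (g_neg n x) e = enc_int (- int (bval (e x)))" "gsem (g_pos n x) e = enc_int (int (bval (e x)))"
  using enc_int_num_string[OF assms(1)] gsem_copy[of e x n] assms(2) by (simp_all add: g_neg_def g_pos_def)

lemma blocks_symbols: "set (concat (map (\<lambda>p. block N (g p) (h p)) ps)) \<subseteq> {1, 2}"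
proof (induction ps)
  case (Cons p ps)
  then show ?case using block_symbols[of N "g p" "h p"] by simp
qed simp

lemma num_string_item: "num_string (item_string F i)"
  unfolding num_string_def item_string_def using blocks_symbols by blast

lemma num_string_target: "num_string (target_string F)"
proof -
  have "set (replicate (2 * length F + 2) 1 @ concat (map (\<lambda>p. block (length F) (lit F p) (mark F p)) [0..<length F])) \<subseteq> {1, 2}"
  proof -
    have "set (replicate (2 * length F + 2) (1::nat)) \<subseteq> {1, 2}" by (simp add: set_replicate_conv_if)
    then show ?thesis using blocks_symbols[of "length F" "lit F" "mark F" "[0..<length F]"]
      by (simp only: set_append Un_subset_iff)
  qed
  then show ?thesis unfolding num_string_def target_string_def by blast
qed

definition g_pattern :: "nat \<Rightarrow> nat \<Rightarrow> nat \<Rightarrow> gen" where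
  "g_pattern n i x = g_bits n (cond (n + 1) (g_bit (n + 2) i n)
     (GSeq (g_int 0) (g_neg (n + 2) x)) (GSeq (g_neg (n + 2) x) (g_int 0)))"

definition g_unit :: "int \<Rightarrow> int \<Rightarrow> gen" where
  "g_unit \<alpha> \<beta> = GSeq (g_bits 8 (if_eq 8 7 (GSeq (g_int \<alpha>) (g_int \<beta>)) (GSeq (g_int 0) (g_int 0)))) (GSeq (g_int 0) (g_int 0))"

definition g_zeros :: gen where
  "g_zeros = g_bits 7 (GSeq (g_int 0) (g_int 0))"

definition g_dim :: gen where
  "g_dim = GLet 7 (GSeq (g_bits 8 (emits [1, 1])) (emits [1, 1])) (g_number 8 7)"

definition g_num_rows :: gen where
  "g_num_rows = GLet 7 (GSeq (GFor 6 8 (emits [1, 1])) (GSeq (g_bits 8 (emits [1, 1, 1, 1])) (emits [1, 1]))) (g_number 8 7)"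

definition g_matrix :: gen where
  "g_matrix = GSeq (GFor 6 7 (GLet 8 (g_item 9 7)
       (GSeq (GSeq (g_pattern 9 7 8) (GSeq (g_neg 9 8) (g_int 1))) (GSeq (g_pattern 9 7 8) (GSeq (g_pos 9 8) (g_int (- 1)))))))
     (GSeq (g_bits 7 (GSeq (g_unit 1 1) (GSeq (g_unit (- 1) (- 1)) (GSeq (g_unit (- 1) 0) (g_unit 0 (- 1))))))
     (GSeq (GSeq g_zeros (GSeq (g_int 1) (g_int 0))) (GSeq g_zeros (GSeq (g_int (- 1)) (g_int 0)))))"

definition g_rhs :: gen where
  "g_rhs = GSeq (GFor 6 7 (GSeq (g_int 0) (g_int 0)))
     (GSeq (g_bits 7 (GSeq (g_int 1) (GSeq (g_int (- 1)) (GSeq (g_int 0) (g_int 0))))) (GSeq (g_int 1) (g_int 0)))"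

definition g_total :: "nat \<Rightarrow> gen" where
  "g_total n = GSeq (emits [1, 2]) (GSeq (g_add n 1 1) (emits [1, 1, 3]))"

definition g_query :: gen where
  "g_query = GSeq (g_bits 7 (GSeq (g_total 8) (g_total 8))) (GSeq (g_total 7) (GSeq (Emit 1) (GSeq (g_target 7) (Emit 3))))"

text \<open>Global variables are set up before any output: 3 is the shifted clause string, 4 has
  length 2 N + 1, 5 marks the powers of two below that, and 6 has length 2^k, obtained as 1 + 1 + 2
  + ... + 2^(k - 1). The five parts then follow the order of \<open>enc_pic\<close>.\<close>

definition g_main :: gen where
  "g_main = GLet 3 (GSeq (Emit 3) (g_copy 4 1)) (GLet 4 (GSeq (g_add 5 1 1) (Emit 1))
     (GLet 5 (GFor 4 6 (cond 7 (g_not_pow2 8 6) (Emit 1) (Emit 2)))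
     (GLet 6 (GSeq (Emit 1) (g_bits 7 (g_len 8 7)))
     (GSeq g_dim (GSeq g_num_rows (GSeq g_matrix (GSeq g_rhs g_query)))))))"

lemma ok_g_main: "ok g_main {1, 2} 3"
  by (simp add: g_main_def g_dim_def g_num_rows_def g_matrix_def g_rhs_def g_query_def g_zeros_def g_unit_def
      g_pattern_def g_total_def)

definition full_env :: "nat list \<Rightarrow> store \<Rightarrow> bool" where
  "full_env F e \<longleftrightarrow> base_env F e \<and> e 5 = pow_marks (2 * length F + 1) \<and> e 6 = replicate (2 ^ dims F) 1"

lemma full_env_upd [simp]: "full_env F e \<Longrightarrow> 6 < n \<Longrightarrow> full_env F (e(n := x))"
  by (simp add: full_env_def)

lemma gsem_bits': "full_env F e \<Longrightarrow> 5 < n \<Longrightarrow>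
  gsem (g_bits n g) e = concat (map (\<lambda>j. gsem g (e(n := replicate (2 ^ j) 1))) [0..<dims F])"
  by (rule gsem_bits) (simp_all add: full_env_def)

lemma length_concat_const: "length (concat (map (\<lambda>j. xs) [0..<k])) = k * length xs"
  by (simp add: length_concat o_def sum_list_triv)

lemma concat_concat_map: "concat (concat (map f xs)) = concat (map (\<lambda>x. concat (f x)) xs)"
  by (induction xs) simp_all

lemma enc_ints_append: "enc_ints (xs @ ys) = enc_ints xs @ enc_ints ys"
  by (simp add: enc_ints_def)

lemma enc_ints_concat: "enc_ints (concat xss) = concat (map enc_ints xss)"
  by (induction xss) (simp_all add: enc_ints_def)

lemma enc_ints_row: "enc_ints (row k a b c y) = concat (map (\<lambda>j. enc_int (a j) @ enc_int (b j)) [0..<k]) @ enc_int c @ enc_int y"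
  unfolding row_def enc_ints_append enc_ints_concat by (simp add: enc_ints_def o_def)

lemma bin_power2: "bin (2 ^ m) = 2 # replicate m 1"
proof -
  have "bval (2 # replicate m 1) = 2 ^ m"
    using bval_append[of "[2]" "replicate m 1"] by (simp add: bval_single bval_zeros del: One_nat_def)
  then show ?thesis using bin_bval[of "replicate m 1"] by (simp add: set_replicate_conv_if)
qed

lemma gsem_total:
  assumes "base_env F e"
  shows "gsem (g_total n) e = enc_int (int (2 ^ (2 * length F + 2)))"
proof -
  have "replicate (2 * length F + 2) (1::nat) = replicate (length F + length F) 1 @ [1, 1]"
    using replicate_add[of "length F + length F" 2 "1::nat"] by (simp add: numeral_2_eq_2 mult_2)
  then show ?thesis using assms
    by (simp add: g_total_def base_env_def enc_int_def bin_power2 nat_power_eq del: replicate_Suc power_Suc power_add)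
qed

context
  fixes F :: "nat list" and e :: store
  assumes env: "full_env F e"
begin

interpretation gadget: pic_gadget "dims F" "\<lambda>i. bval (item_string F i)" "2 ^ (2 * length F + 2)" "bval (target_string F)"
proof
  fix i i'
  show "bval (item_string F i) \<le> 2 * bval (item_string F i')"
    using item_range(2)[of F i] item_range(1)[of F i'] by linarith
qed

lemma benv: "base_env F e"
  using env by (simp add: full_env_def)

lemma gsem_dim: "gsem g_dim e = enc_int (int gadget.dim)"
proof -
  have l: "gsem (GSeq (g_bits 8 (emits [1, 1])) (emits [1, 1])) e = replicate gadget.dim 1"
    by (rule only_ones_replicate)
      (simp_all add: gsem_bits'[OF env] gadget.dim_def length_concat_const[where xs = "[Suc 0, Suc 0]", simplified] del: gsem_emits emits.simps, simp_all add: length_concat_const)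
  show ?thesis unfolding g_dim_def gsem.simps(6) l
    by (rule gsem_number) (use benv in \<open>simp_all add: base_env_def\<close>)
qed

lemma gsem_num_rows: "gsem g_num_rows e = enc_int (int (length gadget.Amat))"
proof -
  have e6: "length (e 6) = 2 ^ dims F" using env by (simp add: full_env_def)
  have l: "gsem (GSeq (GFor 6 8 (emits [1, 1])) (GSeq (g_bits 8 (emits [1, 1, 1, 1])) (emits [1, 1]))) e = replicate (length gadget.Amat) 1"
    unfolding gadget.length_Amat
    by (rule only_ones_replicate) (simp_all only: gsem.simps(3,5) gsem_bits'[OF env] gsem_emits length_append length_concat_const e6 only_ones.simps only_ones_g_bits only_ones_emits, simp_all)
  show ?thesis unfolding g_num_rows_def gsem.simps(6) l
    by (rule gsem_number) (use benv in \<open>simp_all add: base_env_def\<close>)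
qed

lemma gsem_pattern:
  assumes "e' 7 = replicate i 1" "e' 8 = item_string F i" "full_env F e'"
  shows "gsem (g_pattern 9 7 8) e' = concat (map (\<lambda>j. enc_int (gadget.pat1 i j) @ enc_int (gadget.pat2 i j)) [0..<dims F])"
proof -
  have less: "(5::nat) < 9" by simp
  show ?thesis
    unfolding g_pattern_def gsem_bits'[OF assms(3) less]
  proof (rule arg_cong[where f = concat], rule map_cong)
    fix j assume "j \<in> set [0..<dims F]"
    let ?e = "e'(9 := replicate (2 ^ j) 1)"
    have b: "gsem (g_bit 11 7 9) ?e \<noteq> [] \<longleftrightarrow> bit_at i j"
      using gsem_bit[of ?e 7 9 11] assms(1) by simp
    have e2: "?e 2 = []" using assms(3) by (simp add: full_env_def base_env_def)
    have c: "gsem (cond 10 (g_bit 11 7 9) g h) ?e =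
       (if gsem (g_bit 11 7 9) ?e \<noteq> [] then gsem g (?e(10 := gsem (g_bit 11 7 9) ?e)) else gsem h (?e(10 := [])))" for g h
      by (rule gsem_cond) (use e2 in simp_all)
    have v: "gsem (g_neg 11 8) (?e(10 := x)) = enc_int (- int (bval (item_string F i)))" for x
      using gsem_signed(1)[of "?e(10 := x)" 8 11] assms(2) num_string_item by simp
    have "gsem (cond 10 (g_bit 11 7 9) (GSeq (g_int 0) (g_neg 11 8)) (GSeq (g_neg 11 8) (g_int 0))) ?e
      = (if bit_at i j then enc_int 0 @ enc_int (- int (bval (item_string F i))) else enc_int (- int (bval (item_string F i))) @ enc_int 0)"
      unfolding c b gsem.simps(3) v gsem_int ..
    then show "gsem (cond (9 + 1) (g_bit (9 + 2) 7 9) (GSeq (g_int 0) (g_neg (9 + 2) 8)) (GSeq (g_neg (9 + 2) 8) (g_int 0))) ?e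
      = enc_int (gadget.pat1 i j) @ enc_int (gadget.pat2 i j)"
      by (simp add: gadget.pat1_def gadget.pat2_def)
  qed simp
qed

lemma gsem_unit:
  assumes "e' 7 = replicate (2 ^ j) 1" "full_env F e'"
  shows "gsem (g_unit \<alpha> \<beta>) e' = enc_ints (gadget.unit_row j \<alpha> \<beta>)"
proof -
  have "gsem (if_eq 8 7 (GSeq (g_int \<alpha>) (g_int \<beta>)) (GSeq (g_int 0) (g_int 0))) (e'(8 := replicate (2 ^ j') 1))
    = enc_int (if j' = j then \<alpha> else 0) @ enc_int (if j' = j then \<beta> else 0)" for j'
    using assms(1) by simp
  then show ?thesis unfolding g_unit_def gadget.unit_row_def enc_ints_row gsem.simps(3) gsem_bits'[OF assms(2), of 8, simplified]
    by simp
qed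

lemma gsem_matrix: "gsem g_matrix e = enc_ints (concat gadget.Amat)"
proof -
  have z: "gsem g_zeros e = concat (map (\<lambda>j. enc_int 0 @ enc_int 0) [0..<dims F])"
    unfolding g_zeros_def gsem_bits'[OF env, of 7, simplified] by simp
  have e6: "length (e 6) = 2 ^ dims F" using env by (simp add: full_env_def)
  have 1: "gsem (GLet 8 (g_item 9 7) (GSeq (GSeq (g_pattern 9 7 8) (GSeq (g_neg 9 8) (g_int 1)))
        (GSeq (g_pattern 9 7 8) (GSeq (g_pos 9 8) (g_int (- 1)))))) (e(7 := replicate i 1))
    = enc_ints (row (dims F) (gadget.pat1 i) (gadget.pat2 i) (- int (bval (item_string F i))) 1) @
      enc_ints (row (dims F) (gadget.pat1 i) (gadget.pat2 i) (int (bval (item_string F i))) (- 1))" for i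
  proof -
    let ?e1 = "e(7 := replicate i 1)"
    have it: "gsem (g_item 9 7) ?e1 = item_string F i" by (rule gsem_item) (use benv in auto)
    let ?e = "?e1(8 := item_string F i)"
    have p: "gsem (g_pattern 9 7 8) ?e = concat (map (\<lambda>j. enc_int (gadget.pat1 i j) @ enc_int (gadget.pat2 i j)) [0..<dims F])"
      by (rule gsem_pattern) (use env in auto)
    have s: "gsem (g_neg 9 8) ?e = enc_int (- int (bval (item_string F i)))" "gsem (g_pos 9 8) ?e = enc_int (int (bval (item_string F i)))"
      using gsem_signed[of ?e 8 9] num_string_item by simp_all
    show ?thesis unfolding gsem.simps(3,6) it p s enc_ints_row gsem_int by simp
  qed
  have 2: "gsem (GSeq (g_unit 1 1) (GSeq (g_unit (- 1) (- 1)) (GSeq (g_unit (- 1) 0) (g_unit 0 (- 1))))) (e(7 := replicate (2 ^ j) 1))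
    = enc_ints (gadget.unit_row j 1 1) @ enc_ints (gadget.unit_row j (- 1) (- 1)) @ enc_ints (gadget.unit_row j (- 1) 0) @ enc_ints (gadget.unit_row j 0 (- 1))" for j
    unfolding gsem.simps(3) by (simp add: gsem_unit[of _ j] env)
  have "gsem g_matrix e = concat (map (\<lambda>i. enc_ints (row (dims F) (gadget.pat1 i) (gadget.pat2 i) (- int (bval (item_string F i))) 1) @
      enc_ints (row (dims F) (gadget.pat1 i) (gadget.pat2 i) (int (bval (item_string F i))) (- 1))) [0..<2 ^ dims F])
    @ concat (map (\<lambda>j. enc_ints (gadget.unit_row j 1 1) @ enc_ints (gadget.unit_row j (- 1) (- 1)) @ enc_ints (gadget.unit_row j (- 1) 0) @ enc_ints (gadget.unit_row j 0 (- 1))) [0..<dims F])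
    @ enc_ints (row (dims F) (\<lambda>_. 0) (\<lambda>_. 0) 1 0) @ enc_ints (row (dims F) (\<lambda>_. 0) (\<lambda>_. 0) (- 1) 0)"
    unfolding g_matrix_def gsem.simps(3) gsem.simps(5)[of 6] gsem_bits'[OF env, of 7, simplified] 1[unfolded gsem.simps(3)] 2[unfolded gsem.simps(3)] z e6 enc_ints_row
    using 1 2 by (simp add: enc_ints_row)
  then show ?thesis unfolding gadget.Amat_def concat_append enc_ints_append enc_ints_concat map_append map_concat
    by (simp add: o_def concat_concat_map)
qed

lemma gsem_rhs: "gsem g_rhs e = enc_ints gadget.bvec"
proof -
  have e6: "length (e 6) = 2 ^ dims F" using env by (simp add: full_env_def)
  have "enc_ints [0, 0] = enc_int 0 @ enc_int 0" "enc_ints [1, - 1, 0, 0] = enc_int 1 @ enc_int (- 1) @ enc_int 0 @ enc_int 0"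
    "enc_ints [1, 0] = enc_int 1 @ enc_int 0" by (simp_all add: enc_ints_def)
  then show ?thesis unfolding g_rhs_def gadget.bvec_def enc_ints_append enc_ints_concat map_map o_def
    gsem.simps(3) gsem.simps(5)[of 6] gsem_bits'[OF env, of 7, simplified] e6 gsem_int by simp
qed

lemma gsem_query: "gsem g_query e = enc_ints gadget.qvec"
proof -
  have t: "gsem (g_target 7) e = target_string F" by (rule gsem_target) (use benv in auto)
  have T: "gsem (g_total n) e = enc_int (int (2 ^ (2 * length F + 2)))" for n by (rule gsem_total[OF benv])
  have T': "gsem (g_total n) (e(7 := x)) = enc_int (int (2 ^ (2 * length F + 2)))" for n x
    by (rule gsem_total) (use benv in simp)
  show ?thesis unfolding g_query_def gadget.qvec_def enc_ints_row gsem.simps(2,3) gsem_bits'[OF env, of 7, simplified] T T' t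
    enc_int_num_string(1)[OF num_string_target] by simp
qed

lemma gsem_body: "gsem (GSeq g_dim (GSeq g_num_rows (GSeq g_matrix (GSeq g_rhs g_query)))) e
  = enc_pic gadget.dim gadget.Amat gadget.bvec gadget.qvec"
  unfolding gsem.simps(3) gsem_dim gsem_num_rows gsem_matrix gsem_rhs gsem_query enc_pic_def enc_ints_append
  by (simp add: enc_ints_def)

end

section \<open>The lower bound\<close>

lemma length_powers: "length (concat (map (\<lambda>j. replicate (2 ^ j) (1::nat)) [0..<k])) + 1 = 2 ^ k"
  by (induction k) auto

text \<open>The hypothesis on the symbols is needed because \<open>g_copy\<close> reproduces only
  strings over 1, 2, 3. The gadget applies with v(i) the item numbers, and 2^k > 2 N makes the
  knapsack criterion available.\<close>

lemma reduction_correct: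
  assumes F: "set F \<subseteq> {1, 2, 3}"
  shows "\<exists>A b q. gsem g_main (gen_env F) = enc_pic (2 * dims F + 2) A b q \<and> pic_instance (2 * dims F + 2) A b q \<and>
    (pic_answer (2 * dims F + 2) A b q \<longleftrightarrow> selectable F)"
proof -
  interpret gadget: pic_gadget "dims F" "\<lambda>i. bval (item_string F i)" "2 ^ (2 * length F + 2)" "bval (target_string F)"
  proof
    fix i i'
    show "bval (item_string F i) \<le> 2 * bval (item_string F i')"
      using item_range(2)[of F i] item_range(1)[of F i'] by linarith
  qed
  let ?N = "length F"
  define e3 where "e3 = (gen_env F)(3 := 3 # F)"
  define e4 where "e4 = e3(4 := replicate (2 * ?N + 1) 1)"
  define e5 where "e5 = e4(5 := pow_marks (2 * ?N + 1))"
  define e6 where "e6 = e5(6 := replicate (2 ^ dims F) 1)"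
  have 3: "gsem (GSeq (Emit 3) (g_copy 4 1)) (gen_env F) = 3 # F"
    using gsem_copy[of "gen_env F" 1 4] F by (simp add: gen_env_def)
  have 4: "gsem (GSeq (g_add 5 1 1) (Emit 1)) e3 = replicate (2 * ?N + 1) 1"
    by (rule only_ones_replicate) (simp_all add: e3_def gen_env_def g_add_def)
  have 5: "gsem (GFor 4 6 (cond 7 (g_not_pow2 8 6) (Emit 1) (Emit 2))) e4 = pow_marks (2 * ?N + 1)"
  proof -
    have "gsem (cond 7 (g_not_pow2 8 6) (Emit 1) (Emit 2)) (e4(6 := replicate u 1)) = [if pow2 u then 2 else 1]" for u
    proof -
      let ?e = "e4(6 := replicate u 1)"
      have e2: "?e 2 = []" by (simp add: e4_def e3_def gen_env_def)
      have "gsem (g_not_pow2 8 6) ?e = [] \<longleftrightarrow> pow2 (length (?e 6))"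
        by (rule gsem_not_pow2) (use e2 in simp_all)
      then show ?thesis using gsem_cond[of "g_not_pow2 8 6" ?e 7] e2 by simp
    qed
    then show ?thesis unfolding gsem.simps(5) pow_marks_def
      by (simp add: e4_def del: upt_Suc)
  qed
  have 6: "gsem (GSeq (Emit 1) (g_bits 7 (g_len 8 7))) e5 = replicate (2 ^ dims F) 1"
  proof (rule only_ones_replicate)
    have bits: "gsem (g_bits 7 g) e5 = concat (map (\<lambda>j. gsem g (e5(7 := replicate (2 ^ j) 1))) [0..<dims F])" for g
      by (rule gsem_bits) (simp_all add: e5_def)
    show "length (gsem (GSeq (Emit 1) (g_bits 7 (g_len 8 7))) e5) = 2 ^ dims F"
      unfolding gsem.simps(2,3) bits using length_powers[of "dims F"] by simp
  qed simp
  have env: "full_env F e6"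
    by (simp add: full_env_def base_env_def e6_def e5_def e4_def e3_def gen_env_def)
  have "gsem g_main (gen_env F) = gsem (GSeq g_dim (GSeq g_num_rows (GSeq g_matrix (GSeq g_rhs g_query)))) e6"
    unfolding g_main_def gsem.simps(6) 3 e3_def[symmetric] 4 e4_def[symmetric] 5 e5_def[symmetric] 6 e6_def[symmetric] ..
  also have "\<dots> = enc_pic gadget.dim gadget.Amat gadget.bvec gadget.qvec" by (rule gsem_body[OF env])
  finally have 1: "gsem g_main (gen_env F) = enc_pic gadget.dim gadget.Amat gadget.bvec gadget.qvec" .
  have "2 * ?N < 2 ^ dims F" using less_num_bits[of "dims F" "2 * ?N"] by (simp add: dims_def)
  then have "pic_answer gadget.dim gadget.Amat gadget.bvec gadget.qvec \<longleftrightarrow> selectable F"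
    unfolding gadget.pic_answer_iff by (rule knapsack_iff_selectable)
  then show ?thesis using 1 gadget.pic_instance_gadget unfolding gadget.dim_def by blast
qed

section \<open>Size estimates and asymptotics\<close>

lemma length_bin_le: "length (bin n) \<le> n"
proof (induction n rule: less_induct)
  case (less n)
  show ?case
  proof (cases "n = 0")
    case False
    then have "length (bin (n div 2)) \<le> n div 2" using less[of "n div 2"] by simp
    then show ?thesis using False by (simp add: bin_pos)
  qed simp
qed

lemma length_enc_int_le: "length (enc_int z) \<le> nat \<bar>z\<bar> + 2"
  using length_bin_le[of "nat \<bar>z\<bar>"] by (simp add: enc_int_def)

lemma length_enc_ints_le: "(\<And>z. z \<in> set zs \<Longrightarrow> nat \<bar>z\<bar> \<le> m) \<Longrightarrow> length (enc_ints zs) \<le> length zs * (m + 2)"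
proof (induction zs)
  case (Cons z zs)
  have "length (enc_int z) \<le> m + 2" using length_enc_int_le[of z] Cons.prems[of z] by simp
  moreover have "length (enc_ints zs) \<le> length zs * (m + 2)" using Cons by simp
  ultimately show ?case by (simp add: enc_ints_def)
qed (simp add: enc_ints_def)

text \<open>Time is measured against n only, so the whole input must be polynomial in n. Distinct
  clauses of at most three literals over 2 n + 1 integers number at most 4 (2 n + 1)^3.\<close>

lemma length_enc_3sat:
  obtains s where "\<And>n cls. is_3cnf n cls \<Longrightarrow> length (enc_3sat n cls) + 2 \<le> (n + 2) ^ s"
proof -
  define B where "B = (\<lambda>n::nat. 4 * ((2 * n + 1) * ((2 * n + 1) * (2 * n + 1))))"
  \<comment> \<open>The entries after the header are literals, of size at most n, and clause
    lengths, of size at most 3, hence n + 3; the further 2 is for sign and separator. Each clause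
    has at most 4 entries.\<close>
  define p where "p = (\<lambda>n. (n + 2) + (B n + 2) + 4 * B n * (n + 3 + 2) + 2)"
  have "poly_bounded_fun p" unfolding p_def B_def by (intro poly_bounded_intros)
  then obtain s where s: "\<And>n. p n \<le> (n + 2) ^ s" by (rule poly_bounded_funD) blast
  have "length (enc_3sat n cls) + 2 \<le> p n" if cnf: "is_3cnf n cls" for n cls
  proof -
    let ?A = "{- int n..int n}"
    have sub: "set cls \<subseteq> {C. set C \<subseteq> ?A \<and> length C \<le> 3}"
      using cnf unfolding is_3cnf_def by fastforce
    have cA: "card ?A = 2 * n + 1" by simp
    have "card (set cls) \<le> card {C. set C \<subseteq> ?A \<and> length C \<le> 3}"
      by (rule card_mono[OF _ sub]) (rule finite_lists_length_le, simp)
    also have "\<dots> = (\<Sum>i\<le>3. card ?A ^ i)" by (rule card_lists_length_le) simp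
    also have "\<dots> \<le> (\<Sum>i\<le>(3::nat). (2 * n + 1) ^ 3)"
      unfolding cA by (intro sum_mono power_increasing) auto
    also have "\<dots> = B n" by (simp add: B_def power3_eq_cube mult.assoc)
    finally have m: "length cls \<le> B n" using cnf distinct_card[of cls] by (simp add: is_3cnf_def)
    have len: "length (concat (map enc_clause cls)) \<le> 4 * length cls"
      using cnf unfolding is_3cnf_def by (induction cls) (auto simp: enc_clause_def)
    have "length (enc_ints (concat (map enc_clause cls))) \<le> length (concat (map enc_clause cls)) * (n + 3 + 2)"
    proof (rule length_enc_ints_le)
      fix z assume "z \<in> set (concat (map enc_clause cls))"
      then obtain C where C: "C \<in> set cls" "z = int (length C) \<or> z \<in> set C" by (auto simp: enc_clause_def)
      then have "length C \<le> 3" "z \<in> set C \<Longrightarrow> \<bar>z\<bar> \<le> int n" using cnf unfolding is_3cnf_def by auto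
      then show "nat \<bar>z\<bar> \<le> n + 3" using C by auto
    qed
    also have "\<dots> \<le> 4 * B n * (n + 3 + 2)" using len m by (intro mult_le_mono1) simp
    finally have 1: "length (enc_ints (concat (map enc_clause cls))) \<le> 4 * B n * (n + 3 + 2)" .
    have "length (enc_int (int n)) \<le> n + 2" "length (enc_int (int (length cls))) \<le> B n + 2"
      using length_enc_int_le[of "int n"] length_enc_int_le[of "int (length cls)"] m by simp_all
    moreover have "length (enc_3sat n cls) = length (enc_int (int n)) + length (enc_int (int (length cls))) + length (enc_ints (concat (map enc_clause cls)))"
      by (simp add: enc_3sat_def enc_ints_def enc_clause_def[abs_def])
    ultimately show ?thesis using 1 unfolding p_def by linarith
  qed
  then show thesis using that s order_trans by metis
qed

lemma decides_within_mono: "decides_within M w T b \<Longrightarrow> T \<le> T' \<Longrightarrow> decides_within M w T' b"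
  unfolding decides_within_def using order_trans by blast

text \<open>The little-o condition speaks of large d only; the sum of the finitely many remaining
  absolute values is absorbed in the additive constant.\<close>

lemma little_o_linear_bound:
  fixes f :: "nat \<Rightarrow> real"
  assumes "f \<in> o(\<lambda>d. real d)" "0 < \<epsilon>"
  obtains C where "0 \<le> C" "\<And>d. f d \<le> \<epsilon> * real d + C"
proof -
  have "eventually (\<lambda>d. norm (f d) \<le> \<epsilon> * norm (real d)) sequentially"
    using landau_o.smallD[OF assms] .
  then obtain D where D: "\<And>d. D \<le> d \<Longrightarrow> \<bar>f d\<bar> \<le> \<epsilon> * real d"
    unfolding eventually_sequentially by auto
  define C where "C = (\<Sum>d<D. \<bar>f d\<bar>)"
  have "f d \<le> \<epsilon> * real d + C" for d
  proof (cases "D \<le> d")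
    case True
    have "0 \<le> C" unfolding C_def by (rule sum_nonneg) simp
    then show ?thesis using D[OF True] by linarith
  next
    case False
    then have "\<bar>f d\<bar> \<le> C" unfolding C_def by (intro member_le_sum[where f = "\<lambda>d. \<bar>f d\<bar>"]) auto
    moreover have "0 \<le> \<epsilon> * real d" using assms(2) by simp
    ultimately show ?thesis by linarith
  qed
  moreover have "0 \<le> C" unfolding C_def by (rule sum_nonneg) simp
  ultimately show thesis using that by blast
qed

text \<open>The logarithm of the left side grows like n^(1/2) log n, so its quotient by the
  exponential tends to 0. A convergent sequence is bounded, which gives a constant valid for all n,
  including small ones.\<close>

lemma subexponential_bound:
  fixes c C K :: real and m :: nat
  assumes "0 < c" "0 < C"
  obtains K' where "\<And>n::nat. (real n + 2) ^ m + K * (real n + 2) powr (C * (real n + 2) powr (1/2)) \<le> K' * 2 powr (c * real n)"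
proof -
  let ?g = "\<lambda>n::nat. ((real n + 2) ^ m + K * (real n + 2) powr (C * (real n + 2) powr (1/2))) / 2 powr (c * real n)"
  have 1: "(\<lambda>n::nat. (real n + 2) ^ m / 2 powr (c * real n)) \<longlonglongrightarrow> 0"
    using assms by real_asymp
  have 2: "(\<lambda>n::nat. (real n + 2) powr (C * (real n + 2) powr (1/2)) / 2 powr (c * real n)) \<longlonglongrightarrow> 0"
    using assms by real_asymp
  have "?g \<longlonglongrightarrow> 0 + K * 0"
    using tendsto_add[OF 1 tendsto_mult_left[OF 2, of K]] by (simp add: add_divide_distrib)
  then have "Bseq ?g" by (intro convergent_imp_Bseq) (auto simp: convergent_def)
  then obtain K' where K': "\<And>n. norm (?g n) \<le> K'" by (auto simp: Bseq_def)
  have "(real n + 2) ^ m + K * (real n + 2) powr (C * (real n + 2) powr (1/2)) \<le> K' * 2 powr (c * real n)" for n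
  proof -
    have "?g n \<le> norm (?g n)" by (simp only: real_norm_def abs_ge_self)
    also have "\<dots> \<le> K'" by (rule K')
    finally have "?g n \<le> K'" .
    then show ?thesis by (subst (asm) pos_divide_le_eq) auto
  qed
  then show thesis using that by blast
qed

text \<open>For positive k the minimality of the number of bits gives 2^(k - 1) <= 2 N, hence 2^k <=
  4 L <= (L + 2)^2, and 2^d is 4 times the square of 2^k.\<close>

lemma dims_bound:
  assumes "length F \<le> L"
  shows "2 ^ (2 * dims F + 2) \<le> 4 * (L + 2) ^ 4"
proof -
  have "2 ^ dims F \<le> (L + 2) ^ 2"
  proof (cases "dims F")
    case (Suc k)
    then have "2 ^ k \<le> 2 * length F" using less_num_bits[of k "2 * length F"] by (simp add: dims_def)
    then have "2 ^ dims F \<le> 4 * L" using assms Suc by simp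
    also have "\<dots> \<le> (L + 2) ^ 2" by (simp add: power2_eq_square algebra_simps)
    finally show ?thesis .
  qed simp
  then have "(2 ^ dims F) ^ 2 \<le> ((L + 2) ^ 2) ^ 2" by (rule power_mono) simp
  moreover have "(2::nat) ^ (2 * dims F + 2) = 4 * (2 ^ dims F) ^ 2" by (simp add: power_add mult.commute[of 2] flip: power_mult)
  moreover have "((L + 2) ^ 2) ^ 2 = (L + 2) ^ 4" by (simp flip: power_mult)
  ultimately show ?thesis by (metis mult_le_mono2)
qed

theorem theorem1:
  assumes "ETH"
  shows "\<not> (\<exists>(M::tm) (f::nat \<Rightarrow> real) (K::real). wf_tm M \<and> f \<in> o(\<lambda>d. real d) \<and>
           (\<forall>d A b q. pic_instance d A b q \<longrightarrow>
              decides_within M (enc_pic d A b q)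
                (K * (real (length (enc_pic d A b q)) powr (2 powr f d)))
                (pic_answer d A b q)))"
proof
  assume "\<exists>(M::tm) (f::nat \<Rightarrow> real) (K::real). wf_tm M \<and> f \<in> o(\<lambda>d. real d) \<and>
           (\<forall>d A b q. pic_instance d A b q \<longrightarrow>
              decides_within M (enc_pic d A b q)
                (K * (real (length (enc_pic d A b q)) powr (2 powr f d)))
                (pic_answer d A b q))"
  then obtain M f K where M: "wf_tm M" and f: "f \<in> o(\<lambda>d. real d)"
    and dec: "\<And>d A b q. pic_instance d A b q \<Longrightarrow>
       decides_within M (enc_pic d A b q) (K * (real (length (enc_pic d A b q)) powr (2 powr f d))) (pic_answer d A b q)"
    by blast
  obtain M' a where M': "wf_tm M'"
    "\<And>n cls T b. is_3cnf n cls \<Longrightarrow> decides_within M (gsem g_main (gen_env (clause_string cls))) T b \<Longrightarrow>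
       decides_within M' (enc_3sat n cls) (real ((length (enc_3sat n cls) + 2) ^ a) + 2 * T) b"
    by (rule reduction_tm[OF M ok_g_main]) blast
  obtain s where s: "\<And>n cls. is_3cnf n cls \<Longrightarrow> length (enc_3sat n cls) + 2 \<le> (n + 2) ^ s"
    by (rule length_enc_3sat) blast
  obtain a2 where a2: "\<And>S. cost g_main S \<le> (S + 2) ^ a2"
    by (rule poly_bounded_funD[OF poly_bounded_cost]) blast
  \<comment> \<open>With X = n + 2, \<open>dims_bound\<close> and L + 2 <= X^s give 2^d <= 4 X^(4 s)
    <= X^r. The choice of \<open>\<epsilon>\<close> then turns 2^(\<open>\<epsilon>\<close> d) into
    at most X^(1/2).\<close>
  define r where "r = s * 4 + 2"
  define \<epsilon> :: real where "\<epsilon> = 1 / (2 * real r)"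
  have r: "0 < r" "0 < \<epsilon>" by (simp_all add: r_def \<epsilon>_def)
  obtain F0 where F0: "0 \<le> F0" "\<And>d. f d \<le> \<epsilon> * real d + F0"
    by (rule little_o_linear_bound[OF f r(2)]) blast
  \<comment> \<open>The instance has length at most X^(s a2), and 2^f(d) is at most 2^F0 X^(1/2); C
    collects the constant factors of the exponent. The added 1 makes it positive.\<close>
  define C where "C = real (s * a2 + 1) * 2 powr F0"
  have C: "0 < C" unfolding C_def by (intro mult_pos_pos) (simp_all only: of_nat_0_less_iff, simp_all)
  have bound: "decides_within M' (enc_3sat n cls)
      ((real n + 2) ^ (s * a) + 2 * \<bar>K\<bar> * (real n + 2) powr (C * (real n + 2) powr (1/2))) (cnf_sat cls)"
    if cnf: "is_3cnf n cls" for n cls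
  proof -
    let ?F = "clause_string cls" and ?L = "length (enc_3sat n cls)"
    define X where "X = real n + 2"
    have X: "2 \<le> X" by (simp add: X_def)
    have L: "real (?L + 2) \<le> X ^ s"
      using of_nat_mono[OF s[OF cnf], where 'a = real] by (simp add: X_def add.commute)
    obtain A b q where Abq: "gsem g_main (gen_env ?F) = enc_pic (2 * dims ?F + 2) A b q"
      "pic_instance (2 * dims ?F + 2) A b q" "pic_answer (2 * dims ?F + 2) A b q \<longleftrightarrow> selectable ?F"
      using reduction_correct[OF clause_string_symbols] by blast
    have sat: "selectable ?F \<longleftrightarrow> cnf_sat cls"
      by (rule selectable_iff_sat) (use cnf in \<open>auto simp: is_3cnf_def\<close>)
    let ?d = "2 * dims ?F + 2" and ?l = "real (length (enc_pic (2 * dims ?F + 2) A b q))"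
    define T where "T = K * ?l powr (2 powr f ?d)"
    have "decides_within M (gsem g_main (gen_env ?F)) T (cnf_sat cls)"
      using dec[OF Abq(2)] unfolding Abq(1,3) sat T_def .
    then have main: "decides_within M' (enc_3sat n cls) (real ((?L + 2) ^ a) + 2 * T) (cnf_sat cls)"
      by (rule M'(2)[OF cnf])
    have t1: "real ((?L + 2) ^ a) \<le> X ^ (s * a)"
      using power_mono[OF L, of a] by (simp add: power_mult)
    have l: "?l \<le> X ^ (s * a2)"
    proof -
      have "length (gsem g_main (gen_env ?F)) \<le> cost g_main ?L"
        by (rule length_gsem[OF ok_g_main]) (use length_clause_string[of cls n] in \<open>auto simp: gen_env_def\<close>)
      also have "\<dots> \<le> (?L + 2) ^ a2" by (rule a2)
      finally have "?l \<le> real (?L + 2) ^ a2" unfolding Abq(1) by (metis of_nat_mono of_nat_power)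
      also have "\<dots> \<le> (X ^ s) ^ a2" using L by (intro power_mono) auto
      finally show ?thesis by (simp add: power_mult)
    qed
    have l1: "1 \<le> ?l" by (simp add: enc_pic_def enc_ints_def enc_int_def)
    have fd: "2 powr f ?d \<le> 2 powr F0 * X powr (1/2)"
    proof -
      have d: "2 powr real ?d \<le> X powr real r"
      proof -
        have "2 powr real ?d = real (2 ^ ?d)" by (subst powr_realpow) simp_all
        also have "\<dots> \<le> real (4 * (?L + 2) ^ 4)"
          using dims_bound[OF length_clause_string] by (intro of_nat_mono)
        also have "\<dots> = 4 * real (?L + 2) ^ 4" by simp
        also have "\<dots> \<le> X ^ 2 * (X ^ s) ^ 4"
        proof (rule mult_mono)
          show "4 \<le> X ^ 2" using power_mono[OF X, of 2] by simp
          show "real (?L + 2) ^ 4 \<le> (X ^ s) ^ 4" using L by (intro power_mono) auto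
        qed (use X in auto)
        also have "\<dots> = X ^ r" by (simp add: r_def power_mult power_add mult.commute power2_eq_square)
        also have "\<dots> = X powr real r" using X by (simp add: powr_realpow)
        finally show ?thesis .
      qed
      have "2 powr f ?d \<le> 2 powr (\<epsilon> * real ?d + F0)" using F0(2)[of ?d] by simp
      also have "\<dots> = (2 powr real ?d) powr \<epsilon> * 2 powr F0" by (simp only: powr_add powr_powr mult.commute[of \<epsilon>])
      also have "\<dots> \<le> (X powr real r) powr \<epsilon> * 2 powr F0"
        using d r by (intro mult_right_mono powr_mono2) auto
      also have "\<dots> = X powr (1/2) * 2 powr F0" using r by (simp add: powr_powr \<epsilon>_def)
      finally show ?thesis by (simp add: mult.commute)
    qed
    have "?l powr (2 powr f ?d) \<le> X powr (C * X powr (1/2))"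
    proof -
      have "?l powr (2 powr f ?d) \<le> (X ^ (s * a2 + 1)) powr (2 powr f ?d)"
      proof (rule powr_mono2)
        have "X ^ (s * a2) \<le> X ^ (s * a2 + 1)" using X by (intro power_increasing) auto
        then show "?l \<le> X ^ (s * a2 + 1)" using l by linarith
      qed auto
      also have "\<dots> \<le> (X ^ (s * a2 + 1)) powr (2 powr F0 * X powr (1/2))"
      proof (rule powr_mono[OF fd])
        show "1 \<le> X ^ (s * a2 + 1)" using X by (intro one_le_power) auto
      qed
      also have "\<dots> = X powr (real (s * a2 + 1) * (2 powr F0 * X powr (1/2)))"
      proof -
        have "X ^ (s * a2 + 1) = X powr real (s * a2 + 1)" using X by (subst powr_realpow) auto
        then show ?thesis by (simp only: powr_powr)
      qed
      finally show ?thesis by (simp add: C_def mult.assoc)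
    qed
    \<comment> \<open>The constant K of the assumed algorithm may be negative, so the estimate
      passes to its absolute value.\<close>
    then have "\<bar>K\<bar> * ?l powr (2 powr f ?d) \<le> \<bar>K\<bar> * X powr (C * X powr (1/2))" by (intro mult_left_mono) auto
    moreover have "T \<le> \<bar>K\<bar> * ?l powr (2 powr f ?d)" unfolding T_def by (intro mult_right_mono) auto
    ultimately have "real ((?L + 2) ^ a) + 2 * T \<le> X ^ (s * a) + 2 * \<bar>K\<bar> * X powr (C * X powr (1/2))"
      using t1 by linarith
    then show ?thesis using decides_within_mono[OF main] by (simp add: X_def)
  qed
  \<comment> \<open>The machine \<open>M'\<close> and its bound do not depend on c, so one machine
    refutes the lower bound of ETH for every positive c.\<close>
  have "\<exists>M K. wf_tm M \<and> (\<forall>n cls. is_3cnf n cls \<longrightarrow> decides_within M (enc_3sat n cls) (K * 2 powr (c * real n)) (cnf_sat cls))"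
    if c: "0 < c" for c :: real
  proof -
    obtain K' where K': "\<And>n::nat. (real n + 2) ^ (s * a) + 2 * \<bar>K\<bar> * (real n + 2) powr (C * (real n + 2) powr (1/2)) \<le> K' * 2 powr (c * real n)"
      by (rule subexponential_bound[OF c C]) blast
    show ?thesis using M'(1) decides_within_mono[OF bound K'] by blast
  qed
  then show False using assms unfolding ETH_def by blast
qed

end
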